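(* Let $f\in\mathcal{S}$ (or, alternatively, $f\in\mathcal{S}^*$), let $F=f^{-1}$ be its inverse function near the origin, and let $\Gamma_n(F)$ be the logarithmic inverse coefficients. Then for every integer $n\ge 1$, $$|\Gamma_n(F)|\le \frac{1}{2n}\binom{2n}{n},$$ and the inequality is sharp. Equality is attained if and only if $f$ is the Koebe function $k(z)=z/(1-z)^2$ or one of its rotations.
   Context: Let $\mathbb{D}=\{z\in\mathbb{C}:|z|<1\}$. $\mathcal{S}$ is the class of analytic univalent functions $f$ in $\mathbb{D}$ with $f(z)=z+\sum_{n\ge2}a_nz^n$. $\mathcal{S}^*$ is the class of $f\in\mathcal{S}$ such that $f(\mathbb{D})$ is starlike with respect to the origin. A rotation of $f$ is a function $z\mapsto e^{-i\theta}f(e^{i\theta}z)$ with $\theta\in\mathbb{R}$. For $f\in\mathcal{S}$, the inverse function is $F(w)=f^{-1}(w)=w+\sum_{n\ge2}A_nw^n$ for $|w|<1/4$, and the logarithmic inverse coefficients $\Gamma_n(F)$ are defined by $\log\left(F(w)/w\right)=2\sum_{n=1}^\infty\Gamma_n(F)w^n$ for $|w|<1/4$ (branch of the logarithm with value $0$ at $w=0$). *)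

theory Defs
  imports "HOL-Complex_Analysis.Complex_Analysis"
begin

definition class_S :: "(complex \<Rightarrow> complex) set" where
  "class_S = {f. f analytic_on ball 0 1 \<and> inj_on f (ball 0 1) \<and> f 0 = 0 \<and> deriv f 0 = 1}"

text \<open>The origin lies in the image of every \<open>f \<in> class_S\<close>, so the condition below is
  starlikeness of the image with respect to the origin.\<close>

definition class_S_star :: "(complex \<Rightarrow> complex) set" where
  "class_S_star = {f \<in> class_S. \<forall>w \<in> f ` ball 0 1. closed_segment 0 w \<subseteq> f ` ball 0 1}"

definition koebe :: "complex \<Rightarrow> complex" where
  "koebe z = z / (1 - z)\<^sup>2"

text \<open>Only the values on the unit disc matter: HOL functions are total, and nothing is assumed
  about them outside the disc.\<close>

definition is_rotation_of :: "(complex \<Rightarrow> complex) \<Rightarrow> (complex \<Rightarrow> complex) \<Rightarrow> bool" where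
  "is_rotation_of g f \<longleftrightarrow>
     (\<exists>\<theta>::real. \<forall>z \<in> ball 0 1. g z = exp (- \<i> * of_real \<theta>) * f (exp (\<i> * of_real \<theta>) * z))"

definition inverse_fun :: "(complex \<Rightarrow> complex) \<Rightarrow> complex \<Rightarrow> complex" where
  "inverse_fun f = inv_into (ball 0 1) f"

definition is_log_inverse_branch ::
    "(complex \<Rightarrow> complex) \<Rightarrow> (complex \<Rightarrow> complex) \<Rightarrow> bool" where
  "is_log_inverse_branch f L \<longleftrightarrow>
     L holomorphic_on ball 0 (1/4) \<and> L 0 = 0 \<and>
     (\<forall>w \<in> ball 0 (1/4) - {0}. exp (L w) = inverse_fun f w / w)"

text \<open>The branch is unique on the disc of radius \<open>1/4\<close>, so the coefficients do not depend on the
  choice; see \<open>log_inverse_branch_unique\<close> and \<open>log_inverse_coeff_sums\<close> below.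
  For \<open>f \<in> class_S\<close> a branch exists because the image of \<open>f\<close> contains that disc.\<close>

definition log_inverse_coeff :: "(complex \<Rightarrow> complex) \<Rightarrow> nat \<Rightarrow> complex" where
  "log_inverse_coeff f n =
     (deriv ^^ n) (SOME L. is_log_inverse_branch f L) 0 / (2 * fact n)"

lemma log_inverse_branch_unique:
  assumes L: "is_log_inverse_branch f L" and M: "is_log_inverse_branch f M"
    and w: "w \<in> ball 0 (1/4)"
  shows "L w = M w"
proof -
  let ?B = "ball 0 (1/4) :: complex set"
  define h where "h = (\<lambda>z. L z - M z)"
  have hol: "h holomorphic_on ?B"
    using L M unfolding h_def is_log_inverse_branch_def by (intro holomorphic_intros) auto
  have exp1: "exp (h z) = 1" if "z \<in> ?B" for z
  proof (cases "z = 0")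
    case True
    then show ?thesis using L M by (simp add: h_def is_log_inverse_branch_def)
  next
    case False
    then have "exp (L z) = exp (M z)"
      using L M that by (simp add: is_log_inverse_branch_def)
    then show ?thesis by (simp add: h_def exp_diff)
  qed
  have der0: "(h has_field_derivative 0) (at z)" if z: "z \<in> ?B" for z
  proof -
    have d: "(h has_field_derivative deriv h z) (at z)"
      using hol z by (intro holomorphic_derivI[of h ?B]) auto
    have "((\<lambda>z. exp (h z)) has_field_derivative exp (h z) * deriv h z) (at z)"
      using d by (auto intro!: derivative_eq_intros)
    moreover have "((\<lambda>z. exp (h z)) has_field_derivative 0) (at z)"
      by (rule has_field_derivative_transform_within_open[of "\<lambda>_. 1" 0 z ?B])
        (use z exp1 in auto)
    ultimately have "exp (h z) * deriv h z = 0" by (rule DERIV_unique)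
    then show ?thesis using d by simp
  qed
  have "\<exists>c. \<forall>z \<in> ?B. h z = c"
    by (rule has_field_derivative_zero_constant)
      (use der0 in \<open>auto intro: has_field_derivative_at_within\<close>)
  then have "h w = h 0" using w by auto
  then show ?thesis using L M by (simp add: h_def is_log_inverse_branch_def)
qed

lemma log_inverse_coeff_sums:
  assumes L: "is_log_inverse_branch f L" and w: "w \<in> ball 0 (1/4)"
  shows "(\<lambda>n. 2 * log_inverse_coeff f (Suc n) * w ^ Suc n) sums L w"
proof -
  define M where "M = (SOME L. is_log_inverse_branch f L)"
  have M: "is_log_inverse_branch f M"
    unfolding M_def by (rule someI[of _ L]) (rule L)
  have "(\<lambda>n. (deriv ^^ n) M 0 / fact n * (w - 0) ^ n) sums M w"
    by (rule holomorphic_power_series[of _ _ "1/4"])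
      (use M w in \<open>auto simp: is_log_inverse_branch_def\<close>)
  then have "(\<lambda>n. (deriv ^^ Suc n) M 0 / fact (Suc n) * w ^ Suc n) sums M w"
    using M by (subst sums_Suc_iff) (simp add: is_log_inverse_branch_def)
  moreover have "(deriv ^^ n) M 0 / fact n = 2 * log_inverse_coeff f n" for n
    by (simp add: log_inverse_coeff_def M_def)
  ultimately show ?thesis
    using log_inverse_branch_unique[OF M L w] by (simp only:)
qed

end

theory Submission
  imports Defs
begin

text \<open>
  Let \<open>F\<close> be the inverse of \<open>f\<close> and write \<open>w / F(w) = 1 - S(w)\<close>. Then
  \<open>log (F(w)/w) = - log (1 - S) = S + S\<^sup>2/2 + S\<^sup>3/3 + \<dots>\<close>, so the logarithmic inverse coefficients
  are polynomials with nonnegative coefficients in the coefficients of \<open>S\<close>. For the function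
  \<open>z / (1 + z)\<^sup>2\<close>, a rotation of the Koebe function, the coefficients of \<open>S\<close> are nonnegative and
  the resulting coefficients of the logarithm are central binomial coefficients divided by \<open>n\<close>. Hence
  it is enough to show that the series \<open>S\<close> of this function majorizes the series \<open>S\<close> of every \<open>f\<close> in
  the class (\<open>class_S_slope_bound\<close>).

  The series \<open>S\<close> is the right quantity because it is additive under composition: passing from a
  univalent self-map \<open>h\<close> of the disc to \<open>h \<circ> g\<close> adds to \<open>S\<close> a term that is built from the
  coefficients of \<open>z / g(z)\<close> and from the inverse of \<open>h \<circ> g\<close>, and the coefficient of degree \<open>k\<close> of
  that term involves only coefficients of lower degree. If \<open>g\<close> is nearly a rotation,
  \<open>\<bar>g'(0)\<bar> = \<alpha>\<close> with \<open>\<alpha>\<close> near \<open>1\<close>, then Caratheodory's positivity argument bounds all coefficients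
  of \<open>g(z)/z\<close> after the first by \<open>2 (1 - \<alpha>)\<close>, and a majorant of \<open>S\<close> with a factor \<open>\<kappa> > 1\<close> to spare
  survives the step (\<open>slope_bounded_compose\<close>). This is Loewner's argument in discrete form. Instead of
  a Loewner chain it uses an induction principle (\<open>disc_univalent_induct\<close>): every univalent self-map
  of the disc that fixes the origin is reached from the identity by composing with maps that are nearly rotations and by
  taking limits. Its proof minimises \<open>\<bar>h'(0)\<bar>\<close> over the maps \<open>h\<close> already reached whose image contains
  the image of the given map. If the minimiser did not have the same image, one could insert an
  intermediate simply connected domain of nearly the same conformal radius and do better.
  A function of the class is treated by applying the result to \<open>f(rz)/M\<close> and letting \<open>r\<close> and \<open>\<kappa>\<close> tend
  to \<open>1\<close>. The bound for the second coefficient \<open>a\<^sub>2\<close> gives the Koebe quarter theorem, which makes the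
  branch of the logarithm exist.

  For the equality statement, the monomial \<open>(S\<^sub>1)\<^sup>n / n\<close> is split off from the polynomial above. The
  bound improves by \<open>(2\<^sup>n - \<bar>a\<^sub>2\<bar>\<^sup>n) / n\<close> (\<open>class_S_log_inverse_coeff_bound\<close>), so equality forces
  \<open>\<bar>a\<^sub>2\<bar> = 2\<close>. It remains to see that only rotations of the Koebe function satisfy this. The square-root
  transform \<open>g(z) = sqrt (f(z\<^sup>2))\<close> turns \<open>a\<^sub>2 = -2\<close> into the extremal case \<open>S\<^sub>2 = 1\<close> for \<open>g\<close>. The same
  induction, applied to a linear functional of \<open>S\<^sub>1\<close> and \<open>S\<^sub>2\<close> (\<open>quad_bounded\<close>), shows that \<open>S\<^sub>2 = 1\<close>
  forces \<open>S\<^sub>1\<close> to be real. Since \<open>S\<^sub>2\<close> does not change when an omitted value of \<open>g\<close> is sent to infinity,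
  while \<open>S\<^sub>1\<close> is shifted by the reciprocal of that value, all reciprocals of omitted values of \<open>g\<close> lie
  in the real interval from \<open>-2\<close> to \<open>2\<close>. So every value that \<open>g\<close> omits is omitted by \<open>z / (1 + z\<^sup>2)\<close> as
  well, and Schwarz's lemma identifies the two functions.
\<close>

section \<open>The inverse Koebe series\<close>

text \<open>
  With \<open>c = 1\<close> the series \<open>T\<close> is the inverse of \<open>z / (1 + z)\<^sup>2\<close>, and other values of \<open>c\<close> give its
  rotations. The series \<open>1 - S\<close> is the quotient \<open>c w / T(w)\<close>, expressed without a division.
\<close>
lemma koebe_series_relation:
  fixes T :: "'a :: field_char_0 fps"
  assumes T: "T = fps_const c * fps_X * (1 + T)\<^sup>2"
  defines "S \<equiv> fps_const c * fps_X * (2 + T)"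
  shows "(1 - S) * T = fps_const c * fps_X"
proof -
  let ?c = "fps_const c"
  have "(1 - S) * T = T - ?c * fps_X * (2 * T + T\<^sup>2)"
    by (simp add: S_def algebra_simps power2_eq_square)
  also have "\<dots> = ?c * fps_X * (1 + T)\<^sup>2 - ?c * fps_X * (2 * T + T\<^sup>2)"
    using T by simp
  finally show ?thesis by (simp add: algebra_simps power2_eq_square)
qed

lemma deriv_koebe_series:
  fixes T :: "'a :: field_char_0 fps"
  assumes T: "T = fps_const c * fps_X * (1 + T)\<^sup>2"
  defines "S \<equiv> fps_const c * fps_X * (2 + T)"
  shows "fps_deriv S * (1 - T) = 2 * fps_const c"
proof -
  let ?c = "fps_const c"
  have "fps_deriv T = fps_deriv (?c * fps_X * (1 + T)\<^sup>2)" using T by simp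
  also have "\<dots> = ?c * (1 + T)\<^sup>2 + 2 * (?c * fps_X * (1 + T) * fps_deriv T)"
    by (simp add: power2_eq_square algebra_simps)
  finally have "(1 + T) * fps_deriv T
      = (1 + T) * (?c * (1 + T)\<^sup>2 + 2 * (?c * fps_X * (1 + T) * fps_deriv T))" by simp
  also have "\<dots> = ?c * (1 + T) ^ 3 + 2 * (?c * fps_X * (1 + T)\<^sup>2) * fps_deriv T"
    by (simp add: algebra_simps power2_eq_square power3_eq_cube)
  also have "?c * fps_X * (1 + T)\<^sup>2 = T" using T by simp
  finally have T': "fps_deriv T * (1 - T) = ?c * (1 + T) ^ 3" by (simp add: algebra_simps)
  have "fps_deriv S * (1 - T) = ?c * ((2 + T) * (1 - T)) + ?c * fps_X * (fps_deriv T * (1 - T))"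
    by (simp only: S_def fps_deriv_mult fps_deriv_fps_X fps_deriv_add fps_deriv_numeral fps_deriv_const)
      (simp add: algebra_simps)
  also have "?c * fps_X * (fps_deriv T * (1 - T)) = ?c * ((?c * fps_X * (1 + T)\<^sup>2) * (1 + T))"
    by (simp only: T' power2_eq_square power3_eq_cube mult_ac)
  also have "?c * fps_X * (1 + T)\<^sup>2 = T" using T by simp
  finally show ?thesis by (simp add: algebra_simps)
qed

text \<open>
  The series is the derivative of \<open>- log (1 - S)\<close>. Adding \<open>1\<close> to \<open>X\<close> times it gives
  \<open>Q = (1 + T) / (1 - T)\<close>, whose square is \<open>1 / (1 - 4 c X)\<close>. The differential equation of an inverse
  square root then yields the recursion of the central binomial coefficients.
\<close>
lemma koebe_series_log_coeff:
  fixes T :: "'a :: field_char_0 fps"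
  assumes T0: "fps_nth T 0 = 0" and T: "T = fps_const c * fps_X * (1 + T)\<^sup>2" and n: "n \<ge> 1"
  defines "S \<equiv> fps_const c * fps_X * (2 + T)"
  shows "fps_nth (fps_deriv S * inverse (1 - S)) (n - 1) = c ^ n * of_nat ((2 * n) choose n)"
proof -
  let ?c = "fps_const c"
  define N where "N = fps_deriv S * inverse (1 - S)"
  define Q where "Q = 1 + fps_X * N"
  have S0: "fps_nth S 0 = 0" by (simp add: S_def)
  have inv: "inverse (1 - S) * (1 - S) = 1" by (rule inverse_mult_eq_1) (simp add: S0)
  have nz: "1 - T \<noteq> 0"
  proof
    assume "1 - T = 0"
    then have "fps_nth (1 - T) 0 = 0" by simp
    then show False by (simp add: T0)
  qed
  have QT: "Q * (1 - T) = 1 + T"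
  proof -
    have "T = (inverse (1 - S) * (1 - S)) * T" using inv by simp
    also have "\<dots> = inverse (1 - S) * ((1 - S) * T)" by (rule mult.assoc)
    also have "(1 - S) * T = ?c * fps_X" unfolding S_def by (rule koebe_series_relation[OF T])
    finally have Tc: "T = inverse (1 - S) * (?c * fps_X)" .
    have "fps_X * N * (1 - T) = (fps_deriv S * (1 - T)) * (fps_X * inverse (1 - S))"
      by (simp add: N_def mult_ac)
    also have "fps_deriv S * (1 - T) = 2 * ?c" unfolding S_def by (rule deriv_koebe_series[OF T])
    also have "2 * ?c * (fps_X * inverse (1 - S)) = 2 * (inverse (1 - S) * (?c * fps_X))"
      by (simp only: mult_ac)
    also have "\<dots> = 2 * T" using Tc by simp
    finally have "fps_X * N * (1 - T) = 2 * T" .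
    then show ?thesis by (simp add: Q_def ring_distribs)
  qed
  have "(Q\<^sup>2 * (1 - 4 * (?c * fps_X))) * (1 - T)\<^sup>2 = (1 - 4 * (?c * fps_X)) * (1 + T)\<^sup>2"
    by (simp add: QT [symmetric] power_mult_distrib mult_ac)
  also have "\<dots> = (1 + T)\<^sup>2 - 4 * (?c * fps_X * (1 + T)\<^sup>2)" by (simp add: algebra_simps)
  also have "\<dots> = (1 - T)\<^sup>2"
    by (subst T [symmetric]) (simp add: power2_eq_square algebra_simps)
  finally have Q2: "Q\<^sup>2 * (1 - 4 * (?c * fps_X)) = 1" using nz by simp
  have "0 = fps_deriv (Q\<^sup>2 * (1 - 4 * (?c * fps_X)))" by (simp add: Q2)
  also have "\<dots> = 2 * Q * (fps_deriv Q * (1 - 4 * (?c * fps_X)) - 2 * (?c * Q))"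
    by (simp add: power2_eq_square algebra_simps)
  finally have "2 * Q * (fps_deriv Q * (1 - 4 * (?c * fps_X)) - 2 * (?c * Q)) = 0" by simp
  moreover have "Q \<noteq> 0" using Q2 by auto
  ultimately have ode: "fps_deriv Q * (1 - 4 * (?c * fps_X)) = 2 * (?c * Q)" by simp
  have rec: "of_nat (Suc k) * fps_nth Q (Suc k) = c * of_nat (4 * k + 2) * fps_nth Q k" for k
  proof -
    have "fps_nth (fps_deriv Q * (1 - 4 * (?c * fps_X))) k = fps_nth (2 * (?c * Q)) k" using ode by simp
    moreover have "fps_deriv Q * (1 - 4 * (?c * fps_X)) = fps_deriv Q - 4 * (?c * (fps_X * fps_deriv Q))"
      by (simp add: algebra_simps)
    moreover have "fps_nth (4 * (?c * (fps_X * fps_deriv Q))) k = 4 * (c * (of_nat k * fps_nth Q k))"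
      unfolding numeral_fps_const fps_mult_left_const_nth by (cases k) auto
    moreover have "fps_nth (2 * (?c * Q)) k = 2 * (c * fps_nth Q k)"
      unfolding numeral_fps_const fps_mult_left_const_nth ..
    ultimately have "fps_nth (fps_deriv Q) k - 4 * (c * (of_nat k * fps_nth Q k)) = 2 * (c * fps_nth Q k)"
      by (metis fps_sub_nth)
    then show ?thesis by (simp add: algebra_simps)
  qed
  have "fps_nth Q k = c ^ k * of_nat ((2 * k) choose k)" for k
  proof (induction k)
    case 0 show ?case by (simp add: Q_def)
  next
    case (Suc k)
    have b: "Suc k * ((2 * Suc k) choose Suc k) = (4 * k + 2) * ((2 * k) choose k)"
    proof -
      have "Suc k * (Suc (Suc (2*k)) choose Suc k) = Suc (Suc (2*k)) * (Suc (2*k) choose k)"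
        using Suc_times_binomial[of k "Suc (2*k)"] by simp
      moreover have "(Suc (2*k) choose k) = (Suc (2*k) choose Suc k)"
        using binomial_symmetric[of k "Suc (2*k)"] by simp
      moreover have "Suc k * (Suc (2*k) choose Suc k) = Suc (2*k) * ((2*k) choose k)"
        using Suc_times_binomial[of k "2*k"] by simp
      ultimately have "Suc k * (Suc k * (Suc (Suc (2*k)) choose Suc k))
          = Suc (Suc (2*k)) * (Suc (2*k) * ((2*k) choose k))"
        by (metis mult.left_commute)
      also have "\<dots> = Suc k * ((4 * k + 2) * ((2 * k) choose k))" by (simp add: algebra_simps)
      finally have "Suc k * (Suc (Suc (2*k)) choose Suc k) = (4 * k + 2) * ((2 * k) choose k)"
        by (simp only: Suc_mult_cancel1)
      moreover have "2 * Suc k = Suc (Suc (2*k))" by simp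
      ultimately show ?thesis by (simp only:)
    qed
    have "of_nat (Suc k) * fps_nth Q (Suc k) = c ^ Suc k * of_nat ((4 * k + 2) * ((2 * k) choose k))"
      unfolding rec Suc.IH by (simp only: of_nat_mult power_Suc mult_ac)
    also have "\<dots> = of_nat (Suc k) * (c ^ Suc k * of_nat ((2 * Suc k) choose Suc k))"
      unfolding b [symmetric] by (simp only: of_nat_mult mult_ac)
    finally show ?case by (simp only: mult_cancel_left of_nat_eq_0_iff nat.distinct simp_thms)
  qed
  moreover have "fps_nth Q n = fps_nth N (n - 1)" using n by (cases n) (auto simp: Q_def)
  ultimately show ?thesis by (simp add: N_def)
qed

text \<open>
  The inverse of \<open>z / (1 + z)\<^sup>2\<close>: this rotation of the Koebe function has the advantage that all
  coefficients of its inverse are nonnegative.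
\<close>
definition inv_koebe :: "real fps" where
  "inv_koebe = fps_inv (fps_X * inverse ((1 + fps_X)\<^sup>2))"

text \<open>
  The series \<open>S(w) = 1 - w / F(w)\<close> for \<open>F = inv_koebe\<close> (see \<open>one_minus_maj_slope\<close>).
\<close>
definition maj_slope :: "real fps" where
  "maj_slope = fps_X * (2 + inv_koebe)"

lemma inv_koebe_0 [simp]: "fps_nth inv_koebe 0 = 0"
  by (simp add: inv_koebe_def fps_inv_def)

lemma inv_koebe_eq: "inv_koebe = fps_X * (1 + inv_koebe)\<^sup>2"
proof -
  let ?R = "inverse ((1 + fps_X)\<^sup>2) :: real fps"
  have "(fps_X * ?R) oo inv_koebe = fps_X"
    unfolding inv_koebe_def by (rule fps_inv_right) auto
  moreover have "(fps_X * ?R) oo inv_koebe = inv_koebe * inverse ((1 + inv_koebe)\<^sup>2)"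
    by (simp add: fps_compose_mult_distrib fps_inverse_compose fps_compose_power [symmetric]
        fps_compose_add_distrib)
  moreover have "inverse ((1 + inv_koebe)\<^sup>2) * (1 + inv_koebe)\<^sup>2 = 1"
    by (rule inverse_mult_eq_1) auto
  ultimately show ?thesis by (metis mult.assoc mult.right_neutral)
qed

lemma maj_slope_0 [simp]: "fps_nth maj_slope 0 = 0"
  by (simp add: maj_slope_def)

lemma maj_slope_1 [simp]: "fps_nth maj_slope (Suc 0) = 2"
  by (simp add: maj_slope_def)

lemma inv_koebe_eq': "inv_koebe = fps_const 1 * fps_X * (1 + inv_koebe)\<^sup>2"
  using inv_koebe_eq by simp

lemma one_minus_maj_slope: "(1 - maj_slope) * inv_koebe = fps_X"
  using koebe_series_relation[OF inv_koebe_eq'] by (simp add: maj_slope_def)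

lemma deriv_maj_slope: "fps_deriv maj_slope * (1 - inv_koebe) = 2"
  using deriv_koebe_series[OF inv_koebe_eq'] by (simp add: maj_slope_def)

lemma inv_koebe_nonneg: "fps_nth inv_koebe n \<ge> 0"
proof (induction n rule: less_induct)
  case (less n)
  show ?case
  proof (cases n)
    case (Suc m)
    have nn: "fps_nth (1 + inv_koebe) i \<ge> 0" if "i \<le> m" for i
      using less[of i] that Suc by (cases i) auto
    have "fps_nth inv_koebe n = fps_nth ((1 + inv_koebe)\<^sup>2) m"
      by (subst inv_koebe_eq) (simp add: Suc)
    also have "\<dots> \<ge> 0"
      unfolding power2_eq_square fps_mult_nth using nn by (intro sum_nonneg mult_nonneg_nonneg) (auto simp del: fps_add_nth)
    finally show ?thesis .
  qed simp
qed

lemma maj_slope_nonneg: "fps_nth maj_slope n \<ge> 0"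
  using inv_koebe_nonneg by (cases n) (auto simp: maj_slope_def fps_numeral_nth)

lemma inv_koebe_conv: "fps_X * inverse (1 - maj_slope) = inv_koebe"
proof -
  have "inverse (1 - maj_slope) * (1 - maj_slope) = 1"
    by (rule inverse_mult_eq_1) auto
  then have "inv_koebe = (inverse (1 - maj_slope) * (1 - maj_slope)) * inv_koebe" by simp
  also have "\<dots> = inverse (1 - maj_slope) * ((1 - maj_slope) * inv_koebe)"
    by (rule mult.assoc)
  finally have "inv_koebe = inverse (1 - maj_slope) * fps_X" by (simp only: one_minus_maj_slope)
  then show ?thesis by (simp only: mult.commute)
qed

text \<open>
  The coefficients on the left measure how \<open>maj_slope\<close> grows when the conformal radius changes by an
  infinitesimal amount; the identity is what makes the Koebe function the worst case at every instant.
\<close>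
lemma inverse_one_minus_inv_koebe:
  "fps_nth (inverse (1 - inv_koebe)) n = real (Suc n) * fps_nth maj_slope (Suc n) / 2"
proof -
  have "inverse (1 - inv_koebe) * (1 - inv_koebe) = 1"
    by (rule inverse_mult_eq_1) auto
  then have "fps_deriv maj_slope = fps_deriv maj_slope * (inverse (1 - inv_koebe) * (1 - inv_koebe))"
    by simp
  also have "\<dots> = (fps_deriv maj_slope * (1 - inv_koebe)) * inverse (1 - inv_koebe)"
    by (simp only: mult_ac)
  finally have "fps_deriv maj_slope = 2 * inverse (1 - inv_koebe)"
    by (simp only: deriv_maj_slope)
  then have "fps_nth (fps_deriv maj_slope) n = fps_nth (2 * inverse (1 - inv_koebe)) n"
    by (rule arg_cong)
  then show ?thesis by simp
qed

lemma maj_log_coeff: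
  assumes "n \<ge> 1"
  shows "fps_nth (fps_deriv maj_slope * inverse (1 - maj_slope)) (n - 1) = real ((2 * n) choose n)"
  using koebe_series_log_coeff[OF inv_koebe_0 inv_koebe_eq' assms] by (simp add: maj_slope_def)

section \<open>Majorants and slopes of formal power series\<close>

text \<open>
  The parameter \<open>\<mu>\<close> stands for the substitution of \<open>\<mu> X\<close> in the majorant. The truncation at degree
  \<open>n\<close> matters: bounds are proved by induction on the degree.
\<close>
definition majorized :: "real \<Rightarrow> nat \<Rightarrow> complex fps \<Rightarrow> real fps \<Rightarrow> bool" where
  "majorized \<mu> n A B \<longleftrightarrow> (\<forall>k\<le>n. norm (fps_nth A k) \<le> fps_nth B k * \<mu> ^ k)"

lemma majorized_nonneg: "majorized \<mu> n A B \<Longrightarrow> k \<le> n \<Longrightarrow> 0 \<le> fps_nth B k * \<mu> ^ k"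
  unfolding majorized_def using norm_ge_zero order_trans by blast

lemma majorized_mult:
  assumes "majorized \<mu> n A B" "majorized \<mu> n A' B'"
  shows "majorized \<mu> n (A * A') (B * B')"
  unfolding majorized_def
proof (intro allI impI)
  fix k assume k: "k \<le> n"
  have "norm (fps_nth (A * A') k) \<le> (\<Sum>i=0..k. norm (fps_nth A i) * norm (fps_nth A' (k - i)))"
    unfolding fps_mult_nth by (rule order_trans[OF norm_sum]) (simp add: norm_mult)
  also have "\<dots> \<le> (\<Sum>i=0..k. (fps_nth B i * \<mu> ^ i) * (fps_nth B' (k - i) * \<mu> ^ (k - i)))"
    using assms k majorized_nonneg[OF assms(1)]
    by (intro sum_mono mult_mono) (auto simp: majorized_def)
  also have "\<dots> = (\<Sum>i=0..k. fps_nth B i * fps_nth B' (k - i) * \<mu> ^ k)"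
    by (intro sum.cong) (auto simp flip: power_add)
  finally show "norm (fps_nth (A * A') k) \<le> fps_nth (B * B') k * \<mu> ^ k"
    by (simp add: fps_mult_nth sum_distrib_right)
qed

lemma majorized_power: "majorized \<mu> n A B \<Longrightarrow> majorized \<mu> n (A ^ i) (B ^ i)"
proof (induction i)
  case 0 then show ?case by (simp add: majorized_def)
next
  case (Suc i) then show ?case by (auto intro: majorized_mult)
qed

lemma majorized_compose:
  assumes "majorized 1 n D E" "majorized \<mu> n A B"
  shows "majorized \<mu> n (D oo A) (E oo B)"
  unfolding majorized_def
proof (intro allI impI)
  fix k assume k: "k \<le> n"
  have "norm (fps_nth (D oo A) k) \<le> (\<Sum>i=0..k. norm (fps_nth D i) * norm (fps_nth (A ^ i) k))"
    unfolding fps_compose_nth by (rule order_trans[OF norm_sum]) (simp add: norm_mult)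
  also have "\<dots> \<le> (\<Sum>i=0..k. fps_nth E i * (fps_nth (B ^ i) k * \<mu> ^ k))"
    using assms(1) majorized_power[OF assms(2)] k majorized_nonneg[OF assms(1)]
    by (intro sum_mono mult_mono) (auto simp: majorized_def)
  finally show "norm (fps_nth (D oo A) k) \<le> fps_nth (E oo B) k * \<mu> ^ k"
    by (simp add: fps_compose_nth sum_distrib_right mult.assoc)
qed

lemma inverse_one_minus_fps:
  fixes S :: "'a :: field fps"
  assumes "fps_nth S 0 = 0"
  shows "inverse (1 - S) = Abs_fps (\<lambda>_. 1) oo S"
proof -
  have "inverse (1 - fps_X) = Abs_fps (\<lambda>_. 1 :: 'a)"
    by (rule fps_inverse_unique) (simp add: fps_eq_iff fps_mult_nth ring_distribs sum_subtractf)
  moreover have "inverse (1 - fps_X) oo S = inverse (1 - S)"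
    using assms by (simp add: fps_inverse_compose fps_compose_sub_distrib)
  ultimately show ?thesis by simp
qed

lemma majorized_inverse:
  assumes "majorized \<mu> n S T" "fps_nth S 0 = 0" "fps_nth T 0 = 0"
  shows "majorized \<mu> n (inverse (1 - S)) (inverse (1 - T))"
  unfolding inverse_one_minus_fps[OF assms(2)] inverse_one_minus_fps[OF assms(3)]
  by (rule majorized_compose[OF _ assms(1)]) (simp add: majorized_def)

text \<open>
  If \<open>\<Psi>\<close> is the compositional inverse of \<open>A\<close>, this is the series \<open>X / \<Psi>\<close>, by
  \<open>fps_inv_mult_slope\<close>. Defining it through \<open>A(z)/z\<close> at \<open>z = \<Psi>\<close> avoids a division. When \<open>A\<close> starts with
  \<open>b z\<close>, it equals \<open>b (1 - S)\<close> in the notation of the introduction.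
\<close>
definition slope :: "complex fps \<Rightarrow> complex fps" where
  "slope A = fps_shift 1 A oo fps_inv A"

lemma fps_inv_0 [simp]: "fps_nth (fps_inv A) 0 = 0"
  by (simp add: fps_inv_def)

lemma slope_0 [simp]: "fps_nth (slope A) 0 = fps_nth A 1"
  by (simp add: slope_def)

lemma fps_inv_mult_slope:
  assumes "fps_nth A 0 = 0" "fps_nth A 1 \<noteq> 0"
  shows "fps_inv A * slope A = fps_X"
proof -
  have "A = fps_X * fps_shift 1 A"
    using assms(1) by (simp add: fps_eq_iff)
  then have "A oo fps_inv A = fps_inv A * (fps_shift 1 A oo fps_inv A)"
    by (metis fps_X_fps_compose_startby0 fps_compose_mult_distrib fps_inv_0)
  then show ?thesis
    using fps_inv_right[OF assms] by (simp add: slope_def)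
qed

text \<open>
  Let \<open>\<Psi>\<close> and \<open>\<Psi>'\<close> invert \<open>A\<close> and the composition. Then \<open>\<Psi> = \<Psi>' B(\<Psi>')\<close>, and \<open>X / \<Psi>\<close> is
  compared with \<open>X / \<Psi>'\<close>.
\<close>
lemma slope_compose:
  assumes A: "fps_nth A 0 = 0" "fps_nth A 1 \<noteq> 0" and B: "fps_nth B 0 \<noteq> 0"
  shows "slope A = slope (A oo (fps_X * B)) * (inverse B oo fps_inv (A oo (fps_X * B)))"
proof -
  define C where "C = A oo (fps_X * B)"
  define \<Psi> where "\<Psi> = fps_inv C"
  have C0: "fps_nth C 0 = 0" by (simp add: C_def A)
  have "fps_nth C 1 = fps_nth A 1 * fps_nth B 0"
    by (simp add: C_def fps_compose_nth)
  then have C1: "fps_nth C 1 \<noteq> 0" using A B by simp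
  have \<Psi>0: "fps_nth \<Psi> 0 = 0" by (simp add: \<Psi>_def)
  have "A oo ((fps_X * B) oo \<Psi>) = fps_X"
    using fps_inv_right[OF C0 C1] \<Psi>0 by (simp add: C_def \<Psi>_def fps_compose_assoc)
  then have "fps_inv A oo (A oo ((fps_X * B) oo \<Psi>)) = fps_inv A"
    by simp
  then have "(fps_X * B) oo \<Psi> = fps_inv A"
    using fps_inv[OF A] \<Psi>0 A by (simp add: fps_compose_assoc)
  then have eq: "fps_inv A = \<Psi> * (B oo \<Psi>)"
    using \<Psi>0 by (simp add: fps_compose_mult_distrib)
  have "\<Psi> * slope C = \<Psi> * ((B oo \<Psi>) * slope A)"
    using fps_inv_mult_slope[OF A] fps_inv_mult_slope[OF C0 C1] eq
    by (simp add: \<Psi>_def mult.assoc)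
  moreover have "\<Psi> \<noteq> 0"
    using fps_inv_mult_slope[OF C0 C1] by (auto simp: \<Psi>_def)
  ultimately have "slope C = (B oo \<Psi>) * slope A" by simp
  then have "slope C * (inverse B oo \<Psi>) = slope A * ((B oo \<Psi>) * (inverse B oo \<Psi>))"
    by (simp only: mult_ac)
  also have "(B oo \<Psi>) * (inverse B oo \<Psi>) = (inverse B * B) oo \<Psi>"
    using \<Psi>0 by (simp only: fps_compose_mult_distrib mult.commute)
  also have "\<dots> = 1" using inverse_mult_eq_1[OF B] by simp
  finally show ?thesis by (simp add: C_def \<Psi>_def)
qed

text \<open>
  Additivity of \<open>S\<close> under composition. The correction of degree \<open>k\<close> on the right depends on the inverse
  of the composition only up to degree \<open>k\<close>, hence on slope coefficients of degree below \<open>Suc k\<close>.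
\<close>
lemma slope_compose_nth:
  fixes A B :: "complex fps"
  assumes A: "fps_nth A 0 = 0" "fps_nth A 1 \<noteq> 0" and B: "fps_nth B 0 \<noteq> 0"
  defines "C \<equiv> A oo (fps_X * B)"
  shows "fps_nth (slope C) (Suc k)
    = fps_nth B 0 * (fps_nth (slope A) (Suc k) - fps_nth (fps_shift 1 (inverse B) oo fps_inv C) k)"
proof -
  define \<Psi> where "\<Psi> = fps_inv C"
  define D where "D = fps_shift 1 (inverse B)"
  define a where "a = fps_nth B 0"
  have C0: "fps_nth C 0 = 0" by (simp add: C_def A)
  have "fps_nth C 1 = fps_nth A 1 * fps_nth B 0"
    by (simp add: C_def fps_compose_nth)
  then have C1: "fps_nth C 1 \<noteq> 0" using A B by simp
  have \<Psi>0: "fps_nth \<Psi> 0 = 0" by (simp add: \<Psi>_def)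
  have "inverse B = fps_const (1/a) + fps_X * D"
    using B by (auto simp: fps_eq_iff D_def a_def field_simps)
  then have "inverse B oo \<Psi> = fps_const (1/a) + \<Psi> * (D oo \<Psi>)"
    using \<Psi>0 by (simp add: fps_compose_mult_distrib fps_compose_add_distrib)
  then have "slope A = slope C * fps_const (1/a) + (\<Psi> * slope C) * (D oo \<Psi>)"
    using slope_compose[OF A B] by (simp add: C_def \<Psi>_def ring_distribs mult_ac)
  also have "\<Psi> * slope C = fps_X"
    using fps_inv_mult_slope[OF C0 C1] by (simp add: \<Psi>_def)
  finally have "fps_nth (slope A) (Suc k)
    = fps_nth (slope C * fps_const (1/a) + fps_X * (D oo \<Psi>)) (Suc k)" by (rule arg_cong)
  then have "fps_nth (slope A) (Suc k) = fps_nth (slope C) (Suc k) / a + fps_nth (D oo \<Psi>) k"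
    by simp
  then show ?thesis using B by (simp add: a_def D_def \<Psi>_def field_simps)
qed

text \<open>
  The partial sums of the absolute values of the coefficients of \<open>1 / B\<close> grow at most by the factor
  \<open>1 + \<beta> / \<alpha>\<close> at each degree, because of the recursion that \<open>B \<cdot> (1 / B) = 1\<close> imposes.
\<close>
lemma inverse_coeff_bound:
  fixes B :: "complex fps"
  assumes a: "fps_nth B 0 \<noteq> 0" and b: "\<And>k. 1 \<le> k \<Longrightarrow> k \<le> n \<Longrightarrow> norm (fps_nth B k) \<le> \<beta>"
    and k: "Suc k \<le> n"
  defines "\<alpha> \<equiv> norm (fps_nth B 0)"
  shows "norm (fps_nth (inverse B) (Suc k)) \<le> \<beta> / \<alpha>\<^sup>2 * (1 + \<beta> / \<alpha>) ^ k"
proof -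
  define V where "V = inverse B"
  have \<alpha>: "\<alpha> > 0" using a by (simp add: \<alpha>_def)
  have \<beta>: "\<beta> \<ge> 0" using b[of 1] k order_trans[OF norm_ge_zero] by force
  have step: "norm (fps_nth V (Suc j)) \<le> \<beta> / \<alpha> * (\<Sum>i\<le>j. norm (fps_nth V i))" if "Suc j \<le> n" for j
  proof -
    have "0 = fps_nth (V * B) (Suc j)"
      using inverse_mult_eq_1[OF a] by (simp add: V_def)
    also have "\<dots> = (\<Sum>i=0..j. fps_nth V i * fps_nth B (Suc j - i)) + fps_nth V (Suc j) * fps_nth B 0"
      by (simp add: fps_mult_nth)
    finally have "fps_nth V (Suc j) * fps_nth B 0 = - (\<Sum>i=0..j. fps_nth V i * fps_nth B (Suc j - i))"
      by (simp add: eq_neg_iff_add_eq_0 add.commute)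
    then have "norm (fps_nth V (Suc j)) * \<alpha> = norm (\<Sum>i=0..j. fps_nth V i * fps_nth B (Suc j - i))"
      by (metis \<alpha>_def norm_minus_cancel norm_mult)
    also have "\<dots> \<le> (\<Sum>i=0..j. norm (fps_nth V i) * \<beta>)"
      using that by (intro order_trans[OF norm_sum] sum_mono) (auto simp: norm_mult intro!: mult_left_mono b)
    also have "\<dots> = \<beta> * (\<Sum>i\<le>j. norm (fps_nth V i))"
      by (simp add: sum_distrib_left atLeast0AtMost mult.commute)
    finally show ?thesis using \<alpha> by (simp add: field_simps)
  qed
  have sums: "(\<Sum>i\<le>j. norm (fps_nth V i)) \<le> 1 / \<alpha> * (1 + \<beta> / \<alpha>) ^ j" if "j \<le> n" for j
    using that
  proof (induction j)
    case 0
    then show ?case using a by (simp add: V_def \<alpha>_def norm_inverse divide_inverse)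
  next
    case (Suc j)
    have "(\<Sum>i\<le>Suc j. norm (fps_nth V i)) \<le> (1 + \<beta> / \<alpha>) * (\<Sum>i\<le>j. norm (fps_nth V i))"
      using step[of j] Suc.prems by (simp add: ring_distribs)
    also have "\<dots> \<le> (1 + \<beta> / \<alpha>) * (1 / \<alpha> * (1 + \<beta> / \<alpha>) ^ j)"
      using Suc \<alpha> \<beta> by (intro mult_left_mono) auto
    finally show ?case by (simp add: mult_ac)
  qed
  have "norm (fps_nth V (Suc k)) \<le> \<beta> / \<alpha> * (1 / \<alpha> * (1 + \<beta> / \<alpha>) ^ k)"
    using step[OF k] sums[of k] k \<alpha> \<beta>
    by (intro order_trans[OF step[OF k]] mult_left_mono) auto
  then show ?thesis by (simp add: V_def power2_eq_square)
qed

text \<open>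
  For a self-map with derivative \<open>b\<close> at the origin, the coefficients of \<open>S\<close> are compared with those of
  \<open>maj_slope\<close> after the substitution of \<open>(\<kappa> / \<bar>b\<bar>) X\<close>. The factor \<open>\<kappa> > 1\<close> leaves room for the
  discretisation error and does not accumulate from step to step.
\<close>
definition slope_bounded :: "real \<Rightarrow> nat \<Rightarrow> complex fps \<Rightarrow> bool" where
  "slope_bounded \<kappa> n A \<longleftrightarrow> (\<forall>k. 1 \<le> k \<and> k \<le> n \<longrightarrow>
     norm (fps_nth (slope A) k)
       \<le> norm (fps_nth A 1) * (fps_nth maj_slope k * (\<kappa> / norm (fps_nth A 1)) ^ k))"

text \<open>
  Strong induction on the degree. By the induction hypothesis the inverse of the composition is majorized
  by \<open>inv_koebe\<close> in lower degrees, so the correction of degree \<open>k\<close> is at most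
  \<open>\<alpha> d \<mu> ^ (k - 1)\<close> times a coefficient of \<open>1 / (1 - inv_koebe)\<close>, which is \<open>k / 2\<close> times the coefficient of
  \<open>maj_slope\<close>. The condition on \<open>\<kappa>\<close> says that this is absorbed by the growth of \<open>(\<kappa> / \<bar>b\<bar>)\<^sup>k\<close>.
\<close>
lemma slope_bounded_compose:
  fixes A B :: "complex fps"
  assumes A: "fps_nth A 0 = 0" "fps_nth A 1 \<noteq> 0" and B: "fps_nth B 0 \<noteq> 0"
    and \<alpha>: "\<alpha> = norm (fps_nth B 0)" "\<alpha> \<le> 1"
    and coeff: "\<And>k. 1 \<le> k \<Longrightarrow> norm (fps_nth B k) \<le> 2 * (1 - \<alpha>)"
    and \<kappa>: "\<kappa> \<ge> 1" "(1 + 2 * (1 - \<alpha>) / \<alpha>) ^ n \<le> \<kappa> * \<alpha> ^ Suc n"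
    and bd: "slope_bounded \<kappa> n A"
  shows "slope_bounded \<kappa> n (A oo (fps_X * B))"
proof -
  define C where "C = A oo (fps_X * B)"
  define \<Psi> where "\<Psi> = fps_inv C"
  define D where "D = fps_shift 1 (inverse B)"
  define b where "b = norm (fps_nth A 1)"
  define c where "c = norm (fps_nth C 1)"
  define \<mu> where "\<mu> = \<kappa> / c"
  define d where "d = 2 * (1 - \<alpha>) / \<alpha>\<^sup>2 * (1 + 2 * (1 - \<alpha>) / \<alpha>) ^ n"
  have a0: "\<alpha> > 0" using B \<alpha> by simp
  have b0: "b > 0" using A by (simp add: b_def)
  have C0: "fps_nth C 0 = 0" by (simp add: C_def A)
  have C1': "fps_nth C 1 = fps_nth A 1 * fps_nth B 0"
    by (simp add: C_def fps_compose_nth)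
  then have C1: "fps_nth C 1 \<noteq> 0" using A B by simp
  have c: "c = b * \<alpha>" unfolding c_def C1' b_def \<alpha> norm_mult ..
  have \<mu>: "\<mu> > 0" "\<kappa> / b = \<alpha> * \<mu>" using \<kappa> a0 b0 by (auto simp: \<mu>_def c)
  have D: "norm (fps_nth D k) \<le> d" if "k < n" for k
  proof -
    have "norm (fps_nth D k) \<le> 2 * (1 - \<alpha>) / \<alpha>\<^sup>2 * (1 + 2 * (1 - \<alpha>) / \<alpha>) ^ k"
      using inverse_coeff_bound[OF B, of n "2 * (1 - \<alpha>)" k] coeff that by (simp add: D_def \<alpha>(1))
    also have "\<dots> \<le> d"
      unfolding d_def using a0 \<alpha>(2) that by (intro mult_left_mono power_increasing) auto
    finally show ?thesis .
  qed
  \<comment> \<open>what the correction of degree \<open>k\<close> may cost against the decrease from \<open>1\<close> to \<open>\<alpha>\<^sup>k\<close>\<close>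
  have d\<kappa>: "d * \<alpha> * real k \<le> 2 * \<kappa> * (1 - \<alpha> ^ k)" if k: "k \<le> n" "k \<ge> 1" for k
  proof -
    have geo: "1 - \<alpha> ^ k \<ge> real k * \<alpha> ^ n * (1 - \<alpha>)"
    proof -
      have "real k * \<alpha> ^ n = (\<Sum>i<k. \<alpha> ^ n)" by simp
      also have "\<dots> \<le> (\<Sum>i<k. \<alpha> ^ i)"
        using a0 \<alpha>(2) k by (intro sum_mono power_decreasing) auto
      finally have "(1 - \<alpha>) * (real k * \<alpha> ^ n) \<le> (1 - \<alpha>) * (\<Sum>i<k. \<alpha> ^ i)"
        using \<alpha>(2) by (intro mult_left_mono) auto
      also have "\<dots> = 1 - \<alpha> ^ k" by (simp add: one_diff_power_eq)
      finally show ?thesis by (simp add: mult_ac)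
    qed
    have "d * \<alpha> * real k = 2 * (1 - \<alpha>) * real k / \<alpha> * (1 + 2 * (1 - \<alpha>) / \<alpha>) ^ n"
      using a0 by (simp add: d_def power2_eq_square)
    also have "\<dots> \<le> 2 * (1 - \<alpha>) * real k / \<alpha> * (\<kappa> * \<alpha> ^ Suc n)"
      using \<kappa>(2) a0 \<alpha>(2) by (intro mult_left_mono) auto
    also have "\<dots> = 2 * \<kappa> * (real k * \<alpha> ^ n * (1 - \<alpha>))"
      using a0 by simp
    also have "\<dots> \<le> 2 * \<kappa> * (1 - \<alpha> ^ k)"
      using geo \<kappa>(1) by (intro mult_left_mono) auto
    finally show ?thesis .
  qed
  have main: "k \<ge> 1 \<Longrightarrow> k \<le> n \<Longrightarrow> norm (fps_nth (slope C) k) \<le> c * (fps_nth maj_slope k * \<mu> ^ k)" for k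
  proof (induction k rule: less_induct)
    case (less k)
    then obtain m where m: "k = Suc m" by (cases k) auto
    define S where "S = 1 - fps_const (1 / fps_nth C 1) * slope C"
    have S0: "fps_nth S 0 = 0" using C1 by (simp add: S_def)
    have "majorized \<mu> m S maj_slope"
      unfolding majorized_def
    proof (intro allI impI)
      fix j assume j: "j \<le> m"
      show "norm (fps_nth S j) \<le> fps_nth maj_slope j * \<mu> ^ j"
      proof (cases "j = 0")
        case False
        then have "norm (fps_nth S j) = norm (fps_nth (slope C) j) / c"
          by (simp add: S_def norm_divide c_def)
        then show ?thesis
          using less.IH[of j] False j m less.prems a0 b0 by (simp add: c divide_le_eq mult_ac)
      qed (simp add: S0)
    qed
    then have inv: "majorized \<mu> m (inverse (1 - S)) (inverse (1 - maj_slope))"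
      by (rule majorized_inverse) (simp_all add: S0)
    have "slope C = fps_const (fps_nth C 1) * (1 - S)"
      using C1 by (simp add: S_def mult.assoc [symmetric])
    then have "\<Psi> * (fps_const (fps_nth C 1) * (1 - S)) = fps_X"
      using fps_inv_mult_slope[OF C0 C1] by (simp add: \<Psi>_def)
    then have "fps_const (1 / fps_nth C 1) * fps_X * inverse (1 - S)
      = \<Psi> * (fps_const (1 / fps_nth C 1) * fps_const (fps_nth C 1)) * (inverse (1 - S) * (1 - S))"
      by (metis (no_types, lifting) mult.commute mult.left_commute)
    also have "\<dots> = \<Psi>"
      using C1 S0 inverse_mult_eq_1[of "1 - S"] by (simp del: fps_const_mult add: fps_const_mult)
    finally have \<Psi>: "\<Psi> = fps_const (1 / fps_nth C 1) * fps_X * inverse (1 - S)" ..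
    have "majorized \<mu> m (fps_const (1 / fps_nth C 1) * fps_X) fps_X"
      using \<kappa>(1) b0 a0 by (auto simp: majorized_def fps_X_def norm_divide \<mu>_def c_def divide_right_mono)
    then have "majorized \<mu> m \<Psi> (fps_X * inverse (1 - maj_slope))"
      unfolding \<Psi> by (rule majorized_mult) (rule inv)
    then have mK: "majorized \<mu> m \<Psi> inv_koebe" by (simp add: inv_koebe_conv)
    have "majorized 1 m D (fps_const d * Abs_fps (\<lambda>_. 1))"
      using D less.prems m by (auto simp: majorized_def)
    then have "majorized \<mu> m (D oo \<Psi>) ((fps_const d * Abs_fps (\<lambda>_. 1)) oo inv_koebe)"
      using mK by (rule majorized_compose)
    also have "(fps_const d * Abs_fps (\<lambda>_. 1)) oo inv_koebe
        = fps_const d * inverse (1 - inv_koebe)"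
      by (simp add: inverse_one_minus_fps fps_compose_mult_distrib)
    finally have "norm (fps_nth (D oo \<Psi>) m) \<le> d * (real k * fps_nth maj_slope k / 2) * \<mu> ^ m"
      by (auto simp: majorized_def inverse_one_minus_inv_koebe m)
    moreover have "norm (fps_nth (slope A) k) \<le> b * (fps_nth maj_slope k * (\<alpha> * \<mu>) ^ k)"
      using bd less.prems unfolding \<mu>(2) [symmetric] b_def slope_bounded_def by blast
    moreover have "norm (fps_nth (slope C) k)
      \<le> \<alpha> * (norm (fps_nth (slope A) k) + norm (fps_nth (D oo \<Psi>) m))"
      unfolding m C_def slope_compose_nth[OF A B] norm_mult \<alpha>(1) D_def \<Psi>_def
      by (intro mult_left_mono norm_triangle_ineq4) auto
    ultimately have "norm (fps_nth (slope C) k)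
      \<le> \<alpha> * (b * (fps_nth maj_slope k * (\<alpha> * \<mu>) ^ k) + d * (real k * fps_nth maj_slope k / 2) * \<mu> ^ m)"
      using a0 by (smt (verit, best) mult_left_mono)
    also have "\<dots> = fps_nth maj_slope k * \<mu> ^ m * (c * \<mu> * \<alpha> ^ k + d * \<alpha> * real k / 2)"
      by (simp add: c m power_mult_distrib algebra_simps)
    also have "c * \<mu> = \<kappa>" using a0 b0 by (simp add: \<mu>_def c)
    also have "fps_nth maj_slope k * \<mu> ^ m * (\<kappa> * \<alpha> ^ k + d * \<alpha> * real k / 2)
      \<le> fps_nth maj_slope k * \<mu> ^ m * \<kappa>"
      using d\<kappa>[of k] less.prems \<mu>(1) maj_slope_nonneg[of k]
      by (intro mult_left_mono) (auto simp: algebra_simps)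
    also have "\<dots> = c * (fps_nth maj_slope k * \<mu> ^ k)"
      using a0 b0 by (simp add: m \<mu>_def c)
    finally show ?case .
  qed
  show ?thesis
    unfolding slope_bounded_def using main by (simp add: C_def [symmetric] c_def \<mu>_def)
qed

section \<open>A functional of the first two slope coefficients\<close>

text \<open>
  In terms of the normalised coefficients \<open>s\<^sub>1 = b S\<^sub>1\<close> and \<open>s\<^sub>2 = b\<^sup>2 S\<^sub>2\<close> this reads
  \<open>Re (e\<^sup>2 s\<^sub>2) + \<nu>\<^sup>2 Im (e s\<^sub>1) \<le> \<kappa> + 8 \<nu>\<^sup>3\<close>. The unimodular \<open>e\<close> makes the condition invariant under
  rotations. The exponent on the right exceeds the one on the left, so that for \<open>s\<^sub>2 = 1\<close> and
  \<open>\<kappa> = 1\<close> small values of \<open>\<nu>\<close> force the imaginary part of \<open>s\<^sub>1\<close> to vanish.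
\<close>
definition quad_bounded :: "real \<Rightarrow> complex fps \<Rightarrow> bool" where
  "quad_bounded \<kappa> A \<longleftrightarrow> (\<forall>e \<nu>. norm e = 1 \<longrightarrow> 0 \<le> \<nu> \<longrightarrow>
     Re (e\<^sup>2 * (- fps_nth A 1 * fps_nth (slope A) 2)) + \<nu>\<^sup>2 * Im (e * - fps_nth (slope A) 1)
       \<le> \<kappa> + 8 * \<nu> ^ 3)"

lemma Re_of_real_mult: "Re (of_real x * z) = x * Re z" and Im_of_real_mult: "Im (of_real x * z) = x * Im z"
  by simp_all

lemma inverse_nth_1_2:
  fixes B :: "complex fps"
  assumes "fps_nth B 0 \<noteq> 0"
  shows "fps_nth (inverse B) 0 = 1 / fps_nth B 0"
    and "fps_nth (inverse B) 1 = - fps_nth B 1 / (fps_nth B 0)\<^sup>2"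
    and "fps_nth (inverse B) 2 = (fps_nth B 1)\<^sup>2 / fps_nth B 0 ^ 3 - fps_nth B 2 / (fps_nth B 0)\<^sup>2"
proof -
  define V where "V = inverse B"
  have e: "V * B = 1" using inverse_mult_eq_1[OF assms] by (simp add: V_def)
  show 0: "fps_nth (inverse B) 0 = 1 / fps_nth B 0" by (simp add: divide_inverse)
  have "fps_nth (V * B) 1 = 0" by (simp add: e)
  then have "fps_nth V 1 * fps_nth B 0 = - fps_nth V 0 * fps_nth B 1"
    by (simp add: fps_mult_nth_1 add_eq_0_iff)
  then show 1: "fps_nth (inverse B) 1 = - fps_nth B 1 / (fps_nth B 0)\<^sup>2"
    using assms 0 by (simp add: V_def field_simps power2_eq_square)
  have "fps_nth (V * B) 2 = fps_nth V 0 * fps_nth B 2 + fps_nth V 1 * fps_nth B 1 + fps_nth V 2 * fps_nth B 0"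
    by (simp add: fps_mult_nth numeral_2_eq_2)
  then have "fps_nth V 0 * fps_nth B 2 + fps_nth V 1 * fps_nth B 1 + fps_nth V 2 * fps_nth B 0 = 0"
    by (simp add: e)
  then have "fps_nth V 2 * fps_nth B 0 = - (fps_nth V 0 * fps_nth B 2) - fps_nth V 1 * fps_nth B 1"
    by (simp add: eq_neg_iff_add_eq_0 algebra_simps)
  then have "fps_nth V 2 = (- (fps_nth V 0 * fps_nth B 2) - fps_nth V 1 * fps_nth B 1) / fps_nth B 0"
    using assms by (simp add: field_simps)
  then show "fps_nth (inverse B) 2 = (fps_nth B 1)\<^sup>2 / fps_nth B 0 ^ 3 - fps_nth B 2 / (fps_nth B 0)\<^sup>2"
    using assms by (simp add: V_def [symmetric] 0[folded V_def] 1[folded V_def, simplified] diff_divide_distrib power2_eq_square power3_eq_cube)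
qed

text \<open>
  One step multiplies \<open>s\<^sub>1\<close> by \<open>a\<close> and \<open>s\<^sub>2\<close> by \<open>a\<^sup>2\<close> and adds multiples of the first two coefficients of
  \<open>B\<close>. The old terms are controlled by the hypothesis at the parameter \<open>\<nu> / sqrt \<alpha>\<close>, which restores the
  ratio of the two summands; the contraction \<open>\<alpha>\<^sup>2\<close> then pays for the new terms.
\<close>
lemma quad_bounded_compose:
  fixes A B :: "complex fps"
  assumes A: "fps_nth A 0 = 0" "fps_nth A 1 \<noteq> 0" and B: "fps_nth B 0 \<noteq> 0"
    and \<alpha>: "\<alpha> = norm (fps_nth B 0)" "\<alpha> \<le> 1" "1/2 \<le> \<alpha>"
    and b1: "norm (fps_nth B 1) \<le> 2 * (1 - \<alpha>)"
    and quad: "\<And>e \<nu>. norm e = 1 \<Longrightarrow> 0 \<le> \<nu> \<Longrightarrow>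
      Re (e\<^sup>2 * (- cnj (sgn (fps_nth B 0)) * fps_nth B 2)) + \<nu>\<^sup>2 * Im (e * (- cnj (sgn (fps_nth B 0)) * fps_nth B 1))
        \<le> 2 * (1 - \<alpha>) * (1 + \<nu> ^ 3)"
    and \<kappa>: "2 / \<alpha> + 4 * (1 - \<alpha>) / \<alpha>\<^sup>2 \<le> \<kappa> * (1 + \<alpha>)"
    and bd: "quad_bounded \<kappa> A"
  shows "quad_bounded \<kappa> (A oo (fps_X * B))"
proof -
  define C where "C = A oo (fps_X * B)"
  define a where "a = fps_nth B 0"
  define b where "b = fps_nth A 1"
  define s where "s = sgn a"
  have C0: "fps_nth C 0 = 0" by (simp add: C_def A)
  have C1': "fps_nth C 1 = b * a"
    by (simp add: C_def fps_compose_nth a_def b_def)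
  then have C1: "fps_nth C 1 \<noteq> 0" using A B by (simp add: a_def b_def)
  have nz: "a \<noteq> 0" "b \<noteq> 0" "\<alpha> > 0" using A B \<alpha> by (auto simp: a_def b_def)
  have a: "a = of_real \<alpha> * s"
    using nz by (simp add: s_def \<alpha> a_def sgn_div_norm scaleR_conv_of_real)
  have ns: "norm s = 1" using nz by (simp add: s_def norm_sgn)
  have cs: "inverse s = cnj s" using ns
    by (metis complex_norm_square mult_1_right of_real_1 one_power2 inverse_unique)
  define p1 where "p1 = - cnj s * fps_nth B 1"
  define p2 where "p2 = - cnj s * fps_nth B 2"
  have p1: "norm p1 \<le> 2 * (1 - \<alpha>)" using b1 ns by (simp add: p1_def norm_mult)
  have aV1: "a * fps_nth (inverse B) 1 = p1 / \<alpha>"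
    unfolding inverse_nth_1_2[OF B] p1_def cs [symmetric] a_def [symmetric]
    using nz ns by (simp add: a field_simps power2_eq_square)
  have aV2: "a * fps_nth (inverse B) 2 = p2 / \<alpha> + p1\<^sup>2 / \<alpha>\<^sup>2"
    unfolding inverse_nth_1_2[OF B] p1_def p2_def cs [symmetric] a_def [symmetric]
    using nz ns by (simp add: a field_simps power2_eq_square power3_eq_cube)
  define \<Psi> where "\<Psi> = fps_inv C"
  have "fps_nth (\<Psi> * slope C) 1 = 1" using fps_inv_mult_slope[OF C0 C1] by (simp add: \<Psi>_def)
  then have \<Psi>1: "fps_nth \<Psi> 1 = 1 / (b * a)" using C1
    by (simp add: fps_mult_nth_1 \<Psi>_def C1'[simplified] field_simps)
  have u1: "fps_nth (slope C) 1 = a * fps_nth (slope A) 1 - p1 / \<alpha>"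
    using slope_compose_nth[OF A B, of 0] aV1
    by (simp add: C_def a_def right_diff_distrib)
  have u2: "b * a * fps_nth (slope C) 2 = a\<^sup>2 * (b * fps_nth (slope A) 2) - (p2 / \<alpha> + p1\<^sup>2 / \<alpha>\<^sup>2)"
  proof -
    have "fps_nth (fps_shift 1 (inverse B) oo \<Psi>) 1 = fps_nth (inverse B) 2 / (b * a)"
      by (simp add: fps_compose_nth \<Psi>1[simplified] numeral_2_eq_2)
    then have "fps_nth (slope C) 2 = a * (fps_nth (slope A) 2 - fps_nth (inverse B) 2 / (b * a))"
      using slope_compose_nth[OF A B, of 1] by (simp add: C_def a_def numeral_2_eq_2 \<Psi>_def)
    then have "b * a * fps_nth (slope C) 2
        = a\<^sup>2 * (b * fps_nth (slope A) 2) - a * fps_nth (inverse B) 2"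
      using nz by (simp add: field_simps power2_eq_square)
    then show ?thesis by (simp only: aV2)
  qed
  show ?thesis
    unfolding quad_bounded_def C_def [symmetric]
  proof (intro allI impI)
    fix e :: complex and \<nu> :: real assume e: "norm e = 1" and \<nu>: "0 \<le> \<nu>"
    define f where "f = e * s"
    define \<sigma> where "\<sigma> = sqrt \<alpha>"
    have \<sigma>: "\<sigma> > 0" "\<sigma>\<^sup>2 = \<alpha>" using nz by (auto simp: \<sigma>_def)
    have \<sigma>1: "\<sigma> \<le> 1" using \<alpha>(2) by (simp add: \<sigma>_def)
    have "norm f = 1" using e ns by (simp add: f_def norm_mult)
    moreover have "\<nu> / \<sigma> \<ge> 0" using \<sigma> \<nu> by simp
    ultimately have "Re (f\<^sup>2 * (- b * fps_nth (slope A) 2)) + (\<nu> / \<sigma>)\<^sup>2 * Im (f * - fps_nth (slope A) 1)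
       \<le> \<kappa> + 8 * (\<nu> / \<sigma>) ^ 3"
      using bd unfolding quad_bounded_def b_def by blast
    then have "\<alpha>\<^sup>2 * (Re (f\<^sup>2 * (- b * fps_nth (slope A) 2)) + (\<nu> / \<sigma>)\<^sup>2 * Im (f * - fps_nth (slope A) 1))
       \<le> \<alpha>\<^sup>2 * (\<kappa> + 8 * (\<nu> / \<sigma>) ^ 3)" by (rule mult_left_mono) simp
    also have "\<alpha>\<^sup>2 * (Re (f\<^sup>2 * (- b * fps_nth (slope A) 2)) + (\<nu> / \<sigma>)\<^sup>2 * Im (f * - fps_nth (slope A) 1))
      = Re (e\<^sup>2 * (- (a\<^sup>2 * (b * fps_nth (slope A) 2)))) + \<nu>\<^sup>2 * Im (e * - (a * fps_nth (slope A) 1))"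
    proof -
      have "e\<^sup>2 * (- (a\<^sup>2 * (b * fps_nth (slope A) 2))) = of_real (\<alpha>\<^sup>2) * (f\<^sup>2 * (- b * fps_nth (slope A) 2))"
        by (simp add: f_def a power_mult_distrib)
      then have 1: "Re (e\<^sup>2 * (- (a\<^sup>2 * (b * fps_nth (slope A) 2)))) = \<alpha>\<^sup>2 * Re (f\<^sup>2 * (- b * fps_nth (slope A) 2))"
        by (simp only: Re_of_real_mult)
      have "e * - (a * fps_nth (slope A) 1) = of_real \<alpha> * (f * - fps_nth (slope A) 1)"
        by (simp add: f_def a)
      then have "Im (e * - (a * fps_nth (slope A) 1)) = \<alpha> * Im (f * - fps_nth (slope A) 1)"
        by (simp only: Im_of_real_mult)
      moreover have "\<alpha>\<^sup>2 * (\<nu> / \<sigma>)\<^sup>2 = \<nu>\<^sup>2 * \<alpha>"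
        using \<sigma> nz by (simp add: power_divide power2_eq_square)
      ultimately show ?thesis using 1
        by (simp only: distrib_left mult.assoc[symmetric])
    qed
    also have "\<alpha>\<^sup>2 * (\<kappa> + 8 * (\<nu> / \<sigma>) ^ 3) = \<alpha>\<^sup>2 * \<kappa> + 8 * \<sigma> * \<nu> ^ 3"
      using \<sigma>(1) unfolding \<sigma>(2) [symmetric] by (simp add: field_simps power_divide eval_nat_numeral)
    finally have old: "Re (e\<^sup>2 * (- (a\<^sup>2 * (b * fps_nth (slope A) 2)))) + \<nu>\<^sup>2 * Im (e * - (a * fps_nth (slope A) 1))
      \<le> \<alpha>\<^sup>2 * \<kappa> + 8 * \<sigma> * \<nu> ^ 3" .
    have "Re (e\<^sup>2 * p2) + \<nu>\<^sup>2 * Im (e * p1) \<le> 2 * (1 - \<alpha>) * (1 + \<nu> ^ 3)"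
      using quad[OF e \<nu>] by (simp add: p1_def p2_def s_def a_def)
    then have new: "(Re (e\<^sup>2 * p2) + \<nu>\<^sup>2 * Im (e * p1)) / \<alpha> \<le> 2 * (1 - \<alpha>) * (1 + \<nu> ^ 3) / \<alpha>"
      using nz by (intro divide_right_mono) auto
    have "norm (e\<^sup>2 * (p1\<^sup>2 / \<alpha>\<^sup>2)) = (norm p1)\<^sup>2 / \<alpha>\<^sup>2"
      using e by (simp add: norm_mult norm_power norm_divide)
    also have "\<dots> \<le> (2 * (1 - \<alpha>))\<^sup>2 / \<alpha>\<^sup>2" using p1 by (intro divide_right_mono power_mono) auto
    finally have sq: "Re (e\<^sup>2 * (p1\<^sup>2 / \<alpha>\<^sup>2)) \<le> (2 * (1 - \<alpha>))\<^sup>2 / \<alpha>\<^sup>2"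
      using complex_Re_le_cmod order_trans by blast
    have split: "Re (e\<^sup>2 * (- fps_nth C 1 * fps_nth (slope C) 2)) + \<nu>\<^sup>2 * Im (e * - fps_nth (slope C) 1)
      = (Re (e\<^sup>2 * (- (a\<^sup>2 * (b * fps_nth (slope A) 2)))) + \<nu>\<^sup>2 * Im (e * - (a * fps_nth (slope A) 1)))
        + (Re (e\<^sup>2 * p2) + \<nu>\<^sup>2 * Im (e * p1)) / \<alpha> + Re (e\<^sup>2 * (p1\<^sup>2 / \<alpha>\<^sup>2))"
    proof -
      have "e\<^sup>2 * (- fps_nth C 1 * fps_nth (slope C) 2)
        = e\<^sup>2 * (- (a\<^sup>2 * (b * fps_nth (slope A) 2))) + (e\<^sup>2 * p2) / of_real \<alpha> + e\<^sup>2 * (p1\<^sup>2 / \<alpha>\<^sup>2)"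
        unfolding mult_minus_left C1' u2 by (simp add: algebra_simps)
      then have 1: "Re (e\<^sup>2 * (- fps_nth C 1 * fps_nth (slope C) 2))
        = Re (e\<^sup>2 * (- (a\<^sup>2 * (b * fps_nth (slope A) 2)))) + Re (e\<^sup>2 * p2) / \<alpha> + Re (e\<^sup>2 * (p1\<^sup>2 / \<alpha>\<^sup>2))"
        by (simp only: plus_complex.sel Re_divide_of_real)
      have "e * - fps_nth (slope C) 1 = e * - (a * fps_nth (slope A) 1) + e * p1 / of_real \<alpha>"
        unfolding u1 by (simp add: algebra_simps)
      then have "Im (e * - fps_nth (slope C) 1) = Im (e * - (a * fps_nth (slope A) 1)) + Im (e * p1) / \<alpha>"
        by (simp only: plus_complex.sel Im_divide_of_real)
      then show ?thesis unfolding 1 by (simp only: ring_distribs add_divide_distrib times_divide_eq_right)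
    qed
    define t where "t = 1 - \<alpha>"
    have t0: "t \<ge> 0" using \<alpha>(2) by (simp add: t_def)
    have e1: "2 * t / \<alpha> + (2 * t)\<^sup>2 / \<alpha>\<^sup>2 \<le> \<kappa> * (1 - \<alpha>\<^sup>2)"
    proof -
      have "2 * t / \<alpha> + (2 * t)\<^sup>2 / \<alpha>\<^sup>2 = t * (2 / \<alpha> + 4 * (1 - \<alpha>) / \<alpha>\<^sup>2)"
        by (simp add: t_def algebra_simps power2_eq_square)
      also have "\<dots> \<le> t * (\<kappa> * (1 + \<alpha>))" using \<kappa> t0 by (intro mult_left_mono) auto
      finally show ?thesis by (simp add: t_def algebra_simps power2_eq_square)
    qed
    have e2: "2 * t / \<alpha> \<le> 8 * (1 - \<sigma>)"
    proof -
      have "2 * t / \<alpha> \<le> 4 * t"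
        using \<alpha>(3) nz t0 mult_left_mono[of 1 "2 * \<alpha>" t] by (simp add: divide_le_eq mult_ac)
      have "4 * t = 4 * ((1 - \<sigma>) * (1 + \<sigma>))" using \<sigma> by (simp add: t_def algebra_simps power2_eq_square)
      also have "\<dots> \<le> 4 * ((1 - \<sigma>) * 2)"
        using \<sigma>1 by (intro mult_left_mono) auto
      finally show ?thesis using \<open>2 * t / \<alpha> \<le> 4 * t\<close> by linarith
    qed
    have e3: "2 * t / \<alpha> * \<nu> ^ 3 \<le> 8 * (1 - \<sigma>) * \<nu> ^ 3"
      using e2 \<nu> by (intro mult_right_mono) auto
    have "2 * t * (1 + \<nu> ^ 3) / \<alpha> = 2 * t / \<alpha> + 2 * t / \<alpha> * \<nu> ^ 3"
      by (simp add: algebra_simps add_divide_distrib)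
    then show "Re (e\<^sup>2 * (- fps_nth C 1 * fps_nth (slope C) 2)) + \<nu>\<^sup>2 * Im (e * - fps_nth (slope C) 1)
       \<le> \<kappa> + 8 * \<nu> ^ 3"
      unfolding split using old new sq e1 e3 unfolding t_def [symmetric] by (simp add: algebra_simps)
  qed
qed

section \<open>Coefficients of bounded holomorphic functions\<close>

text \<open>
  The mean over a circle of \<open>Re p\<close> times a nonnegative trigonometric polynomial is nonnegative, and
  Cauchy's formula evaluates this mean in terms of the Taylor coefficients of \<open>p\<close>.
\<close>
lemma caratheodory_positivity:
  fixes p :: "complex \<Rightarrow> complex"
  assumes hol: "p holomorphic_on ball 0 1" and Re: "\<And>z. z \<in> ball 0 1 \<Longrightarrow> Re (p z) \<ge> 0"
    and T: "\<And>\<zeta>. norm \<zeta> = 1 \<Longrightarrow> x0 + Re (x1 * \<zeta> ^ k + x2 * \<zeta> ^ m) \<ge> 0" and km: "k \<ge> 1" "m \<ge> 1"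
  defines "c \<equiv> (\<lambda>k. (deriv ^^ k) p 0 / fact k)"
  shows "x0 * Re (p 0) + Re (x1 * c k + x2 * c m) / 2 \<ge> 0"
proof -
  have main: "x0 * Re (p 0) + Re (x1 * of_real (r ^ k) * c k + x2 * of_real (r ^ m) * c m) / 2 \<ge> 0"
    if r: "0 < r" "r < 1" for r :: real
  proof -
    define R where "R = complex_of_real r"
    \<comment> \<open>on the circle of radius \<open>r\<close> this Laurent polynomial equals the trigonometric polynomial, since there \<open>z / R\<close> and \<open>R / z\<close> are conjugate\<close>
    define M where "M = (\<lambda>z :: complex. of_real x0 + (x1 * (R / z) ^ k + cnj x1 * (z / R) ^ k
       + x2 * (R / z) ^ m + cnj x2 * (z / R) ^ m) / 2)"
    define W where "W = of_real x0 * c 0 + (x1 * R ^ k * c k + x2 * R ^ m * c m) / 2"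
    have R0: "R \<noteq> 0" using r by (simp add: R_def)
    have neg: "((\<lambda>z. p z / z ^ Suc j) has_contour_integral 2 * pi * \<i> * c j) (circlepath 0 r)" for j
    proof -
      have "((\<lambda>u. p u / (u - 0) ^ (Suc j)) has_contour_integral
           (2 * pi * \<i>) / fact j * (deriv ^^ j) p 0) (circlepath 0 r)"
        using r by (intro Cauchy_has_contour_integral_higher_derivative_circlepath
              holomorphic_on_imp_continuous_on holomorphic_on_subset[OF hol]) auto
      then show ?thesis by (simp add: c_def)
    qed
    have pos: "((\<lambda>z. p z * z ^ j) has_contour_integral 0) (circlepath 0 r)" for j
      using r by (intro Cauchy_theorem_disc_simple[of _ 0 1] holomorphic_intros hol) auto
    have int: "((\<lambda>z. of_real x0 * (p z / z ^ Suc 0)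
         + (x1 * R ^ k * (p z / z ^ Suc k) + cnj x1 / R ^ k * (p z * z ^ (k - 1))
         + x2 * R ^ m * (p z / z ^ Suc m) + cnj x2 / R ^ m * (p z * z ^ (m - 1))) * (1/2))
       has_contour_integral
         (of_real x0 * (2 * pi * \<i> * c 0)
         + (x1 * R ^ k * (2 * pi * \<i> * c k) + cnj x1 / R ^ k * 0
         + x2 * R ^ m * (2 * pi * \<i> * c m) + cnj x2 / R ^ m * 0) * (1/2))) (circlepath 0 r)"
      by (intro has_contour_integral_add has_contour_integral_lmul has_contour_integral_rmul neg pos)
    have val: "of_real x0 * (2 * pi * \<i> * c 0)
         + (x1 * R ^ k * (2 * pi * \<i> * c k) + cnj x1 / R ^ k * 0
         + x2 * R ^ m * (2 * pi * \<i> * c m) + cnj x2 / R ^ m * 0) * (1/2) = 2 * pi * \<i> * W"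
      by (simp add: algebra_simps W_def)
    have fn: "of_real x0 * (p z / z ^ Suc 0)
         + (x1 * R ^ k * (p z / z ^ Suc k) + cnj x1 / R ^ k * (p z * z ^ (k - 1))
         + x2 * R ^ m * (p z / z ^ Suc m) + cnj x2 / R ^ m * (p z * z ^ (m - 1))) * (1/2)
         = p z * M z / z" if "z \<noteq> 0" for z
    proof -
      have e: "z ^ (j - 1) = z ^ j / z" if "j \<ge> 1" for j
        using that \<open>z \<noteq> 0\<close> by (cases j) auto
      show ?thesis
        unfolding e[OF km(1)] e[OF km(2)] M_def power_divide
        using \<open>z \<noteq> 0\<close> R0 by (simp add: field_simps)
    qed
    \<comment> \<open>the powers of \<open>z\<close> in \<open>M\<close> with positive exponent contribute nothing\<close>
    have "((\<lambda>z. p z * M z / z) has_contour_integral (2 * pi * \<i> * W)) (circlepath 0 r)"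
    proof (rule has_contour_integral_eq[OF int[unfolded val]])
      fix z assume "z \<in> path_image (circlepath 0 r)"
      then have "z \<noteq> 0" using r by auto
      then show "of_real x0 * (p z / z ^ Suc 0)
         + (x1 * R ^ k * (p z / z ^ Suc k) + cnj x1 / R ^ k * (p z * z ^ (k - 1))
         + x2 * R ^ m * (p z / z ^ Suc m) + cnj x2 / R ^ m * (p z * z ^ (m - 1))) * (1/2)
         = p z * M z / z" by (rule fn)
    qed
    then have "((\<lambda>x. p (circlepath 0 r x) * M (circlepath 0 r x) / circlepath 0 r x
         * vector_derivative (circlepath 0 r) (at x within {0..1})) has_integral (2 * pi * \<i> * W)) {0..1}"
      by (simp add: has_contour_integral_def)
    then have "((\<lambda>x. 2 * pi * \<i> * (p (circlepath 0 r x) * M (circlepath 0 r x)))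
        has_integral (2 * pi * \<i> * W)) {0..1}"
      by (rule has_integral_eq[rotated]) (use r in \<open>simp add: vector_derivative_circlepath01, simp add: circlepath\<close>)
    then have "((\<lambda>x. inverse (2 * pi * \<i>) * (2 * pi * \<i> * (p (circlepath 0 r x) * M (circlepath 0 r x))))
        has_integral (inverse (2 * pi * \<i>) * (2 * pi * \<i> * W))) {0..1}"
      by (rule has_integral_mult_right)
    moreover have "inverse (2 * pi * \<i>) * (2 * pi * \<i> * w) = w" for w :: complex
      by (simp add: field_simps)
    ultimately have "((\<lambda>x. p (circlepath 0 r x) * M (circlepath 0 r x)) has_integral W) {0..1}"
      by (simp only:)
    then have ReW: "((\<lambda>x. Re (p (circlepath 0 r x) * M (circlepath 0 r x))) has_integral Re W) {0..1}"
      using has_integral_linear[OF _ bounded_linear_Re] by (force simp: o_def)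
    have "Re W \<ge> 0"
    proof (rule has_integral_nonneg[OF ReW])
      fix x :: real
      define z where "z = circlepath 0 r x"
      define \<zeta> where "\<zeta> = exp (- (2 * pi * \<i> * x))"
      have z: "z = R * exp (2 * pi * \<i> * x)" by (simp add: z_def circlepath R_def)
      have n\<zeta>: "norm \<zeta> = 1" by (simp add: \<zeta>_def)
      have 1: "R / z = \<zeta>" using R0 by (simp add: z \<zeta>_def exp_minus field_simps)
      have "cnj \<zeta> = exp (2 * pi * \<i> * x)" by (simp add: \<zeta>_def exp_cnj)
      then have 2: "z / R = cnj \<zeta>" using R0 by (simp add: z)
      have "M z = of_real x0 + ((x1 * \<zeta> ^ k + x2 * \<zeta> ^ m) + cnj (x1 * \<zeta> ^ k + x2 * \<zeta> ^ m)) / 2"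
        by (simp add: M_def 1 2 algebra_simps)
      then have M: "M z = of_real (x0 + Re (x1 * \<zeta> ^ k + x2 * \<zeta> ^ m))"
        by (simp only: complex_add_cnj) simp
      have "norm z < 1" using r by (simp add: z norm_mult R_def)
      then have "Re (p z) * (x0 + Re (x1 * \<zeta> ^ k + x2 * \<zeta> ^ m)) \<ge> 0"
        using T[OF n\<zeta>] Re[of z] by simp
      then show "0 \<le> Re (p (circlepath 0 r x) * M (circlepath 0 r x))"
        unfolding z_def [symmetric] M by simp
    qed
    moreover have "Re W = x0 * Re (p 0) + Re (x1 * of_real (r ^ k) * c k + x2 * of_real (r ^ m) * c m) / 2"
      by (simp add: W_def R_def c_def)
    ultimately show ?thesis by simp
  qed
  define g where "g = (\<lambda>r :: real. x0 * Re (p 0) + Re (x1 * of_real (r ^ k) * c k + x2 * of_real (r ^ m) * c m) / 2)"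
  have "(g \<longlongrightarrow> x0 * Re (p 0) + Re (x1 * of_real (1 ^ k) * c k + x2 * of_real (1 ^ m) * c m) / 2) (at_left 1)"
    unfolding g_def by (intro tendsto_intros) auto
  moreover have "\<forall>\<^sub>F r in at_left 1. 0 \<le> g r"
    using eventually_at_left_real[OF zero_less_one] by (rule eventually_mono) (use main in \<open>auto simp: g_def\<close>)
  ultimately have "0 \<le> x0 * Re (p 0) + Re (x1 * of_real (1 ^ k) * c k + x2 * of_real (1 ^ m) * c m) / 2"
    by (intro tendsto_lowerbound) auto
  then show ?thesis by simp
qed

lemma coeff_affine:
  assumes "B holomorphic_on ball 0 1" "k \<ge> 1"
  shows "(deriv ^^ k) (\<lambda>z. 1 - u * B z) 0 = - u * (deriv ^^ k) B 0"
proof -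
  have "(deriv ^^ k) (\<lambda>z. 1 - u * B z) 0 = (deriv ^^ k) (\<lambda>z. 1) 0 - (deriv ^^ k) (\<lambda>z. u * B z) 0"
    by (intro higher_deriv_diff[of _ "ball 0 1"] holomorphic_intros assms) auto
  also have "(deriv ^^ k) (\<lambda>z. u * B z) 0 = u * (deriv ^^ k) B 0"
    by (intro higher_deriv_cmult[of _ "ball 0 1"] holomorphic_intros assms) auto
  finally show ?thesis using assms(2) by (simp add: higher_deriv_const)
qed

lemma cnj_sgn_mult: "cnj (sgn c) * c = of_real (norm c)"
proof (cases "c = 0")
  case False
  have "cnj (sgn c) * c = (c * cnj c) / of_real (norm c)" by (simp add: sgn_eq)
  also have "\<dots> = of_real ((norm c)\<^sup>2) / of_real (norm c)"
    by (metis complex_norm_square of_real_power)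
  finally show ?thesis using False by (simp add: power2_eq_square)
qed simp

text \<open>
  The positivity lemma for the function \<open>1 - u B\<close>, where the rotation \<open>u\<close> is chosen to make \<open>u B(0)\<close> real
  and nonnegative, so that the real part of the value at \<open>0\<close> is as small as possible.
\<close>
lemma bounded_coeff_positivity:
  fixes B :: "complex \<Rightarrow> complex"
  assumes hol: "B holomorphic_on ball 0 1" and bd: "\<And>z. z \<in> ball 0 1 \<Longrightarrow> norm (B z) \<le> 1"
    and T: "\<And>\<zeta>. norm \<zeta> = 1 \<Longrightarrow> x0 + Re (x1 * \<zeta> ^ k + x2 * \<zeta> ^ m) \<ge> 0" and km: "k \<ge> 1" "m \<ge> 1"
  defines "c \<equiv> (\<lambda>k. - cnj (sgn (B 0)) * ((deriv ^^ k) B 0 / fact k))"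
  shows "x0 * (1 - norm (B 0)) + Re (x1 * c k + x2 * c m) / 2 \<ge> 0"
proof -
  define u where "u = cnj (sgn (B 0))"
  have u: "norm u \<le> 1" by (simp add: u_def norm_sgn)
  have 0: "u * B 0 = of_real (norm (B 0))"
    unfolding u_def by (rule cnj_sgn_mult)
  have "x0 * Re (1 - u * B 0) + Re (x1 * ((deriv ^^ k) (\<lambda>z. 1 - u * B z) 0 / fact k)
      + x2 * ((deriv ^^ m) (\<lambda>z. 1 - u * B z) 0 / fact m)) / 2 \<ge> 0"
  proof (rule caratheodory_positivity[OF _ _ T km])
    fix z :: complex assume "z \<in> ball 0 1"
    then have "norm (u * B z) \<le> 1 * 1"
      unfolding norm_mult using u bd by (intro mult_mono) auto
    then show "0 \<le> Re (1 - u * B z)"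
      using complex_Re_le_cmod[of "u * B z"] by simp
  qed (intro holomorphic_intros hol)
  then show ?thesis
    unfolding coeff_affine[OF hol km(1)] coeff_affine[OF hol km(2)] minus_complex.sel 0
    by (simp add: c_def u_def)
qed

lemma bounded_coeff_le:
  fixes B :: "complex \<Rightarrow> complex"
  assumes hol: "B holomorphic_on ball 0 1" and bd: "\<And>z. z \<in> ball 0 1 \<Longrightarrow> norm (B z) \<le> 1"
    and k: "k \<ge> 1" and nz: "B 0 \<noteq> 0"
  shows "norm ((deriv ^^ k) B 0 / fact k) \<le> 2 * (1 - norm (B 0))"
proof -
  define c where "c = - cnj (sgn (B 0)) * ((deriv ^^ k) B 0 / fact k)"
  define x where "x = - cnj (sgn c)"
  have "1 * (1 - norm (B 0)) + Re (x * c + 0 * c) / 2 \<ge> 0"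
    unfolding c_def
  proof (rule bounded_coeff_positivity[OF hol bd _ k k])
    fix \<zeta> :: complex assume "norm \<zeta> = 1"
    then have "norm (x * \<zeta> ^ k) \<le> 1" by (simp add: x_def norm_mult norm_power norm_sgn)
    then show "0 \<le> 1 + Re (x * \<zeta> ^ k + 0 * \<zeta> ^ k)"
      using abs_Re_le_cmod[of "x * \<zeta> ^ k"] by simp
  qed
  moreover have "x * c = - of_real (norm c)"
    by (simp add: x_def cnj_sgn_mult)
  moreover have "norm c = norm ((deriv ^^ k) B 0 / fact k)"
    unfolding c_def norm_mult using nz by (simp add: norm_sgn)
  ultimately show ?thesis by simp
qed

text \<open>
  For \<open>\<zeta>\<close> on the unit circle and \<open>s = Im (e \<zeta>)\<close>, the trigonometric polynomial used here is
  \<open>2 s\<^sup>2 - \<nu>\<^sup>2 s + \<nu>\<^sup>3\<close>.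
\<close>
lemma bounded_coeff_quadratic:
  fixes B :: "complex \<Rightarrow> complex"
  assumes hol: "B holomorphic_on ball 0 1" and bd: "\<And>z. z \<in> ball 0 1 \<Longrightarrow> norm (B z) \<le> 1"
    and e: "norm e = 1" and \<nu>: "\<nu> \<ge> 0"
  defines "c \<equiv> (\<lambda>k. - cnj (sgn (B 0)) * ((deriv ^^ k) B 0 / fact k))"
  shows "Re (e\<^sup>2 * c 2) + \<nu>\<^sup>2 * Im (e * c 1) \<le> 2 * (1 - norm (B 0)) * (1 + \<nu> ^ 3)"
proof -
  have "(1 + \<nu> ^ 3) * (1 - norm (B 0)) + Re (\<i> * of_real (\<nu>\<^sup>2) * e * c 1 + (- e\<^sup>2) * c 2) / 2 \<ge> 0"
    unfolding c_def
  proof (rule bounded_coeff_positivity[OF hol bd])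
    fix \<zeta> :: complex assume \<zeta>: "norm \<zeta> = 1"
    define s where "s = Im (e * \<zeta>)"
    have "norm (e * \<zeta>) = 1" using e \<zeta> by (simp add: norm_mult)
    then have cs: "(Re (e * \<zeta>))\<^sup>2 + s\<^sup>2 = 1" by (metis cmod_power2 one_power2 s_def)
    then have "s\<^sup>2 \<le> 1" by (smt (verit) zero_le_power2)
    then have s1: "\<bar>s\<bar> \<le> 1" by (simp add: abs_square_le_1)
    have "Re ((e * \<zeta>)\<^sup>2) = (Re (e * \<zeta>))\<^sup>2 - s\<^sup>2" unfolding s_def by (simp only: Re_power2)
    then have "Re ((e * \<zeta>)\<^sup>2) = 1 - 2 * s\<^sup>2" using cs by simp
    then have "Re (- e\<^sup>2 * \<zeta>\<^sup>2) = 2 * s\<^sup>2 - 1" by (simp add: power_mult_distrib)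
    moreover have "Re (\<i> * of_real (\<nu>\<^sup>2) * e * \<zeta> ^ 1) = - \<nu>\<^sup>2 * s"
    proof -
      have "\<i> * of_real (\<nu>\<^sup>2) * e * \<zeta> ^ 1 = of_real (\<nu>\<^sup>2) * (\<i> * (e * \<zeta>))" by simp
      then show ?thesis by (simp only: Re_of_real_mult Re_i_times s_def mult_minus_left mult_minus_right)
    qed
    moreover have "2 * s\<^sup>2 - \<nu>\<^sup>2 * s + \<nu> ^ 3 \<ge> 0"
    proof (cases "\<nu> \<le> 1")
      case True
      have "\<nu> ^ 3 \<ge> \<nu> ^ 4" using True \<nu> by (intro power_decreasing) auto
      moreover have "8 * (2 * s\<^sup>2 - \<nu>\<^sup>2 * s + \<nu> ^ 3) = 16 * s\<^sup>2 - 8 * \<nu>\<^sup>2 * s + 8 * \<nu> ^ 3"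
        by (simp add: algebra_simps)
      ultimately have "8 * (2 * s\<^sup>2 - \<nu>\<^sup>2 * s + \<nu> ^ 3) \<ge> 16 * s\<^sup>2 - 8 * \<nu>\<^sup>2 * s + \<nu> ^ 4"
        using zero_le_power[OF \<nu>, of 3] by linarith
      also have "16 * s\<^sup>2 - 8 * \<nu>\<^sup>2 * s + \<nu> ^ 4 = (4 * s - \<nu>\<^sup>2)\<^sup>2"
        by (simp add: power2_eq_square algebra_simps eval_nat_numeral)
      finally show ?thesis by (smt (verit) zero_le_power2)
    next
      case False
      then have "\<nu>\<^sup>2 * s \<le> \<nu>\<^sup>2 * 1" using s1 by (intro mult_left_mono) auto
      also have "\<dots> \<le> \<nu> ^ 3" using False by (simp add: power_increasing)
      finally show ?thesis by (smt (verit) zero_le_power2)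
    qed
    ultimately show "0 \<le> 1 + \<nu> ^ 3 + Re (\<i> * of_real (\<nu>\<^sup>2) * e * \<zeta> ^ 1 + - e\<^sup>2 * \<zeta>\<^sup>2)"
      by simp
  qed auto
  moreover have "Re (\<i> * of_real (\<nu>\<^sup>2) * e * c 1 + (- e\<^sup>2) * c 2) = - \<nu>\<^sup>2 * Im (e * c 1) - Re (e\<^sup>2 * c 2)"
  proof -
    have "\<i> * of_real (\<nu>\<^sup>2) * e * c 1 + (- e\<^sup>2) * c 2 = of_real (\<nu>\<^sup>2) * (\<i> * (e * c 1)) - e\<^sup>2 * c 2" by simp
    then show ?thesis by (simp only: minus_complex.sel Re_of_real_mult Re_i_times)
  qed
  moreover have "2 * (1 - norm (B 0)) * (1 + \<nu> ^ 3) = 2 * ((1 + \<nu> ^ 3) * (1 - norm (B 0)))"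
    by simp
  ultimately show ?thesis by linarith
qed

section \<open>Generating univalent self-maps of the disc by near-rotations\<close>

definition disc_univalent :: "(complex \<Rightarrow> complex) set" where
  "disc_univalent = {\<phi>. \<phi> holomorphic_on ball 0 1 \<and> inj_on \<phi> (ball 0 1) \<and> \<phi> 0 = 0 \<and> \<phi> ` ball 0 1 \<subseteq> ball 0 1}"

lemma disc_univalentD:
  assumes "\<phi> \<in> disc_univalent"
  shows "\<phi> holomorphic_on ball 0 1" "inj_on \<phi> (ball 0 1)" "\<phi> 0 = 0" "\<phi> ` ball 0 1 \<subseteq> ball 0 1"
    "\<And>z. z \<in> ball 0 1 \<Longrightarrow> \<phi> z \<in> ball 0 1" "deriv \<phi> 0 \<noteq> 0" "norm (deriv \<phi> 0) \<le> 1"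
    "(\<phi> has_field_derivative deriv \<phi> 0) (at 0)"
proof -
  show *: "\<phi> holomorphic_on ball 0 1" "inj_on \<phi> (ball 0 1)" "\<phi> 0 = 0" "\<phi> ` ball 0 1 \<subseteq> ball 0 1"
    using assms by (auto simp: disc_univalent_def)
  show **: "\<And>z. z \<in> ball 0 1 \<Longrightarrow> \<phi> z \<in> ball 0 1" using * by blast
  show "deriv \<phi> 0 \<noteq> 0" using * by (intro holomorphic_injective_imp_regular[of _ "ball 0 1"]) auto
  show "norm (deriv \<phi> 0) \<le> 1"
    by (rule Schwarz_Lemma(2)[of \<phi> 0]) (use * ** in auto)
  show "(\<phi> has_field_derivative deriv \<phi> 0) (at 0)"
    using * by (intro holomorphic_derivI[of _ "ball 0 1"]) auto
qed

lemma disc_univalent_compose: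
  assumes "h \<in> disc_univalent" "g \<in> disc_univalent"
  shows "h \<circ> g \<in> disc_univalent" "deriv (h \<circ> g) 0 = deriv h 0 * deriv g 0"
proof -
  note h = disc_univalentD[OF assms(1)] and g = disc_univalentD[OF assms(2)]
  have "h \<circ> g holomorphic_on ball 0 1"
    using g(4) by (intro holomorphic_on_compose_gen[OF g(1) h(1)]) auto
  moreover have "inj_on (h \<circ> g) (ball 0 1)"
    using comp_inj_on[OF g(2) inj_on_subset[OF h(2) g(4)]] .
  moreover have "(h \<circ> g) ` ball 0 1 \<subseteq> ball 0 1"
    using g(5) h(5) by fastforce
  ultimately show "h \<circ> g \<in> disc_univalent"
    using g(3) h(3) by (simp add: disc_univalent_def)
  have "((h \<circ> g) has_field_derivative deriv h 0 * deriv g 0) (at 0)"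
    using DERIV_chain[of h "deriv h 0" g 0 "deriv g 0" UNIV] h(8) g(8) g(3) by simp
  then show "deriv (h \<circ> g) 0 = deriv h 0 * deriv g 0" by (rule DERIV_imp_deriv)
qed

text \<open>
  Containment of images is subordination: the inner factor is \<open>h\<inverse> \<circ> f\<close>.
\<close>
lemma disc_univalent_factor:
  assumes h: "h \<in> disc_univalent" and f: "f \<in> disc_univalent" and sub: "f ` ball 0 1 \<subseteq> h ` ball 0 1"
  obtains g where "g \<in> disc_univalent" "\<And>z. z \<in> ball 0 1 \<Longrightarrow> f z = h (g z)"
proof -
  note h = disc_univalentD[OF h] and f = disc_univalentD[OF f]
  obtain k where k: "k holomorphic_on h ` ball 0 1" "\<And>z. z \<in> ball 0 1 \<Longrightarrow> k (h z) = z"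
    using holomorphic_has_inverse[OF h(1) open_ball h(2)] by metis
  have eq: "f z = h (k (f z))" "k (f z) \<in> ball 0 1" if "z \<in> ball 0 1" for z
    using that sub k(2) by fastforce+
  have "k \<circ> f \<in> disc_univalent"
    unfolding disc_univalent_def
  proof (intro CollectI conjI)
    show "k \<circ> f holomorphic_on ball 0 1"
      using sub by (intro holomorphic_on_compose_gen[OF f(1) k(1)]) auto
    show "inj_on (k \<circ> f) (ball 0 1)"
      using eq(1) f(2) by (metis (no_types, lifting) comp_apply inj_on_def)
    show "(k \<circ> f) 0 = 0" using k(2)[of 0] h(3) f(3) by simp
    show "(k \<circ> f) ` ball 0 1 \<subseteq> ball 0 1" using eq(2) by auto
  qed
  then show ?thesis using that[of "k \<circ> f"] eq by simp
qed

lemma simply_connected_univalent_image: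
  assumes "\<phi> holomorphic_on ball 0 1" "inj_on \<phi> (ball 0 1)"
  shows "simply_connected (\<phi> ` ball 0 1)" "open (\<phi> ` ball 0 1)"
proof -
  show op: "open (\<phi> ` ball 0 1)"
    using open_mapping_thm3[OF assms(1) open_ball assms(2)] .
  obtain k where k: "k holomorphic_on \<phi> ` ball 0 1" "\<And>z. z \<in> ball 0 1 \<Longrightarrow> k (\<phi> z) = z"
    using holomorphic_has_inverse[OF assms(1) open_ball assms(2)] by metis
  then have "\<exists>f g. f holomorphic_on \<phi> ` ball 0 1 \<and> g holomorphic_on ball 0 1 \<and>
       (\<forall>z\<in>\<phi> ` ball 0 1. f z \<in> ball 0 1 \<and> g (f z) = z) \<and>
       (\<forall>z\<in>ball 0 1. g z \<in> \<phi> ` ball 0 1 \<and> f (g z) = z)"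
    using assms(1) by (intro exI[of _ k] exI[of _ \<phi>]) auto
  then show "simply_connected (\<phi> ` ball 0 1)"
    using Riemann_mapping_theorem[of "\<phi> ` ball 0 1"] by blast
qed

text \<open>
  An instance of boundary bumping. The complement of \<open>\<Omega>\<close> is connected and contains both \<open>p\<close> and the
  unit circle. If filling the holes of \<open>\<Omega> \<union> ball 0 s\<close> swallowed the whole disc, a clopen subset would
  split the part of this complement near \<open>p\<close> off from the unit circle.
\<close>
lemma filled_union_ball_proper:
  fixes \<Omega> :: "complex set"
  assumes \<Omega>: "open \<Omega>" "simply_connected \<Omega>" "0 \<in> \<Omega>" "\<Omega> \<subseteq> ball 0 1"
    and s: "0 < s" "s < 1" and p: "p \<notin> \<Omega>" "norm p < s"
  defines "U \<equiv> \<Omega> \<union> ball 0 s"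
  shows "outside U \<noteq> - ball 0 1"
proof
  assume out: "outside U = - ball 0 1"
  have U: "open U" "U \<subseteq> ball 0 1" using \<Omega> s by (auto simp: U_def)
  have conn: "connected (- \<Omega>)"
    using simply_connected_iff_simple[OF \<Omega>(1) bounded_subset[OF bounded_ball \<Omega>(4)]] \<Omega>(2) by simp
  have conn1: "connected (outside U)"
    using bounded_subset[OF bounded_ball U(2)] by (intro connected_outside) auto
  then have comp: "outside U \<in> components (- U)"
  proof -
    have "1 \<in> outside U" using out by simp
    then show ?thesis using conn1 by (auto simp: outside_in_components)
  qed
  define K0 where "K0 = cball 0 2 - U"
  have cK0: "compact K0" unfolding K0_def using U(1) by (intro compact_diff) auto
  define C where "C = connected_component_set K0 1"
  have 1: "(1::complex) \<in> K0" using U(2) by (auto simp: K0_def)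
  have C: "C \<in> components K0" using 1 by (auto simp: C_def components_def)
  have "1 \<in> C" using 1 by (simp add: C_def)
  have "C \<subseteq> outside U"
  proof (rule components_maximal[OF comp])
    show "connected C" by (simp add: C_def)
    show "C \<subseteq> - U" using connected_component_subset[of K0 1] by (auto simp: C_def K0_def)
    show "outside U \<inter> C \<noteq> {}" using \<open>1 \<in> C\<close> out by auto
  qed
  then have Cs: "C \<subseteq> - cball 0 s" using out s by auto
  have "compact C" using compact_components[OF cK0 C] .
  obtain K where K: "openin (top_of_set K0) K" "compact K" "C \<subseteq> K" "K \<subseteq> - cball 0 s"
    using Sura_Bura_clopen_subset[OF closed_imp_locally_compact[OF compact_imp_closed[OF cK0]] C \<open>compact C\<close> _ Cs]
    by (metis closed_cball open_Compl)
  have KK: "K \<subseteq> K0" using K(1) openin_imp_subset by blast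
  have ann: "connected {x::complex. 1 \<le> norm (x - 0) \<and> norm (x - 0) \<le> 2}"
    by (rule connected_annulus) simp
  have sub: "{x::complex. 1 \<le> norm (x - 0) \<and> norm (x - 0) \<le> 2} \<subseteq> C"
    unfolding C_def using U(2) ann by (intro connected_component_maximal) (auto simp: K0_def)
  have clo: "closed (K0 - K)"
  proof -
    obtain T where "open T" "K = K0 \<inter> T" using K(1) by (auto simp: openin_open)
    then have "K0 - K = K0 - T" by auto
    then show ?thesis using \<open>open T\<close> cK0 by (simp add: closed_Diff compact_imp_closed)
  qed
  \<comment> \<open>the clopen piece \<open>K\<close> would separate the complement of \<open>\<Omega>\<close>, with infinity on one side and \<open>p\<close> on the other\<close>
  define X1 where "X1 = K \<union> - ball 0 2"
  define X2 where "X2 = (K0 - K) \<union> (cball 0 s - \<Omega>)"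
  have "closed X1" using K(2) by (auto simp: X1_def compact_imp_closed intro!: closed_Un)
  moreover have "closed X2" using clo \<Omega>(1) by (auto simp: X2_def intro!: closed_Un)
  moreover have "- \<Omega> \<subseteq> X1 \<union> X2"
    by (auto simp: X1_def X2_def K0_def U_def not_le not_less)
  moreover have "X1 \<inter> X2 \<inter> - \<Omega> = {}"
  proof -
    have "z \<in> K" if "z \<in> K0" "norm z \<ge> 2" for z
    proof -
      have "z \<in> {x::complex. 1 \<le> norm (x - 0) \<and> norm (x - 0) \<le> 2}" using that by (auto simp: K0_def)
      then show ?thesis using sub K(3) by blast
    qed
    then show ?thesis using K(4) s by (auto simp: X1_def X2_def not_less)
  qed
  moreover have "p \<in> X2 \<inter> - \<Omega>" using p by (auto simp: X2_def)
  moreover have "2 \<in> X1 \<inter> - \<Omega>" using \<Omega>(4) by (auto simp: X1_def)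
  ultimately show False
    using conn unfolding connected_closed by blast
qed

text \<open>
  The image of \<open>g\<close> is the union of the image of \<open>f\<close> and a disc of radius \<open>t\<close> close to \<open>1\<close>, with its
  holes filled. It is simply connected since its complement is the unbounded component. Containing the
  disc of radius \<open>t\<close> makes its conformal radius at least \<open>t\<close>.
\<close>
lemma intermediate_disc_univalent:
  assumes f: "f \<in> disc_univalent" and p: "p \<in> ball 0 1" "p \<notin> f ` ball 0 1" and s: "s < 1"
  obtains g where "g \<in> disc_univalent" "f ` ball 0 1 \<subseteq> g ` ball 0 1" "s \<le> norm (deriv g 0)" "norm (deriv g 0) < 1"
proof -
  note F = disc_univalentD[OF f]
  define \<Omega> where "\<Omega> = f ` ball 0 1"
  have \<Omega>: "open \<Omega>" "simply_connected \<Omega>" "0 \<in> \<Omega>" "\<Omega> \<subseteq> ball 0 1"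
    using simply_connected_univalent_image[OF F(1,2)] F(3,4) by (auto simp: \<Omega>_def intro!: image_eqI[of 0 f 0])
  obtain t where t: "max (max 0 s) (norm p) < t" "t < 1"
    using p(1) s dense[of "max (max 0 s) (norm p)" 1] by auto
  define U where "U = \<Omega> \<union> ball 0 t"
  define W where "W = - outside U"
  have U: "open U" "U \<subseteq> ball 0 1" using \<Omega> t by (auto simp: U_def)
  then have Ub: "bounded U" using bounded_subset[OF bounded_ball] by blast
  have Uc: "connected U" unfolding U_def
    using simply_connected_imp_connected[OF \<Omega>(2)] \<Omega>(3) t by (intro connected_Un) auto
  have sub1: "- ball 0 1 \<subseteq> outside U"
    using outside_mono[OF U(2)] outside_convex[OF convex_ball] by auto
  have oc: "connected (outside U)" using Ub by (intro connected_outside) auto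
  have comp: "outside U \<in> components (- U)"
  proof -
    have "1 \<in> outside U" using sub1 by auto
    then show ?thesis using oc by (auto simp: outside_in_components)
  qed
  have W: "open W" unfolding W_def
    using closed_components[OF _ comp] U(1) by auto
  have WB: "W \<subseteq> ball 0 1" using sub1 by (auto simp: W_def)
  have UW: "U \<subseteq> W" using outside_no_overlap[of U] unfolding W_def by blast
  have "connected W" unfolding W_def by (rule component_complement_connected[OF Uc comp])
  moreover have "connected (- W)" using oc by (simp add: W_def)
  ultimately have "simply_connected W"
    using simply_connected_iff_simple[OF W bounded_subset[OF bounded_ball WB]] by simp
  moreover have "W \<noteq> {}" using UW \<Omega>(3) by (auto simp: U_def)
  moreover have "1 \<notin> W" using WB by auto
  then have "W \<noteq> UNIV" by auto
  ultimately have "\<exists>f g. f holomorphic_on W \<and> g holomorphic_on ball 0 1 \<and>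
       (\<forall>z\<in>W. f z \<in> ball 0 1 \<and> g (f z) = z) \<and> (\<forall>z\<in>ball 0 1. g z \<in> W \<and> f (g z) = z)"
    using Riemann_mapping_theorem[of W] W by simp
  then obtain \<Phi> G where \<Phi>: "\<Phi> holomorphic_on W" and G: "G holomorphic_on ball 0 1"
    and \<Phi>G: "\<And>z. z \<in> W \<Longrightarrow> \<Phi> z \<in> ball 0 1 \<and> G (\<Phi> z) = z"
    and G\<Phi>: "\<And>z. z \<in> ball 0 1 \<Longrightarrow> G z \<in> W \<and> \<Phi> (G z) = z"
    by blast
  have 0: "0 \<in> W" using UW \<Omega>(3) by (auto simp: U_def)
  obtain M N where M: "M (\<Phi> 0) = 0" "M holomorphic_on ball 0 1" "M ` ball 0 1 \<subseteq> ball 0 1"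
    "N holomorphic_on ball 0 1" "N ` ball 0 1 \<subseteq> ball 0 1"
    "\<And>z. z \<in> ball 0 1 \<Longrightarrow> M (N z) = z" "\<And>z. z \<in> ball 0 1 \<Longrightarrow> N (M z) = z"
    using ball_biholomorphism_exists[of "\<Phi> 0"] \<Phi>G[OF 0] by metis
  define g where "g = G \<circ> N"
  define k where "k = M \<circ> \<Phi>"
  have gk: "g z \<in> W" "k (g z) = z" if "z \<in> ball 0 1" for z
  proof -
    have "N z \<in> ball 0 1" using that M(5) by blast
    then show "g z \<in> W" "k (g z) = z" using G\<Phi> M(6) that by (auto simp: g_def k_def)
  qed
  have kg: "k z \<in> ball 0 1" "g (k z) = z" if "z \<in> W" for z
  proof -
    have "\<Phi> z \<in> ball 0 1" using that \<Phi>G by blast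
    moreover from this have "M (\<Phi> z) \<in> ball 0 1" using M(3) by blast
    ultimately show "k z \<in> ball 0 1" "g (k z) = z" using \<Phi>G M(7) that by (auto simp: g_def k_def)
  qed
  have ghol: "g holomorphic_on ball 0 1" unfolding g_def
    using M(5) by (intro holomorphic_on_compose_gen[OF M(4) G]) auto
  have khol: "k holomorphic_on W" unfolding k_def
    using \<Phi>G by (intro holomorphic_on_compose_gen[OF \<Phi> M(2)]) auto
  have k0: "k 0 = 0" using M(1) by (simp add: k_def)
  then have g0: "g 0 = 0" using kg[OF 0] by simp
  have gim: "g ` ball 0 1 = W" using gk kg by force
  have gdu: "g \<in> disc_univalent"
    unfolding disc_univalent_def using ghol g0 gim WB gk(2) inj_on_inverseI[of "ball 0 1" k g] by auto
  have low: "t \<le> norm (deriv g 0)"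
  proof -
    define q where "q = k \<circ> (\<lambda>z. of_real t * z)"
    have inW: "of_real t * z \<in> W" if "z \<in> ball 0 1" for z :: complex
    proof -
      have "norm (of_real t * z) < t" using that t by (simp add: norm_mult)
      then show ?thesis using UW by (auto simp: U_def)
    qed
    have "q holomorphic_on ball 0 1" unfolding q_def
      using inW by (intro holomorphic_on_compose_gen[OF _ khol] holomorphic_intros) auto
    then have "norm (deriv q 0) \<le> 1"
      by (rule Schwarz_Lemma(2)[of q 0]) (use kg(1) inW k0 in \<open>auto simp: q_def\<close>)
    moreover have dk: "(k has_field_derivative deriv k 0) (at 0)"
      using khol W 0 by (rule holomorphic_derivI)
    have "(q has_field_derivative deriv k 0 * of_real t) (at 0)" unfolding q_def
      using DERIV_chain[of k "deriv k 0" "\<lambda>z. of_real t * z" 0 "of_real t" UNIV] dk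
      by (simp add: DERIV_cmult_Id)
    then have "deriv q 0 = deriv k 0 * of_real t" by (rule DERIV_imp_deriv)
    moreover have "deriv k 0 * deriv g 0 = 1"
    proof -
      have "((k \<circ> g) has_field_derivative deriv k 0 * deriv g 0) (at 0)"
        using DERIV_chain[of k "deriv k 0" g 0 "deriv g 0" UNIV] dk disc_univalentD(8)[OF gdu] g0 by simp
      moreover have "((k \<circ> g) has_field_derivative 1) (at 0)"
        by (rule has_field_derivative_transform_within_open[of "\<lambda>z. z" _ _ "ball 0 1"])
          (use gk(2) in auto)
      ultimately show ?thesis by (rule DERIV_unique)
    qed
    ultimately have "t * norm (deriv k 0) \<le> norm (deriv k 0) * norm (deriv g 0)"
      using t by (simp add: norm_mult [symmetric]) (simp add: norm_mult mult.commute)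
    moreover have "norm (deriv k 0) > 0" using \<open>deriv k 0 * deriv g 0 = 1\<close> by auto
    ultimately show ?thesis by (simp add: mult.commute)
  qed
  have "norm (deriv g 0) \<noteq> 1"
  proof
    assume "norm (deriv g 0) = 1"
    then obtain \<alpha> where \<alpha>: "\<And>z. norm z < 1 \<Longrightarrow> g z = \<alpha> * z" "norm \<alpha> = 1"
      using Schwarz_Lemma(3)[of g 0] ghol g0 disc_univalentD(5)[OF gdu] by auto
    have "z \<in> W" if "z \<in> ball 0 1" for z
    proof -
      have "g (z / \<alpha>) = z" using \<alpha>(1)[of "z / \<alpha>"] \<alpha>(2) that by (auto simp: norm_divide)
      moreover have "z / \<alpha> \<in> ball 0 1" using that \<alpha>(2) by (simp add: norm_divide)
      ultimately show ?thesis using gim by force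
    qed
    then have "outside U = - ball 0 1" using WB by (auto simp: W_def)
    moreover have "outside U \<noteq> - ball 0 1" unfolding U_def
      by (rule filled_union_ball_proper[OF \<Omega>, of t p]) (use t p in \<open>auto simp: \<Omega>_def\<close>)
    ultimately show False by contradiction
  qed
  then show ?thesis
    using that[OF gdu] gim UW low t disc_univalentD(7)[OF gdu] by (auto simp: U_def \<Omega>_def)
qed

text \<open>
  Montel's theorem supplies the limit; the lower bound for the derivatives keeps it nonconstant, and then
  Hurwitz's theorem makes it injective.
\<close>
lemma disc_univalent_compact:
  fixes H :: "nat \<Rightarrow> complex \<Rightarrow> complex"
  assumes H: "\<And>j. H j \<in> disc_univalent" and \<delta>: "\<delta> > 0" "\<And>j. \<delta> \<le> norm (deriv (H j) 0)"
  obtains h r where "h \<in> disc_univalent" "strict_mono (r :: nat \<Rightarrow> nat)"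
    "\<And>K. compact K \<Longrightarrow> K \<subseteq> ball 0 1 \<Longrightarrow> uniform_limit K (H \<circ> r) h sequentially"
    "\<And>k. (\<lambda>j. (deriv ^^ k) (H (r j)) 0) \<longlonglongrightarrow> (deriv ^^ k) h 0"
proof -
  note hd = disc_univalentD[OF H]
  obtain h r where h: "h holomorphic_on ball 0 1" and r: "strict_mono (r :: nat \<Rightarrow> nat)"
    and pt: "\<And>x. x \<in> ball 0 1 \<Longrightarrow> ((\<lambda>n. H (r n) x) \<longlongrightarrow> h x) sequentially"
    and ul: "\<And>K. \<lbrakk>compact K; K \<subseteq> ball 0 1\<rbrakk> \<Longrightarrow> uniform_limit K (H \<circ> r) h sequentially"
  proof (rule Montel[of "ball 0 1" disc_univalent H])
    show "\<And>h. h \<in> disc_univalent \<Longrightarrow> h holomorphic_on ball 0 1" by (rule disc_univalentD)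
    show "\<exists>B. \<forall>h\<in>disc_univalent. \<forall>z\<in>K. norm (h z) \<le> B" if "compact K" "K \<subseteq> ball 0 1" for K
    proof (intro exI[of _ 1] ballI)
      fix h z assume "h \<in> disc_univalent" "z \<in> K"
      then have "h z \<in> ball 0 1" using that(2) disc_univalentD(5) by blast
      then show "norm (h z) \<le> 1" by simp
    qed
    show "range H \<subseteq> disc_univalent" using H by auto
  qed auto
  have ul': "uniform_limit (ball 0 (1/2)) (H \<circ> r) h sequentially"
    by (rule uniform_limit_on_subset[OF ul[of "cball 0 (1/2)"]]) auto
  have dl: "(\<lambda>j. (deriv ^^ k) (H (r j)) 0) \<longlonglongrightarrow> (deriv ^^ k) h 0" for k
  proof -
    have "(\<lambda>j. (deriv ^^ k) ((H \<circ> r) j) 0) \<longlonglongrightarrow> (deriv ^^ k) h 0"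
    proof (rule higher_deriv_complex_uniform_limit[OF ul'])
      show "\<forall>\<^sub>F n in sequentially. (H \<circ> r) n holomorphic_on ball 0 (1 / 2)"
        by (intro always_eventually allI holomorphic_on_subset[OF hd(1)[of "r _"], folded comp_apply[of H r]]) auto
    qed auto
    then show ?thesis by simp
  qed
  have "(\<lambda>j. norm (deriv (H (r j)) 0)) \<longlonglongrightarrow> norm (deriv h 0)"
    using tendsto_norm[OF dl[of 1]] by simp
  then have "\<delta> \<le> norm (deriv h 0)"
    by (rule tendsto_lowerbound) (use \<delta> in auto)
  then have d0: "deriv h 0 \<noteq> 0" using \<delta>(1) by auto
  have nc: "\<not> h constant_on ball 0 1"
  proof
    assume "h constant_on ball 0 1"
    then obtain c where "\<And>z. z \<in> ball 0 1 \<Longrightarrow> h z = c" by (auto simp: constant_on_def)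
    then have "(h has_field_derivative 0) (at 0)"
      using has_field_derivative_transform_within_open[of "\<lambda>_. c" 0 0 "ball 0 1" h] by simp
    then show False using d0 DERIV_imp_deriv by blast
  qed
  have inj: "inj_on h (ball 0 1)"
    by (rule Hurwitz_injective[OF _ _ _ h ul nc]) (use hd in auto)
  have "h ` ball 0 1 \<subseteq> cball 0 1"
  proof safe
    fix z :: complex assume z: "z \<in> ball 0 1"
    have "norm (h z) \<le> 1"
      by (rule Lim_bounded[OF tendsto_norm[OF pt[OF z]], of 0])
        (use hd(5)[OF z] in \<open>auto intro: less_imp_le\<close>)
    then show "h z \<in> cball 0 1" by simp
  qed
  then have "h ` ball 0 1 \<subseteq> ball 0 1"
    using interior_maximal[OF _ open_mapping_thm3[OF h open_ball inj]] by (metis interior_cball)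
  moreover have "h 0 = 0"
    using pt[of 0] hd(3) by (simp add: LIMSEQ_const_iff)
  ultimately have "h \<in> disc_univalent" using h inj by (simp add: disc_univalent_def)
  then show ?thesis using that r ul dl by blast
qed

text \<open>
  Among the maps \<open>h\<close> with property \<open>Q\<close> whose image contains that of \<open>\<phi>\<close>, compactness provides one with
  minimal \<open>\<bar>h'(0)\<bar>\<close>. Write \<open>\<phi> = h \<circ> g\<close>. If \<open>g\<close> were not onto, a near-rotation whose image lies between
  that of \<open>g\<close> and the disc would lower the minimum. Thus \<open>g\<close> is a rotation, and one last step reaches \<open>\<phi>\<close>.
\<close>
theorem disc_univalent_induct:
  fixes Q :: "(complex \<Rightarrow> complex) \<Rightarrow> bool"
  assumes \<phi>: "\<phi> \<in> disc_univalent" and s: "s < 1"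
    and id: "Q (\<lambda>z. z)"
    and lim: "\<And>H h. (\<And>j::nat. H j \<in> disc_univalent \<and> Q (H j)) \<Longrightarrow> h \<in> disc_univalent \<Longrightarrow>
       (\<And>k. (\<lambda>j. (deriv ^^ k) (H j) 0) \<longlonglongrightarrow> (deriv ^^ k) h 0) \<Longrightarrow> Q h"
    and step: "\<And>h g. h \<in> disc_univalent \<Longrightarrow> Q h \<Longrightarrow> g \<in> disc_univalent \<Longrightarrow>
       s \<le> norm (deriv g 0) \<Longrightarrow> Q (h \<circ> g)"
  shows "Q \<phi>"
proof -
  define \<A> where "\<A> = {h \<in> disc_univalent. Q h \<and> \<phi> ` ball 0 1 \<subseteq> h ` ball 0 1}"
  define D where "D = (\<lambda>h. norm (deriv h 0)) ` \<A>"
  define m where "m = Inf D"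
  note p = disc_univalentD[OF \<phi>]
  have "(\<lambda>z. z) \<in> \<A>"
    using id p by (auto simp: \<A>_def disc_univalent_def)
  then have D: "D \<noteq> {}" "bdd_below D" by (auto simp: D_def intro!: bdd_belowI[of _ 0])
  have fac: "\<exists>g. g \<in> disc_univalent \<and> (\<forall>z\<in>ball 0 1. \<phi> z = h (g z)) \<and> deriv \<phi> 0 = deriv h 0 * deriv g 0"
    if h: "h \<in> \<A>" for h
  proof -
    have h': "h \<in> disc_univalent" "\<phi> ` ball 0 1 \<subseteq> h ` ball 0 1" using h by (auto simp: \<A>_def)
    obtain g where g: "g \<in> disc_univalent" "\<And>z. z \<in> ball 0 1 \<Longrightarrow> \<phi> z = h (g z)"
      using disc_univalent_factor[OF h'(1) \<phi> h'(2)] by blast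
    have "((h \<circ> g) has_field_derivative deriv \<phi> 0) (at 0)"
      by (rule has_field_derivative_transform_within_open[OF p(8) open_ball[of 0 1]]) (use g(2) in auto)
    then have "deriv \<phi> 0 = deriv h 0 * deriv g 0"
      using disc_univalent_compose(2)[OF h'(1) g(1)] by (simp add: DERIV_imp_deriv)
    then show ?thesis using g by blast
  qed
  have low: "norm (deriv \<phi> 0) \<le> norm (deriv h 0)" if "h \<in> \<A>" for h
  proof -
    obtain g where "g \<in> disc_univalent" "deriv \<phi> 0 = deriv h 0 * deriv g 0" using fac[OF \<open>h \<in> \<A>\<close>] by blast
    then show ?thesis using disc_univalentD(7)[of g]
      by (simp add: norm_mult mult_left_le)
  qed
  have "\<exists>h\<in>\<A>. norm (deriv h 0) < m + 1 / real (Suc j)" for j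
  proof -
    have "m < m + 1 / real (Suc j)" by simp
    then show ?thesis using cInf_lessD[OF D(1)] unfolding m_def D_def by blast
  qed
  then obtain H where H: "\<And>j. H j \<in> \<A>" "\<And>j. norm (deriv (H j) 0) < m + 1 / real (Suc j)"
    by metis
  have Hu: "H j \<in> disc_univalent" for j using H(1) by (auto simp: \<A>_def)
  have p0: "norm (deriv \<phi> 0) > 0" using p(6) by simp
  obtain h r where h: "h \<in> disc_univalent" "strict_mono (r :: nat \<Rightarrow> nat)"
    "\<And>K. compact K \<Longrightarrow> K \<subseteq> ball 0 1 \<Longrightarrow> uniform_limit K (H \<circ> r) h sequentially"
    "\<And>k. (\<lambda>j. (deriv ^^ k) (H (r j)) 0) \<longlonglongrightarrow> (deriv ^^ k) h 0"
    using disc_univalent_compact[of H "norm (deriv \<phi> 0)"] Hu p0 low H(1) by metis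
  have Qh: "Q h" by (rule lim[of "H \<circ> r"]) (use H(1) h Hu in \<open>auto simp: \<A>_def\<close>)
  \<comment> \<open>the infimum is attained at \<open>h\<close>\<close>
  have hm: "norm (deriv h 0) \<le> m"
  proof -
    have 1: "(\<lambda>j. norm (deriv (H (r j)) 0)) \<longlonglongrightarrow> norm (deriv h 0)"
      using tendsto_norm[OF h(4)[of 1]] by simp
    have "(\<lambda>j. m + 1 / real (Suc j)) \<longlonglongrightarrow> m + 0"
      by (intro tendsto_intros LIMSEQ_Suc[OF lim_1_over_n])
    then have "(\<lambda>j. m + 1 / real (Suc (r j))) \<longlonglongrightarrow> m"
      using LIMSEQ_subseq_LIMSEQ[OF _ h(2)] by (force simp: o_def)
    then show ?thesis by (rule LIMSEQ_le[OF 1]) (use H(2) in \<open>auto intro: less_imp_le\<close>)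
  qed
  have "\<forall>j. \<exists>g. g \<in> disc_univalent \<and> (\<forall>z\<in>ball 0 1. \<phi> z = H (r j) (g z)) \<and> deriv \<phi> 0 = deriv (H (r j)) 0 * deriv g 0"
    using fac H(1) by blast
  then obtain G where G: "\<And>j. G j \<in> disc_univalent" "\<And>j z. z \<in> ball 0 1 \<Longrightarrow> \<phi> z = H (r j) (G j z)"
     "\<And>j. deriv \<phi> 0 = deriv (H (r j)) 0 * deriv (G j) 0" by metis
  have "norm (deriv \<phi> 0) \<le> norm (deriv (G j) 0)" for j
    using disc_univalentD(7)[OF Hu[of "r j"]] by (simp add: G(3)[of j] norm_mult mult_left_le_one_le)
  then obtain g q where g: "g \<in> disc_univalent" "strict_mono (q :: nat \<Rightarrow> nat)"
    "\<And>K. compact K \<Longrightarrow> K \<subseteq> ball 0 1 \<Longrightarrow> uniform_limit K (G \<circ> q) g sequentially"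
    using disc_univalent_compact[of G "norm (deriv \<phi> 0)"] G(1) p0 by metis
  \<comment> \<open>the inner factors converge too, so the image of \<open>h\<close> still contains that of \<open>\<phi>\<close>\<close>
  have hg: "\<phi> z = h (g z)" if z: "z \<in> ball 0 1" for z
  proof -
    have gz: "norm (g z) < 1" using disc_univalentD(5)[OF g(1) z] by simp
    obtain \<rho> where \<rho>: "norm (g z) < \<rho>" "\<rho> < 1" using dense[OF gz] by blast
    have Gl: "(\<lambda>j. G (q j) z) \<longlonglongrightarrow> g z"
      using tendsto_uniform_limitI[OF g(3)[of "{z}"]] z by simp
    have ev: "\<forall>\<^sub>F j in sequentially. G (q j) z \<in> cball 0 \<rho>"
      using eventually_mono[OF order_tendstoD(2)[OF tendsto_norm[OF Gl] \<rho>(1)]] by simp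
    have "(\<lambda>j. H (r (q j)) (G (q j) z)) \<longlonglongrightarrow> h (g z)"
    proof (rule Lim_transform)
      have "isCont h (g z)"
        using holomorphic_on_imp_continuous_on[OF disc_univalentD(1)[OF h(1)]] gz
        by (simp add: continuous_on_eq_continuous_at)
      then show "(\<lambda>j. h (G (q j) z)) \<longlonglongrightarrow> h (g z)"
        using Gl by (rule isCont_tendsto_compose)
      have ul: "uniform_limit (cball 0 \<rho>) (H \<circ> r) h sequentially"
        using \<rho> by (intro h(3)) auto
      show "(\<lambda>j. H (r (q j)) (G (q j) z) - h (G (q j) z)) \<longlonglongrightarrow> 0"
      proof (rule metric_LIMSEQ_I)
        fix e :: real assume "e > 0"
        then have "\<forall>\<^sub>F j in sequentially. \<forall>x\<in>cball 0 \<rho>. dist ((H \<circ> r) j x) (h x) < e"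
          using ul by (rule uniform_limitD[rotated])
        then have "\<forall>\<^sub>F j in sequentially. \<forall>x\<in>cball 0 \<rho>. dist ((H \<circ> r) (q j) x) (h x) < e"
          using eventually_subseq[OF g(2)] by blast
        with ev have "\<forall>\<^sub>F j in sequentially. dist (H (r (q j)) (G (q j) z) - h (G (q j) z)) 0 < e"
          by eventually_elim (simp add: dist_norm)
        then show "\<exists>no. \<forall>n\<ge>no. dist (H (r (q n)) (G (q n) z) - h (G (q n) z)) 0 < e"
          by (simp add: eventually_sequentially)
      qed
    qed
    moreover have "H (r (q j)) (G (q j) z) = \<phi> z" for j using G(2)[OF z] by simp
    ultimately show ?thesis by (simp add: LIMSEQ_const_iff)
  qed
  have onto: "ball 0 1 \<subseteq> g ` ball 0 1"
  proof (rule ccontr)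
    assume "\<not> ball 0 1 \<subseteq> g ` ball 0 1"
    then obtain w where w: "w \<in> ball 0 1" "w \<notin> g ` ball 0 1" by blast
    obtain k where k: "k \<in> disc_univalent" "g ` ball 0 1 \<subseteq> k ` ball 0 1" "s \<le> norm (deriv k 0)" "norm (deriv k 0) < 1"
      using intermediate_disc_univalent[OF g(1) w s] by blast
    have "Q (h \<circ> k)" by (rule step[OF h(1) Qh k(1,3)])
    moreover have "\<phi> ` ball 0 1 \<subseteq> (h \<circ> k) ` ball 0 1"
      using k(2) hg by (fastforce simp: image_subset_iff image_iff)
    ultimately have "h \<circ> k \<in> \<A>" using disc_univalent_compose[OF h(1) k(1)] by (auto simp: \<A>_def)
    then have "m \<le> norm (deriv (h \<circ> k) 0)"
      unfolding m_def using D(2) by (intro cInf_lower) (auto simp: D_def)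
    also have "\<dots> < norm (deriv h 0)"
      using k(4) disc_univalentD(6)[OF h(1)] unfolding disc_univalent_compose(2)[OF h(1) k(1)]
      by (simp add: norm_mult)
    finally show False using hm by simp
  qed
  have "norm (deriv g 0) = 1"
  proof -
    have "(\<lambda>z. z) \<in> disc_univalent" by (auto simp: disc_univalent_def)
    then obtain k where k: "k \<in> disc_univalent" "\<And>z. z \<in> ball 0 1 \<Longrightarrow> z = g (k z)"
      using disc_univalent_factor[OF g(1), of "\<lambda>z. z"] onto by auto
    have "((g \<circ> k) has_field_derivative 1) (at 0)"
      by (rule has_field_derivative_transform_within_open[of "\<lambda>z. z" _ _ "ball 0 1"]) (use k(2) in auto)
    then have "deriv g 0 * deriv k 0 = 1"
      using disc_univalent_compose(2)[OF g(1) k(1)] DERIV_imp_deriv by metis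
    then have "norm (deriv g 0) * norm (deriv k 0) = 1" by (metis norm_mult norm_one)
    moreover have "norm (deriv g 0) * norm (deriv k 0) \<le> norm (deriv g 0) * 1"
      using disc_univalentD(7)[OF k(1)] by (intro mult_left_mono) auto
    ultimately show ?thesis using disc_univalentD(7)[OF g(1)] by linarith
  qed
  then have Qhg: "Q (h \<circ> g)" using step[OF h(1) Qh g(1)] s by simp
  have hgu: "h \<circ> g \<in> disc_univalent" by (rule disc_univalent_compose[OF h(1) g(1)])
  have "(deriv ^^ k) (h \<circ> g) 0 = (deriv ^^ k) \<phi> 0" for k
    using hg disc_univalentD(1)[OF hgu] p(1)
    by (intro higher_deriv_transform_within_open[of _ "ball 0 1"]) auto
  then show "Q \<phi>"
    using lim[of "\<lambda>_. h \<circ> g" \<phi>] Qhg hgu \<phi> by simp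
qed

section \<open>Slope bounds for univalent functions\<close>

lemma holomorphic_has_fps_expansion:
  assumes "f holomorphic_on ball 0 r" "r > 0"
  shows "f has_fps_expansion fps_expansion f 0"
  using assms by (intro analytic_at_imp_has_fps_expansion_0 holomorphic_on_imp_analytic_at[of _ "ball 0 r"]) auto

lemma has_fps_expansion_transform_ball:
  fixes f g :: "complex \<Rightarrow> complex"
  assumes "f has_fps_expansion F" "r > 0" "\<And>z. z \<in> ball 0 r \<Longrightarrow> g z = f z"
  shows "g has_fps_expansion F"
proof (rule has_fps_expansion_cong[THEN iffD1, OF _ refl assms(1)])
  have "\<forall>\<^sub>F z in nhds 0. z \<in> ball (0::complex) r"
    using assms(2) by (intro eventually_nhds_in_open) auto
  then show "\<forall>\<^sub>F z in nhds 0. f z = g z" by eventually_elim (simp add: assms(3))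
qed

lemma fps_nth_fps_expansion_0: "fps_nth (fps_expansion f 0) n = (deriv ^^ n) f 0 / fact n"
  by (simp add: fps_expansion_def)

lemma disc_univalent_quotient:
  assumes "g \<in> disc_univalent"
  obtains B where "B holomorphic_on ball 0 1" "\<And>z. z \<in> ball 0 1 \<Longrightarrow> norm (B z) \<le> 1"
    "B 0 = deriv g 0" "fps_expansion g 0 = fps_X * fps_expansion B 0"
proof -
  note g = disc_univalentD[OF assms]
  obtain B where B: "B holomorphic_on ball 0 1" "\<And>z. norm z < 1 \<Longrightarrow> g z = z * B z" "deriv g 0 = B 0"
    using Schwarz3[OF g(1,3)] by blast
  have "norm (B z) \<le> 1" if z: "z \<in> ball 0 1" for z
  proof (cases "z = 0")
    case True then show ?thesis using g(7) B(3) by simp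
  next
    case False
    have "norm (g z) \<le> norm z"
      using Schwarz_Lemma(1)[of g z] g(1,3,5) z by auto
    then show ?thesis using False B(2)[of z] z by (simp add: norm_mult mult_le_cancel_left1)
  qed
  moreover have "fps_expansion g 0 = fps_X * fps_expansion B 0"
  proof (rule fps_expansion_unique_complex)
    show "g has_fps_expansion fps_expansion g 0" by (rule holomorphic_has_fps_expansion[OF g(1)]) simp
    have "(\<lambda>z. z * B z) has_fps_expansion (fps_X * fps_expansion B 0)"
      by (intro fps_expansion_intros holomorphic_has_fps_expansion[OF B(1)]) auto
    then show "g has_fps_expansion (fps_X * fps_expansion B 0)"
      by (rule has_fps_expansion_transform_ball[of _ _ 1]) (use B(2) in auto)
  qed
  ultimately show ?thesis using that[of B] B by simp
qed

lemma tendsto_fps_mult: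
  assumes "\<And>k. ((\<lambda>j. fps_nth (A j) k) \<longlongrightarrow> fps_nth a k) F" "\<And>k. ((\<lambda>j. fps_nth (B j) k) \<longlongrightarrow> fps_nth b k) F"
  shows "((\<lambda>j. fps_nth (A j * B j :: complex fps) k) \<longlongrightarrow> fps_nth (a * b) k) F"
  unfolding fps_mult_nth by (intro tendsto_intros assms)

lemma tendsto_fps_power:
  assumes "\<And>k. ((\<lambda>j. fps_nth (A j :: complex fps) k) \<longlongrightarrow> fps_nth a k) F"
  shows "((\<lambda>j. fps_nth (A j ^ i) k) \<longlongrightarrow> fps_nth (a ^ i) k) F"
proof (induction i arbitrary: k)
  case (Suc i)
  then show ?case unfolding power_Suc by (intro tendsto_fps_mult assms)
qed simp

text \<open>
  Each slope coefficient is a rational function of finitely many Taylor coefficients, with a power of the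
  first one as denominator.
\<close>
lemma tendsto_slope:
  assumes A: "\<And>k. ((\<lambda>j. fps_nth (A j) k) \<longlongrightarrow> fps_nth a k) F" and a1: "fps_nth a 1 \<noteq> 0"
  shows "((\<lambda>j. fps_nth (slope (A j)) k) \<longlongrightarrow> fps_nth (slope a) k) F"
proof -
  have inv: "((\<lambda>j. fps_nth (fps_inv (A j)) k) \<longlongrightarrow> fps_nth (fps_inv a) k) F" for k
  proof (induction k rule: less_induct)
    case (less k)
    show ?case
    proof (cases k)
      case (Suc m)
      have "((\<lambda>j. compinv (A j) i) \<longlongrightarrow> compinv a i) F" if "i \<le> m" for i
        using less[of i] that Suc by (simp add: fps_inv_def)
      then show ?thesis
        unfolding fps_inv_def Suc fps_nth_Abs_fps compinv.simps using a1
        by (intro tendsto_intros tendsto_fps_power A) auto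
    qed (simp add: fps_inv_def)
  qed
  show ?thesis unfolding slope_def fps_compose_nth fps_shift_nth
    by (intro tendsto_intros tendsto_fps_power inv A)
qed

lemma slope_X: "slope fps_X = 1"
proof -
  have "fps_shift 1 fps_X = (1 :: complex fps)" by (simp add: fps_eq_iff fps_X_def)
  then show ?thesis by (simp add: slope_def)
qed

lemma slope_bounded_X: "slope_bounded \<kappa> n fps_X" if "\<kappa> \<ge> 1"
  using that by (auto simp: slope_bounded_def slope_X maj_slope_nonneg)

lemma quad_bounded_X: "quad_bounded \<kappa> fps_X" if "\<kappa> \<ge> 1"
  using that by (auto simp: quad_bounded_def slope_X)

text \<open>
  All conditions on \<open>\<alpha>\<close> that the two composition lemmas require hold strictly at \<open>\<alpha> = 1\<close> because
  \<open>\<kappa> > 1\<close>, hence also near \<open>1\<close>. So the induction principle applies.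
\<close>
lemma disc_univalent_bounds:
  assumes \<phi>: "\<phi> \<in> disc_univalent" and \<kappa>: "\<kappa> > 1"
  shows "slope_bounded \<kappa> n (fps_expansion \<phi> 0) \<and> quad_bounded \<kappa> (fps_expansion \<phi> 0)"
proof -
  define good where "good = (\<lambda>\<alpha> :: real. 1/2 < \<alpha> \<and> (1 + 2 * (1 - \<alpha>) / \<alpha>) ^ n < \<kappa> * \<alpha> ^ Suc n
     \<and> 2 / \<alpha> + 4 * (1 - \<alpha>) / \<alpha>\<^sup>2 < \<kappa> * (1 + \<alpha>))"
  have "\<forall>\<^sub>F \<alpha> in nhds 1. good \<alpha>"
  proof -
    have "\<forall>\<^sub>F \<alpha> in nhds (1::real). 1/2 < \<alpha>"
      by (rule order_tendstoD[OF filterlim_ident]) simp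
    moreover have "((\<lambda>\<alpha>. \<kappa> * \<alpha> ^ Suc n - (1 + 2 * (1 - \<alpha>) / \<alpha>) ^ n) \<longlongrightarrow>
        \<kappa> * 1 ^ Suc n - (1 + 2 * (1 - 1) / 1) ^ n) (nhds (1::real))"
      by (intro tendsto_intros filterlim_ident) auto
    then have "\<forall>\<^sub>F \<alpha> in nhds (1::real). 0 < \<kappa> * \<alpha> ^ Suc n - (1 + 2 * (1 - \<alpha>) / \<alpha>) ^ n"
      by (rule order_tendstoD) (use \<kappa> in simp)
    moreover have "((\<lambda>\<alpha>. \<kappa> * (1 + \<alpha>) - (2 / \<alpha> + 4 * (1 - \<alpha>) / \<alpha>\<^sup>2)) \<longlongrightarrow>
        \<kappa> * (1 + 1) - (2 / 1 + 4 * (1 - 1) / 1\<^sup>2)) (nhds (1::real))"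
      by (intro tendsto_intros filterlim_ident) auto
    then have "\<forall>\<^sub>F \<alpha> in nhds (1::real). 0 < \<kappa> * (1 + \<alpha>) - (2 / \<alpha> + 4 * (1 - \<alpha>) / \<alpha>\<^sup>2)"
      by (rule order_tendstoD) (use \<kappa> in simp)
    ultimately show ?thesis unfolding good_def by eventually_elim auto
  qed
  then obtain d where d: "d > 0" "\<And>\<alpha>. dist \<alpha> 1 < d \<Longrightarrow> good \<alpha>"
    by (auto simp: eventually_nhds_metric)
  define s where "s = 1 - d / 2"
  have good: "good \<alpha>" if "s \<le> \<alpha>" "\<alpha> \<le> 1" for \<alpha>
    using that d(1) by (intro d(2)) (auto simp: s_def dist_real_def)
  show ?thesis
  proof (rule disc_univalent_induct[OF \<phi>, of s])
    show "s < 1" using d by (simp add: s_def)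
    have "fps_expansion (\<lambda>z. z) 0 = fps_X"
      by (rule fps_expansion_unique_complex[OF holomorphic_has_fps_expansion[of _ 1]])
        (auto intro: fps_expansion_intros holomorphic_intros)
    then show "slope_bounded \<kappa> n (fps_expansion (\<lambda>z. z) 0) \<and> quad_bounded \<kappa> (fps_expansion (\<lambda>z. z) 0)"
      using \<kappa> by (simp add: slope_bounded_X quad_bounded_X)
  next
    fix H h
    assume H: "\<And>j::nat. H j \<in> disc_univalent \<and> slope_bounded \<kappa> n (fps_expansion (H j) 0) \<and> quad_bounded \<kappa> (fps_expansion (H j) 0)"
      and h: "h \<in> disc_univalent" and lim: "\<And>k. (\<lambda>j. (deriv ^^ k) (H j) 0) \<longlonglongrightarrow> (deriv ^^ k) h 0"
    have A: "(\<lambda>j. fps_nth (fps_expansion (H j) 0) k) \<longlonglongrightarrow> fps_nth (fps_expansion h 0) k" for k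
      unfolding fps_nth_fps_expansion_0 by (intro tendsto_intros lim) auto
    have h1: "fps_nth (fps_expansion h 0) 1 \<noteq> 0"
      using disc_univalentD(6)[OF h] by (simp add: fps_nth_fps_expansion_0)
    note sl = tendsto_slope[OF A h1]
    show "slope_bounded \<kappa> n (fps_expansion h 0) \<and> quad_bounded \<kappa> (fps_expansion h 0)"
    proof
      show "slope_bounded \<kappa> n (fps_expansion h 0)"
        unfolding slope_bounded_def
      proof (intro allI impI)
        fix k assume k: "1 \<le> k \<and> k \<le> n"
        have "(\<lambda>j. norm (fps_nth (slope (fps_expansion (H j) 0)) k)) \<longlonglongrightarrow> norm (fps_nth (slope (fps_expansion h 0)) k)"
          by (intro tendsto_intros sl)
        moreover have "(\<lambda>j. norm (fps_nth (fps_expansion (H j) 0) 1) * (fps_nth maj_slope k * (\<kappa> / norm (fps_nth (fps_expansion (H j) 0) 1)) ^ k))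
          \<longlonglongrightarrow> norm (fps_nth (fps_expansion h 0) 1) * (fps_nth maj_slope k * (\<kappa> / norm (fps_nth (fps_expansion h 0) 1)) ^ k)"
          using h1 by (intro tendsto_intros A) auto
        ultimately show "norm (fps_nth (slope (fps_expansion h 0)) k)
          \<le> norm (fps_nth (fps_expansion h 0) 1) * (fps_nth maj_slope k * (\<kappa> / norm (fps_nth (fps_expansion h 0) 1)) ^ k)"
          by (rule LIMSEQ_le) (use H k in \<open>auto simp: slope_bounded_def\<close>)
      qed
      show "quad_bounded \<kappa> (fps_expansion h 0)"
        unfolding quad_bounded_def
      proof (intro allI impI)
        fix e :: complex and \<nu> :: real assume e: "norm e = 1" "0 \<le> \<nu>"
        show "Re (e\<^sup>2 * (- fps_nth (fps_expansion h 0) 1 * fps_nth (slope (fps_expansion h 0)) 2)) + \<nu>\<^sup>2 * Im (e * - fps_nth (slope (fps_expansion h 0)) 1)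
         \<le> \<kappa> + 8 * \<nu> ^ 3"
        proof (rule Lim_bounded)
          show "(\<lambda>j. Re (e\<^sup>2 * (- fps_nth (fps_expansion (H j) 0) 1 * fps_nth (slope (fps_expansion (H j) 0)) 2)) + \<nu>\<^sup>2 * Im (e * - fps_nth (slope (fps_expansion (H j) 0)) 1))
            \<longlonglongrightarrow> Re (e\<^sup>2 * (- fps_nth (fps_expansion h 0) 1 * fps_nth (slope (fps_expansion h 0)) 2)) + \<nu>\<^sup>2 * Im (e * - fps_nth (slope (fps_expansion h 0)) 1)"
            by (intro tendsto_intros A sl)
          show "\<forall>j\<ge>0. Re (e\<^sup>2 * (- fps_nth (fps_expansion (H j) 0) 1 * fps_nth (slope (fps_expansion (H j) 0)) 2)) + \<nu>\<^sup>2 * Im (e * - fps_nth (slope (fps_expansion (H j) 0)) 1) \<le> \<kappa> + 8 * \<nu> ^ 3"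
            using H e unfolding quad_bounded_def by blast
        qed
      qed
    qed
  next
    fix h g
    assume h: "h \<in> disc_univalent" and g: "g \<in> disc_univalent" and s: "s \<le> norm (deriv g 0)"
      and bd: "slope_bounded \<kappa> n (fps_expansion h 0) \<and> quad_bounded \<kappa> (fps_expansion h 0)"
    obtain B where B: "B holomorphic_on ball 0 1" "\<And>z. z \<in> ball 0 1 \<Longrightarrow> norm (B z) \<le> 1"
      "B 0 = deriv g 0" "fps_expansion g 0 = fps_X * fps_expansion B 0"
      using disc_univalent_quotient[OF g] by blast
    have hg: "fps_expansion (h \<circ> g) 0 = fps_expansion h 0 oo (fps_X * fps_expansion B 0)"
      unfolding B(4) [symmetric]
    proof (rule fps_expansion_unique_complex)
      show "(h \<circ> g) has_fps_expansion fps_expansion (h \<circ> g) 0"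
        by (rule holomorphic_has_fps_expansion[OF disc_univalentD(1)[OF disc_univalent_compose(1)[OF h g]]]) simp
      show "(h \<circ> g) has_fps_expansion (fps_expansion h 0 oo fps_expansion g 0)"
        by (intro has_fps_expansion_compose holomorphic_has_fps_expansion[OF disc_univalentD(1)[OF h]]
            holomorphic_has_fps_expansion[OF disc_univalentD(1)[OF g]])
          (auto simp: fps_nth_fps_expansion_0 disc_univalentD(3)[OF g])
    qed
    define \<alpha> where "\<alpha> = norm (deriv g 0)"
    have \<alpha>: "\<alpha> \<le> 1" "good \<alpha>" using disc_univalentD(7)[OF g] good s by (auto simp: \<alpha>_def)
    have h01: "fps_nth (fps_expansion h 0) 0 = 0" "fps_nth (fps_expansion h 0) 1 \<noteq> 0"
      using disc_univalentD(3,6)[OF h] by (auto simp: fps_nth_fps_expansion_0)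
    have b0: "fps_nth (fps_expansion B 0) 0 = B 0" by (simp add: fps_nth_fps_expansion_0)
    have B0: "B 0 \<noteq> 0" using B(3) disc_univalentD(6)[OF g] by simp
    have coeff: "norm (fps_nth (fps_expansion B 0) k) \<le> 2 * (1 - \<alpha>)" if "1 \<le> k" for k
      using bounded_coeff_le[OF B(1,2) that B0] by (simp add: fps_nth_fps_expansion_0 B(3) \<alpha>_def)
    have quad: "Re (e\<^sup>2 * (- cnj (sgn (fps_nth (fps_expansion B 0) 0)) * fps_nth (fps_expansion B 0) 2))
       + \<nu>\<^sup>2 * Im (e * (- cnj (sgn (fps_nth (fps_expansion B 0) 0)) * fps_nth (fps_expansion B 0) 1))
        \<le> 2 * (1 - \<alpha>) * (1 + \<nu> ^ 3)" if "norm e = 1" "0 \<le> \<nu>" for e \<nu>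
      unfolding b0 unfolding fps_nth_fps_expansion_0 \<alpha>_def B(3) [symmetric]
      by (rule bounded_coeff_quadratic[OF B(1,2) that])
    have "slope_bounded \<kappa> n (fps_expansion (h \<circ> g) 0)"
      unfolding hg
      by (rule slope_bounded_compose[OF h01, of _ \<alpha>])
        (use bd \<alpha> coeff \<kappa> B0 in \<open>auto simp: b0 B(3) \<alpha>_def good_def\<close>)
    moreover have "quad_bounded \<kappa> (fps_expansion (h \<circ> g) 0)"
      unfolding hg
    proof (rule quad_bounded_compose[OF h01 _ _ \<alpha>(1) _ _ quad])
      show "\<alpha> = norm (fps_nth (fps_expansion B 0) 0)" by (simp add: b0 B(3) \<alpha>_def)
    qed (use bd \<alpha> coeff[of 1] B0 in \<open>auto simp: b0 good_def\<close>)
    ultimately show "slope_bounded \<kappa> n (fps_expansion (h \<circ> g) 0) \<and> quad_bounded \<kappa> (fps_expansion (h \<circ> g) 0)" ..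
  qed
qed

lemma slope_scale:
  fixes A :: "complex fps"
  assumes A: "fps_nth A 0 = 0" "fps_nth A 1 \<noteq> 0" and cr: "c \<noteq> 0" "r \<noteq> 0"
  shows "fps_nth (slope (fps_const c * (A oo (fps_const r * fps_X)))) k = c * r * fps_nth (slope A) k / c ^ k"
proof -
  define C where "C = fps_const c * (A oo (fps_const r * fps_X))"
  define L where "L = fps_const (1 / c) * (fps_X :: complex fps)"
  define \<Psi> where "\<Psi> = fps_const (1 / r) * (fps_inv A oo L)"
  have L0: "fps_nth L 0 = 0" by (simp add: L_def)
  have \<Psi>0: "fps_nth \<Psi> 0 = 0" by (simp add: \<Psi>_def)
  have C0: "fps_nth C 0 = 0" by (simp add: C_def A)
  have "fps_nth C 1 = c * r * fps_nth A 1" by (simp add: C_def fps_compose_linear)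
  then have C1: "fps_nth C 1 \<noteq> 0" using A cr by simp
  have r\<Psi>: "(fps_const r * fps_X) oo \<Psi> = fps_inv A oo L"
    using cr \<Psi>0 by (simp add: fps_compose_mult_distrib \<Psi>_def mult.assoc [symmetric])
  have "C oo \<Psi> = fps_const c * ((A oo (fps_const r * fps_X)) oo \<Psi>)"
    unfolding C_def fps_compose_mult_distrib[OF \<Psi>0] by simp
  also have "(A oo (fps_const r * fps_X)) oo \<Psi> = A oo (fps_inv A oo L)"
    unfolding r\<Psi> [symmetric] by (rule fps_compose_assoc [symmetric]) (use \<Psi>0 in auto)
  also have "A oo (fps_inv A oo L) = (A oo fps_inv A) oo L"
    by (rule fps_compose_assoc) (use L0 in auto)
  also have "fps_const c * ((A oo fps_inv A) oo L) = fps_const c * L"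
    using L0 by (simp add: fps_inv_right[OF A])
  also have "\<dots> = fps_X"
    using cr by (simp add: L_def mult.assoc [symmetric])
  finally have "C oo \<Psi> = fps_X" .
  then have "fps_inv C oo (C oo \<Psi>) = fps_inv C" by simp
  then have inv: "fps_inv C = \<Psi>"
    using fps_inv[OF C0 C1] \<Psi>0 C0 by (simp add: fps_compose_assoc)
  have "\<Psi> * slope C = fps_X" using fps_inv_mult_slope[OF C0 C1] inv by simp
  also have "fps_X = fps_const c * L"
    using cr by (simp add: L_def mult.assoc [symmetric])
  also have "L = (fps_inv A * slope A) oo L"
    unfolding fps_inv_mult_slope[OF A] using L0 by simp
  also have "fps_const c * \<dots> = \<Psi> * (fps_const (c * r) * (slope A oo L))"
    using cr L0 by (simp add: \<Psi>_def fps_compose_mult_distrib mult_ac flip: fps_const_mult)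
  finally have "\<Psi> * slope C = \<Psi> * (fps_const (c * r) * (slope A oo L))" .
  moreover have "\<Psi> \<noteq> 0" using fps_inv_mult_slope[OF C0 C1] inv by auto
  ultimately have "slope C = fps_const (c * r) * (slope A oo L)" by simp
  moreover have "fps_nth (slope A oo L) k = fps_nth (slope A) k / c ^ k"
    unfolding L_def fps_compose_linear by (simp add: power_one_over field_simps)
  ultimately show ?thesis by (simp add: C_def)
qed

lemma class_SD:
  assumes "f \<in> class_S"
  shows "f holomorphic_on ball 0 1" "inj_on f (ball 0 1)" "f 0 = 0" "deriv f 0 = 1"
    "f has_fps_expansion fps_expansion f 0"
    "fps_nth (fps_expansion f 0) 0 = 0" "fps_nth (fps_expansion f 0) 1 = 1"
proof -
  show h: "f holomorphic_on ball 0 1" and "inj_on f (ball 0 1)" "f 0 = 0" "deriv f 0 = 1"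
    using assms by (auto simp: class_S_def analytic_imp_holomorphic)
  show "f has_fps_expansion fps_expansion f 0" by (rule holomorphic_has_fps_expansion[OF h]) simp
  show "fps_nth (fps_expansion f 0) 0 = 0" "fps_nth (fps_expansion f 0) 1 = 1"
    using \<open>f 0 = 0\<close> \<open>deriv f 0 = 1\<close> by (simp_all add: fps_nth_fps_expansion_0)
qed

text \<open>
  The bounds for the self-map \<open>f(r z) / M\<close> with \<open>r = 1 / t\<close> and \<open>\<kappa> = t\<close>. By \<open>slope_scale\<close> the constant
  \<open>M\<close> cancels, so the possible unboundedness of \<open>f\<close> is harmless.
\<close>
lemma class_S_bounds_aux:
  assumes f: "f \<in> class_S" and t: "t > 1"
  defines "A \<equiv> fps_expansion f 0"
  shows "1 \<le> k \<Longrightarrow> norm (fps_nth (slope A) k) \<le> fps_nth maj_slope k * (t\<^sup>2) ^ k"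
    and "norm e = 1 \<Longrightarrow> 0 \<le> \<nu> \<Longrightarrow>
      Re (- e\<^sup>2 * fps_nth (slope A) 2) / t\<^sup>2 + \<nu>\<^sup>2 * Im (- e * fps_nth (slope A) 1) / t \<le> t + 8 * \<nu> ^ 3"
proof -
  note F = class_SD[OF f]
  define r where "r = 1 / t"
  have r: "0 < r" "r < 1" using t by (auto simp: r_def)
  have sub: "(\<lambda>z. complex_of_real r * z) ` ball 0 1 \<subseteq> cball 0 r"
    using r by (auto simp: norm_mult mult_left_le)
  have "compact (f ` cball 0 r)"
    using r by (intro compact_continuous_image holomorphic_on_imp_continuous_on holomorphic_on_subset[OF F(1)]) auto
  then obtain M0 where M0: "\<And>z. z \<in> cball 0 r \<Longrightarrow> norm (f z) \<le> M0"
    using compact_imp_bounded bounded_iff by (metis (no_types, lifting) imageI)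
  \<comment> \<open>strictly larger than \<open>\<bar>f\<bar>\<close> on the smaller disc, so that the image lies in the open unit disc\<close>
  define M where "M = max M0 1 + 1"
  have M: "M > 0" "norm (f z) < M" if "z \<in> cball 0 r" for z
    using M0[OF that] by (auto simp: M_def)
  have M: "M > 0" "\<And>z. z \<in> cball 0 r \<Longrightarrow> norm (f z) < M"
    using M[of 0] M(2) r by auto
  define c where "c = complex_of_real (1 / M)"
  define \<phi> where "\<phi> = (\<lambda>z. c * f (of_real r * z))"
  have du: "\<phi> \<in> disc_univalent"
    unfolding disc_univalent_def
  proof (intro CollectI conjI)
    have "(f \<circ> (\<lambda>z. of_real r * z)) holomorphic_on ball 0 1"
    proof (rule holomorphic_on_compose_gen[OF _ F(1)])
      show "(\<lambda>z. of_real r * z) holomorphic_on ball 0 1" by (intro holomorphic_intros)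
      have "cball 0 r \<subseteq> ball (0::complex) 1" using r by auto
      then show "(\<lambda>z. of_real r * z) ` ball 0 1 \<subseteq> ball (0::complex) 1" by (rule order_trans[OF sub])
    qed
    then show "\<phi> holomorphic_on ball 0 1" by (auto simp: \<phi>_def o_def intro: holomorphic_intros)
    show "inj_on \<phi> (ball 0 1)"
    proof (rule inj_onI)
      fix x y :: complex assume xy: "x \<in> ball 0 1" "y \<in> ball 0 1" "\<phi> x = \<phi> y"
      then have "f (of_real r * x) = f (of_real r * y)" using M by (simp add: \<phi>_def c_def)
      moreover have "of_real r * x \<in> ball 0 1" "of_real r * y \<in> ball 0 1" using sub xy r by force+
      ultimately show "x = y" using F(2) r by (auto dest: inj_onD)
    qed
    show "\<phi> 0 = 0" by (simp add: \<phi>_def F)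
    show "\<phi> ` ball 0 1 \<subseteq> ball 0 1"
    proof safe
      fix z :: complex assume "z \<in> ball 0 1"
      then have "norm (f (of_real r * z)) < M" using sub M(2) by blast
      then show "\<phi> z \<in> ball 0 1" using M by (simp add: \<phi>_def c_def norm_mult norm_divide)
    qed
  qed
  have exp: "fps_expansion \<phi> 0 = fps_const c * (A oo (fps_const (of_real r) * fps_X))"
  proof (rule fps_expansion_unique_complex)
    show "\<phi> has_fps_expansion fps_expansion \<phi> 0"
      by (rule holomorphic_has_fps_expansion[OF disc_univalentD(1)[OF du]]) simp
    have "(f \<circ> (\<lambda>z. of_real r * z)) has_fps_expansion (A oo (fps_const (of_real r) * fps_X))"
      unfolding A_def by (intro has_fps_expansion_compose F(5) fps_expansion_intros) auto
    then have "(\<lambda>z. c * (f \<circ> (\<lambda>z. of_real r * z)) z) has_fps_expansion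
        (fps_const c * (A oo (fps_const (of_real r) * fps_X)))"
      by (rule has_fps_expansion_cmult_left)
    then show "\<phi> has_fps_expansion (fps_const c * (A oo (fps_const (of_real r) * fps_X)))"
      by (simp add: \<phi>_def o_def)
  qed
  have A01: "fps_nth A 0 = 0" "fps_nth A 1 = 1" using F by (auto simp: A_def)
  have cr: "c \<noteq> 0" "complex_of_real r \<noteq> 0" using M r by (auto simp: c_def)
  have sl: "fps_nth (slope (fps_expansion \<phi> 0)) k = c * of_real r * fps_nth (slope A) k / c ^ k" for k
    unfolding exp by (rule slope_scale) (use A01 cr in auto)
  have e1: "fps_nth (fps_expansion \<phi> 0) 1 = c * of_real r"
    unfolding exp using A01 by (simp add: fps_compose_linear)
  note bd = disc_univalent_bounds[OF du t, of k]
  show "norm (fps_nth (slope A) k) \<le> fps_nth maj_slope k * (t\<^sup>2) ^ k" if k: "1 \<le> k"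
  proof -
    have nc: "norm c = 1 / M" using M by (simp add: c_def norm_divide)
    have "norm (c * of_real r * fps_nth (slope A) k / c ^ k)
        \<le> norm (c * of_real r) * (fps_nth maj_slope k * (t / norm (c * of_real r)) ^ k)"
      using bd k unfolding slope_bounded_def sl e1 by auto
    then have "norm (c * of_real r) * (norm (fps_nth (slope A) k) * M ^ k)
        \<le> norm (c * of_real r) * (fps_nth maj_slope k * (t / norm (c * of_real r)) ^ k)"
      by (simp add: norm_mult norm_divide norm_power nc power_one_over)
    then have "norm (fps_nth (slope A) k) * M ^ k \<le> fps_nth maj_slope k * (t / norm (c * of_real r)) ^ k"
      by (rule mult_left_le_imp_le) (use cr in simp)
    also have "t / norm (c * of_real r) = M * t\<^sup>2"
    proof -
      have "norm (c * of_real r) = 1 / M * (1 / t)"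
        unfolding norm_mult nc using t by (simp add: r_def norm_divide)
      then show ?thesis using M t by (simp add: power2_eq_square)
    qed
    also have "fps_nth maj_slope k * (M * t\<^sup>2) ^ k = fps_nth maj_slope k * (t\<^sup>2) ^ k * M ^ k"
      by (simp add: power_mult_distrib)
    finally show ?thesis using M by simp
  qed
  show "Re (- e\<^sup>2 * fps_nth (slope A) 2) / t\<^sup>2 + \<nu>\<^sup>2 * Im (- e * fps_nth (slope A) 1) / t \<le> t + 8 * \<nu> ^ 3"
    if e: "norm e = 1" "0 \<le> \<nu>"
  proof -
    have "Re (e\<^sup>2 * (- fps_nth (fps_expansion \<phi> 0) 1 * fps_nth (slope (fps_expansion \<phi> 0)) 2))
      + \<nu>\<^sup>2 * Im (e * - fps_nth (slope (fps_expansion \<phi> 0)) 1) \<le> t + 8 * \<nu> ^ 3"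
      using bd e unfolding quad_bounded_def by blast
    moreover have "e\<^sup>2 * (- fps_nth (fps_expansion \<phi> 0) 1 * fps_nth (slope (fps_expansion \<phi> 0)) 2)
        = (- e\<^sup>2 * fps_nth (slope A) 2) / of_real (t\<^sup>2)"
      unfolding e1 sl using cr t by (simp add: r_def field_simps power2_eq_square)
    moreover have "e * - fps_nth (slope (fps_expansion \<phi> 0)) 1 = (- e * fps_nth (slope A) 1) / of_real t"
      unfolding sl using cr t by (simp add: r_def field_simps)
    ultimately show ?thesis by (simp only: Re_divide_of_real Im_divide_of_real times_divide_eq_right)
  qed
qed

theorem class_S_slope_bound:
  assumes f: "f \<in> class_S" and k: "1 \<le> k"
  shows "norm (fps_nth (slope (fps_expansion f 0)) k) \<le> fps_nth maj_slope k"
proof -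
  have "((\<lambda>t::real. fps_nth maj_slope k * (t\<^sup>2) ^ k) \<longlongrightarrow> fps_nth maj_slope k * (1\<^sup>2) ^ k) (at_right 1)"
    by (intro tendsto_intros)
  moreover have "\<forall>\<^sub>F t in at_right 1. norm (fps_nth (slope (fps_expansion f 0)) k) \<le> fps_nth maj_slope k * (t\<^sup>2) ^ k"
    using class_S_bounds_aux(1)[OF f _ k] by (auto simp: eventually_at_filter)
  ultimately have "norm (fps_nth (slope (fps_expansion f 0)) k) \<le> fps_nth maj_slope k * (1\<^sup>2) ^ k"
    by (intro tendsto_lowerbound) auto
  then show ?thesis by simp
qed

lemma class_S_quadratic_bound:
  assumes f: "f \<in> class_S" and e: "norm e = 1" and \<nu>: "0 \<le> \<nu>"
  defines "u \<equiv> slope (fps_expansion f 0)"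
  shows "Re (- e\<^sup>2 * fps_nth u 2) + \<nu>\<^sup>2 * Im (- e * fps_nth u 1) \<le> 1 + 8 * \<nu> ^ 3"
proof -
  let ?l = "\<lambda>t::real. Re (- e\<^sup>2 * fps_nth u 2) / t\<^sup>2 + \<nu>\<^sup>2 * Im (- e * fps_nth u 1) / t"
  have "(?l \<longlongrightarrow> ?l 1) (at_right 1)" by (intro tendsto_intros) auto
  moreover have "((\<lambda>t::real. t + 8 * \<nu> ^ 3) \<longlongrightarrow> 1 + 8 * \<nu> ^ 3) (at_right 1)" by (intro tendsto_intros)
  moreover have "\<forall>\<^sub>F t in at_right 1. ?l t \<le> t + 8 * \<nu> ^ 3"
    using class_S_bounds_aux(2)[OF f _ e \<nu>] by (auto simp: eventually_at_filter u_def)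
  ultimately have "?l 1 \<le> 1 + 8 * \<nu> ^ 3" by (intro tendsto_le[of "at_right 1" "\<lambda>t. t + 8 * \<nu> ^ 3" _ ?l]) auto
  then show ?thesis by simp
qed

text \<open>
  When \<open>S\<^sub>2 = 1\<close>, the quadratic bound leaves \<open>\<nu>\<^sup>2 Im (e S\<^sub>1) \<le> 8 \<nu>\<^sup>3\<close> for \<open>e = 1\<close> and \<open>e = -1\<close>.
\<close>
lemma class_S_extremal_real:
  assumes f: "f \<in> class_S" and u2: "fps_nth (slope (fps_expansion f 0)) 2 = -1"
  shows "Im (fps_nth (slope (fps_expansion f 0)) 1) = 0"
proof -
  define u where "u = fps_nth (slope (fps_expansion f 0)) 1"
  have le: "x \<le> 0" if "\<And>\<nu>. 0 \<le> \<nu> \<Longrightarrow> \<nu>\<^sup>2 * x \<le> 8 * \<nu> ^ 3" for x :: real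
  proof (rule ccontr)
    assume "\<not> x \<le> 0"
    \<comment> \<open>any \<open>\<nu> < x / 8\<close> contradicts the assumption\<close>
    then have "(x/16)\<^sup>2 * x \<le> 8 * (x/16) ^ 3" "x > 0" using that[of "x/16"] by auto
    then have "(x/16)\<^sup>2 * x \<le> (x/16)\<^sup>2 * (x / 2)" by (simp add: power2_eq_square power3_eq_cube)
    then show False using \<open>x > 0\<close> by (simp add: mult_le_cancel_left_pos)
  qed
  have "\<nu>\<^sup>2 * (- Im u) \<le> 8 * \<nu> ^ 3" "\<nu>\<^sup>2 * Im u \<le> 8 * \<nu> ^ 3" if "0 \<le> \<nu>" for \<nu>
    using class_S_quadratic_bound[OF f, of 1, OF _ that] class_S_quadratic_bound[OF f, of "-1", OF _ that] u2
    by (simp_all add: u_def)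
  then have "- Im u \<le> 0" "Im u \<le> 0" using le by blast+
  then show ?thesis by (simp add: u_def)
qed

lemma slope_nth_1_2:
  assumes A: "fps_nth A 0 = 0" "fps_nth A 1 = 1"
  shows "fps_nth (slope A) 1 = fps_nth A 2" "fps_nth (slope A) 2 = fps_nth A 3 - (fps_nth A 2)\<^sup>2"
proof -
  let ?\<Psi> = "fps_inv A"
  have e: "?\<Psi> * slope A = fps_X" using fps_inv_mult_slope[of A] A by simp
  have "fps_nth (?\<Psi> * slope A) 1 = 1" by (simp add: e)
  then have \<Psi>1: "fps_nth ?\<Psi> 1 = 1" using A by (simp add: fps_mult_nth_1)
  show s1: "fps_nth (slope A) 1 = fps_nth A 2"
    using \<Psi>1 by (simp add: slope_def fps_compose_nth numeral_2_eq_2)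
  have "fps_nth (?\<Psi> * slope A) 2 = 0" by (simp add: e)
  moreover have "fps_nth (?\<Psi> * slope A) 2 = fps_nth ?\<Psi> 1 * fps_nth (slope A) 1 + fps_nth ?\<Psi> 2 * fps_nth (slope A) 0"
    by (simp add: fps_mult_nth numeral_2_eq_2)
  ultimately have \<Psi>2: "fps_nth ?\<Psi> 2 = - fps_nth A 2" using A \<Psi>1 s1 by (simp add: add_eq_0_iff2)
  have "fps_nth (?\<Psi> ^ 2) 2 = 1" using \<Psi>1 by (simp add: power2_eq_square fps_mult_nth numeral_2_eq_2)
  then show "fps_nth (slope A) 2 = fps_nth A 3 - (fps_nth A 2)\<^sup>2"
    using \<Psi>2 by (simp add: slope_def fps_compose_nth numeral_2_eq_2 numeral_3_eq_3 power2_eq_square)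
qed

lemma class_S_a2_le_2:
  assumes "f \<in> class_S"
  shows "norm (fps_nth (fps_expansion f 0) 2) \<le> 2"
  using class_S_slope_bound[OF assms, of 1] slope_nth_1_2(1)[OF class_SD(6,7)[OF assms]] by simp

text \<open>
  In terms of reciprocals the transform is the translation \<open>1/g = 1/f - 1/w\<close>, so it changes only the
  constant term of the Laurent expansion of \<open>1/f\<close>.
\<close>
lemma class_S_omitted_transform:
  assumes f: "f \<in> class_S" and w: "w \<notin> f ` ball 0 1"
  defines "g \<equiv> (\<lambda>z. w * f z / (w - f z))"
  shows "g \<in> class_S"
    "fps_nth (fps_expansion g 0) 2 = fps_nth (fps_expansion f 0) 2 + 1 / w"
    "fps_nth (slope (fps_expansion g 0)) 2 = fps_nth (slope (fps_expansion f 0)) 2"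
proof -
  note F = class_SD[OF f]
  have "f 0 \<in> f ` ball 0 1" by auto
  then have w0: "w \<noteq> 0" using w F(3) by auto
  have nz: "w - f z \<noteq> 0" if "z \<in> ball 0 1" for z using w that by auto
  have hol: "g holomorphic_on ball 0 1"
    unfolding g_def using nz by (intro holomorphic_intros F) auto
  have inj: "inj_on g (ball 0 1)"
  proof (rule inj_onI)
    fix x y assume xy: "x \<in> ball 0 1" "y \<in> ball 0 1" "g x = g y"
    then have "w * f x * (w - f y) = w * f y * (w - f x)"
      using nz by (simp add: g_def frac_eq_eq)
    then have "f x = f y" using w0 by (simp add: algebra_simps)
    then show "x = y" using xy F(2) by (auto dest: inj_onD)
  qed
  define A where "A = fps_expansion f 0"
  define G where "G = fps_expansion g 0"
  have gexp: "g has_fps_expansion G"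
    unfolding G_def by (rule holomorphic_has_fps_expansion[OF hol]) simp
  have eq: "G * (fps_const w - A) = fps_const w * A"
  proof (rule fps_expansion_unique_complex)
    show "(\<lambda>z. g z * (w - f z)) has_fps_expansion (G * (fps_const w - A))"
      unfolding A_def by (intro fps_expansion_intros gexp F(5))
    have 1: "(\<lambda>z. w * f z) has_fps_expansion (fps_const w * A)"
      unfolding A_def by (intro fps_expansion_intros F(5))
    show "(\<lambda>z. g z * (w - f z)) has_fps_expansion (fps_const w * A)"
      by (rule has_fps_expansion_transform_ball[OF 1, of 1]) (use nz in \<open>auto simp: g_def\<close>)
  qed
  have A01: "fps_nth A 0 = 0" "fps_nth A 1 = 1" using F by (auto simp: A_def)
  have G0: "fps_nth G 0 = 0" by (simp add: G_def fps_nth_fps_expansion_0 g_def F)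
  have n: "fps_nth (G * (fps_const w - A)) k = w * fps_nth A k" for k by (simp add: eq)
  have G1: "fps_nth G 1 = 1" using n[of 1] A01 G0 w0 by (simp add: fps_mult_nth_1)
  have "fps_nth G 2 * w - 1 = w * fps_nth A 2"
    using n[of 2] A01 G0 G1 by (simp add: fps_mult_nth numeral_2_eq_2)
  then have G2: "fps_nth G 2 = fps_nth A 2 + 1 / w" using w0 by (simp add: field_simps)
  have "fps_nth G 3 * w - fps_nth G 2 - fps_nth A 2 = w * fps_nth A 3"
    using n[of 3] A01 G0 G1 by (simp add: fps_mult_nth numeral_3_eq_3 numeral_2_eq_2 algebra_simps)
  then have G3: "fps_nth G 3 = fps_nth A 3 + (fps_nth G 2 + fps_nth A 2) / w" using w0 by (simp add: field_simps)
  show g: "g \<in> class_S"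
    using hol inj G0 G1 unfolding class_S_def
    by (simp add: analytic_on_open G_def fps_nth_fps_expansion_0)
  show "fps_nth (fps_expansion g 0) 2 = fps_nth (fps_expansion f 0) 2 + 1 / w"
    using G2 by (simp add: G_def A_def)
  have "fps_nth (slope G) 2 = fps_nth (slope A) 2"
    unfolding slope_nth_1_2(2)[OF A01] slope_nth_1_2(2)[OF G0 G1] G3 G2
    by (simp add: power2_eq_square algebra_simps add_divide_distrib)
  then show "fps_nth (slope (fps_expansion g 0)) 2 = fps_nth (slope (fps_expansion f 0)) 2"
    by (simp add: G_def A_def)
qed

text \<open>
  Two functions of the class, \<open>f\<close> and its transform, have second coefficients that differ by \<open>1/w\<close>, and
  both have modulus at most \<open>2\<close>.
\<close>
theorem koebe_quarter:
  assumes f: "f \<in> class_S"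
  shows "ball 0 (1/4) \<subseteq> f ` ball 0 1"
proof
  fix w :: complex assume w: "w \<in> ball 0 (1/4)"
  show "w \<in> f ` ball 0 1"
  proof (rule ccontr)
    assume nw: "w \<notin> f ` ball 0 1"
    have "f 0 \<in> f ` ball 0 1" by auto
    then have w0: "w \<noteq> 0" using nw class_SD(3)[OF f] by auto
    have "norm (1 / w) \<le> norm (fps_nth (fps_expansion f 0) 2 + 1 / w) + norm (fps_nth (fps_expansion f 0) 2)"
      using norm_triangle_ineq4[of "fps_nth (fps_expansion f 0) 2 + 1 / w" "fps_nth (fps_expansion f 0) 2"] by simp
    also have "\<dots> \<le> 2 + 2"
      using class_S_a2_le_2[OF class_S_omitted_transform(1)[OF f nw]] class_S_a2_le_2[OF f]
        class_S_omitted_transform(2)[OF f nw] by (intro add_mono) auto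
    finally show False using w w0 by (simp add: norm_divide field_simps)
  qed
qed

section \<open>Logarithmic inverse coefficients\<close>

lemma slope_eqI:
  assumes "fps_nth A 0 = 0" "fps_nth A 1 \<noteq> 0" "fps_inv A * U = fps_X"
  shows "slope A = U"
proof -
  have "fps_inv A * slope A = fps_inv A * U" using fps_inv_mult_slope[OF assms(1,2)] assms(3) by simp
  moreover have "fps_inv A \<noteq> 0" using assms(3) by auto
  ultimately show ?thesis by simp
qed

lemma class_S_inverse:
  assumes f: "f \<in> class_S"
  shows "inverse_fun f holomorphic_on f ` ball 0 1" "inverse_fun f 0 = 0"
    "\<And>w. w \<in> f ` ball 0 1 \<Longrightarrow> f (inverse_fun f w) = w"
    "inverse_fun f has_fps_expansion fps_inv (fps_expansion f 0)"
proof -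
  note F = class_SD[OF f]
  obtain g where g: "g holomorphic_on f ` ball 0 1" "\<And>z. z \<in> ball 0 1 \<Longrightarrow> g (f z) = z"
    using holomorphic_has_inverse[OF F(1) open_ball F(2)] by metis
  have eq: "inverse_fun f (f z) = z" if "z \<in> ball 0 1" for z
    using inv_into_f_f[OF F(2) that] by (simp add: inverse_fun_def)
  show hol: "inverse_fun f holomorphic_on f ` ball 0 1"
    by (rule holomorphic_transform[OF g(1)]) (use g(2) eq in auto)
  show 0: "inverse_fun f 0 = 0" using eq[of 0] F(3) by simp
  show inv: "\<And>w. w \<in> f ` ball 0 1 \<Longrightarrow> f (inverse_fun f w) = w" using eq by auto
  have op: "open (f ` ball 0 1)" using open_mapping_thm3[OF F(1) open_ball F(2)] .
  have mem: "0 \<in> f ` ball 0 1" using F(3) by (auto intro: image_eqI[of 0 f 0])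
  have exp: "inverse_fun f has_fps_expansion fps_expansion (inverse_fun f) 0"
    using hol op mem by (intro analytic_at_imp_has_fps_expansion_0 holomorphic_on_imp_analytic_at) auto
  define G where "G = fps_expansion (inverse_fun f) 0"
  define A where "A = fps_expansion f 0"
  have G0: "fps_nth G 0 = 0" by (simp add: G_def fps_nth_fps_expansion_0 0)
  have "A oo G = fps_X"
  proof (rule fps_expansion_unique_complex)
    show "(f \<circ> inverse_fun f) has_fps_expansion (A oo G)"
      unfolding A_def by (rule has_fps_expansion_compose[OF F(5)]) (use exp G0 in \<open>auto simp: G_def\<close>)
    show "(f \<circ> inverse_fun f) has_fps_expansion fps_X"
    proof (rule has_fps_expansion_cong[THEN iffD1, OF _ refl has_fps_expansion_fps_X])
      show "\<forall>\<^sub>F x in nhds 0. x = (f \<circ> inverse_fun f) x"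
        by (rule eventually_mono[OF eventually_nhds_in_open[OF op mem]]) (use inv in auto)
    qed
  qed
  then have "fps_inv A oo (A oo G) = fps_inv A" by simp
  moreover have "fps_inv A oo (A oo G) = (fps_inv A oo A) oo G"
    by (rule fps_compose_assoc) (use G0 F(6) in \<open>auto simp: A_def\<close>)
  moreover have "fps_inv A oo A = fps_X" using F(6,7) by (intro fps_inv) (auto simp: A_def)
  ultimately have "G = fps_inv A" using G0 by simp
  then show "inverse_fun f has_fps_expansion fps_inv (fps_expansion f 0)"
    using exp by (simp add: G_def A_def)
qed

text \<open>
  If \<open>F = z h\<close>, then \<open>1/h\<close> has the expansion \<open>slope\<close>, so \<open>L = log h = - log slope\<close>.
\<close>
lemma class_S_log_inverse_branch:
  assumes f: "f \<in> class_S"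
  obtains L where "is_log_inverse_branch f L"
    "fps_deriv (fps_expansion L 0) = - fps_deriv (slope (fps_expansion f 0)) * inverse (slope (fps_expansion f 0))"
proof -
  note F = class_SD[OF f] and I = class_S_inverse[OF f]
  have hol: "inverse_fun f holomorphic_on ball 0 (1/4)"
    using I(1) koebe_quarter[OF f] by (rule holomorphic_on_subset)
  obtain h where h: "h holomorphic_on ball 0 (1/4)" "\<And>z. norm z < 1/4 \<Longrightarrow> inverse_fun f z = z * h z"
    using Schwarz3[OF hol I(2)] by metis
  define A where "A = fps_expansion f 0"
  define u where "u = slope A"
  have A01: "fps_nth A 0 = 0" "fps_nth A 1 = 1" using F by (auto simp: A_def)
  have hexp: "h has_fps_expansion fps_expansion h 0"
    by (rule holomorphic_has_fps_expansion[OF h(1)]) simp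
  define H where "H = fps_expansion h 0"
  have XH: "fps_inv A = fps_X * H"
  proof (rule fps_expansion_unique_complex)
    show "inverse_fun f has_fps_expansion fps_inv A" using I(4) by (simp add: A_def)
    have 1: "(\<lambda>z. z * h z) has_fps_expansion (fps_X * H)"
      unfolding H_def by (intro fps_expansion_intros hexp)
    show "inverse_fun f has_fps_expansion (fps_X * H)"
      by (rule has_fps_expansion_transform_ball[OF 1, of "1/4"]) (use h(2) in auto)
  qed
  have "fps_X * (H * u) = fps_X * 1"
    using fps_inv_mult_slope[of A] A01 XH by (simp add: u_def mult.assoc)
  then have Hu: "H * u = 1" by (simp only: mult_cancel_left fps_X_neq_zero simp_thms)
  have h0: "h 0 = 1"
  proof -
    have "fps_nth (H * u) 0 = 1" by (simp add: Hu)
    then show ?thesis using A01 by (simp add: u_def H_def fps_nth_fps_expansion_0)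
  qed
  have hnz: "h z \<noteq> 0" if z: "z \<in> ball 0 (1/4)" for z
  proof (cases "z = 0")
    case False
    have "f (inverse_fun f z) = z" using I(3) koebe_quarter[OF f] z by blast
    then have "inverse_fun f z \<noteq> 0" using F(3) False by auto
    then show ?thesis using h(2)[of z] z by auto
  qed (simp add: h0)
  obtain L0 where L0: "L0 holomorphic_on ball 0 (1/4)" "\<And>z. z \<in> ball 0 (1/4) \<Longrightarrow> h z = exp (L0 z)"
    using contractible_imp_holomorphic_log[OF h(1) convex_imp_contractible[OF convex_ball] hnz] by blast
  define L where "L = (\<lambda>z. L0 z - L0 0)"
  have Lhol: "L holomorphic_on ball 0 (1/4)" unfolding L_def by (intro holomorphic_intros L0)
  have expL: "exp (L z) = h z" if "z \<in> ball 0 (1/4)" for z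
    using L0(2)[of 0] L0(2)[OF that] h0 by (simp add: L_def exp_diff)
  have br: "is_log_inverse_branch f L"
    unfolding is_log_inverse_branch_def using Lhol expL h(2) by (auto simp: L_def)
  define E where "E = fps_expansion L 0"
  have Eexp: "L has_fps_expansion E" unfolding E_def by (rule holomorphic_has_fps_expansion[OF Lhol]) simp
  have dH: "fps_deriv H = fps_deriv E * H"
  proof (rule fps_expansion_unique_complex)
    show "deriv h has_fps_expansion fps_deriv H"
      unfolding H_def by (intro has_fps_expansion_deriv hexp)
    have 1: "(\<lambda>z. deriv L z * h z) has_fps_expansion (fps_deriv E * H)"
      unfolding H_def by (intro fps_expansion_intros hexp Eexp)
    show "deriv h has_fps_expansion (fps_deriv E * H)"
    proof (rule has_fps_expansion_transform_ball[OF 1, of "1/4"])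
      show "deriv h z = deriv L z * h z" if z: "z \<in> ball 0 (1/4)" for z
      proof -
        have "(L has_field_derivative deriv L z) (at z)"
          using Lhol z by (intro holomorphic_derivI[of _ "ball 0 (1/4)"]) auto
        then have "((\<lambda>z. exp (L z)) has_field_derivative deriv L z * exp (L z)) (at z)"
          by (auto intro!: derivative_eq_intros)
        then have "(h has_field_derivative deriv L z * exp (L z)) (at z)"
          by (rule has_field_derivative_transform_within_open[OF _ open_ball z]) (use expL in auto)
        then show ?thesis using expL[OF z] by (simp add: DERIV_imp_deriv)
      qed
    qed simp
  qed
  have "fps_deriv H * u + H * fps_deriv u = 0"
    using Hu by (metis fps_deriv_mult fps_deriv_1 add.commute)
  then have "fps_deriv E * (H * u) + H * fps_deriv u = 0" by (simp add: dH mult.assoc)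
  then have "fps_deriv E = - fps_deriv u * H" by (simp add: Hu add_eq_0_iff2 mult.commute)
  moreover have "inverse u = H" using Hu by (intro fps_inverse_unique) (simp add: mult.commute)
  ultimately show ?thesis using that[OF br] by (simp add: E_def u_def A_def)
qed

lemma class_S_log_inverse_coeff:
  assumes f: "f \<in> class_S" and n: "n \<ge> 1"
  defines "S \<equiv> 1 - slope (fps_expansion f 0)"
  shows "log_inverse_coeff f n = fps_nth (fps_deriv S * inverse (1 - S)) (n - 1) / (2 * of_nat n)"
proof -
  obtain L where L: "is_log_inverse_branch f L"
    "fps_deriv (fps_expansion L 0) = - fps_deriv (slope (fps_expansion f 0)) * inverse (slope (fps_expansion f 0))"
    using class_S_log_inverse_branch[OF f] by blast
  define M where "M = (SOME L. is_log_inverse_branch f L)"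
  have M: "is_log_inverse_branch f M" unfolding M_def by (rule someI[of _ L]) (rule L)
  have "(deriv ^^ n) M 0 = (deriv ^^ n) L 0"
    using M L(1) log_inverse_branch_unique[OF M L(1)]
    by (intro higher_deriv_transform_within_open[of _ "ball 0 (1/4)"]) (auto simp: is_log_inverse_branch_def)
  then have "log_inverse_coeff f n = fps_nth (fps_expansion L 0) n / 2"
    by (simp add: log_inverse_coeff_def M_def fps_nth_fps_expansion_0)
  moreover have "fps_nth (fps_deriv (fps_expansion L 0)) (n - 1) = of_nat n * fps_nth (fps_expansion L 0) n"
    using n by simp
  moreover have "fps_deriv (fps_expansion L 0) = fps_deriv S * inverse (1 - S)"
    by (simp add: L(2) S_def)
  ultimately show ?thesis using n by (simp add: field_simps)
qed

text \<open>
  Besides the monomial \<open>(S\<^sub>1)\<^sup>n\<close>, which comes from the top power in the geometric series, the coefficient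
  is a polynomial with nonnegative coefficients in those of \<open>S\<close>. Only this remaining part is
  replaced by its majorant.
\<close>
lemma majorized_log_coeff:
  fixes S :: "complex fps" and T :: "real fps"
  assumes S: "fps_nth S 0 = 0" and T: "fps_nth T 0 = 0"
    and maj: "\<And>k. 1 \<le> k \<Longrightarrow> norm (fps_nth S k) \<le> fps_nth T k" and n: "n \<ge> 1"
  shows "norm (fps_nth (fps_deriv S * inverse (1 - S)) (n - 1))
    \<le> fps_nth (fps_deriv T * inverse (1 - T)) (n - 1) - (fps_nth T 1 ^ n - norm (fps_nth S 1) ^ n)"
proof -
  define m where "m = n - 1"
  have mST: "majorized 1 m S T"
    unfolding majorized_def using maj S T by (metis Suc_leI mult_cancel_left1 neq0_conv norm_zero order_refl power_one One_nat_def)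
  have dST: "majorized 1 m (fps_deriv S) (fps_deriv T)"
    unfolding majorized_def
  proof (intro allI impI)
    fix k
    have "norm (fps_nth (fps_deriv S) k) = real (Suc k) * norm (fps_nth S (Suc k))"
      by (simp add: norm_mult del: of_nat_Suc)
    also have "\<dots> \<le> real (Suc k) * fps_nth T (Suc k)" using maj by (intro mult_left_mono) auto
    finally show "norm (fps_nth (fps_deriv S) k) \<le> fps_nth (fps_deriv T) k * 1 ^ k" by (simp del: of_nat_Suc)
  qed
  have split: "fps_nth (fps_deriv U * inverse (1 - U)) m
      = fps_nth (fps_deriv U * ((Abs_fps (\<lambda>_. 1) - fps_X ^ m) oo U)) m + fps_nth U 1 ^ n"
    if "fps_nth U 0 = 0" for U :: "'a :: {field, comm_ring_1} fps"
  proof -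
    have "inverse (1 - U) = ((Abs_fps (\<lambda>_. 1) - fps_X ^ m) oo U) + U ^ m"
      using that by (simp add: inverse_one_minus_fps fps_compose_sub_distrib fps_compose_power [symmetric])
    moreover have "fps_nth (fps_deriv U * U ^ m) m = fps_nth U 1 ^ n"
    proof -
      have "fps_nth (fps_deriv U * U ^ m) m = (\<Sum>i=0..m. fps_nth (fps_deriv U) i * fps_nth (U ^ m) (m - i))"
        by (simp add: fps_mult_nth)
      also have "\<dots> = (\<Sum>i\<in>{0}. fps_nth (fps_deriv U) i * fps_nth (U ^ m) (m - i))"
        using startsby_zero_power_prefix[OF that, of m] by (intro sum.mono_neutral_right) auto
      also have "\<dots> = fps_nth U 1 * fps_nth U 1 ^ m"
        using startsby_zero_power_nth_same[OF that, of m] by simp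
      also have "\<dots> = fps_nth U 1 ^ n" using n by (simp add: m_def power_eq_if)
      finally show ?thesis .
    qed
    ultimately show ?thesis by (simp add: ring_distribs)
  qed
  have "majorized 1 m (fps_deriv S * ((Abs_fps (\<lambda>_. 1) - fps_X ^ m) oo S))
     (fps_deriv T * ((Abs_fps (\<lambda>_. 1) - fps_X ^ m) oo T))"
    by (intro majorized_mult dST majorized_compose mST) (auto simp: majorized_def)
  then have "norm (fps_nth (fps_deriv S * ((Abs_fps (\<lambda>_. 1) - fps_X ^ m) oo S)) m)
    \<le> fps_nth (fps_deriv T * ((Abs_fps (\<lambda>_. 1) - fps_X ^ m) oo T)) m"
    by (simp add: majorized_def)
  moreover have "norm (fps_nth (fps_deriv S * inverse (1 - S)) m)
    \<le> norm (fps_nth (fps_deriv S * ((Abs_fps (\<lambda>_. 1) - fps_X ^ m) oo S)) m) + norm (fps_nth S 1) ^ n"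
    unfolding split[OF S] by (metis norm_power norm_triangle_ineq)
  ultimately show ?thesis unfolding m_def [symmetric] split[OF T] by linarith
qed

theorem class_S_log_inverse_coeff_bound:
  assumes f: "f \<in> class_S" and n: "n \<ge> 1"
  shows "2 * real n * norm (log_inverse_coeff f n)
    \<le> real ((2 * n) choose n) - (2 ^ n - norm (fps_nth (fps_expansion f 0) 2) ^ n)"
proof -
  note F = class_SD[OF f]
  define S where "S = 1 - slope (fps_expansion f 0)"
  have S0: "fps_nth S 0 = 0" using F by (simp add: S_def)
  have Sk: "norm (fps_nth S k) \<le> fps_nth maj_slope k" if "1 \<le> k" for k
    using class_S_slope_bound[OF f that] that by (simp add: S_def)
  have S1: "norm (fps_nth S 1) = norm (fps_nth (fps_expansion f 0) 2)"
    using slope_nth_1_2(1)[OF F(6,7)] by (simp add: S_def)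
  have "norm (fps_nth (fps_deriv S * inverse (1 - S)) (n - 1))
    \<le> real ((2 * n) choose n) - (2 ^ n - norm (fps_nth (fps_expansion f 0) 2) ^ n)"
    using majorized_log_coeff[OF S0 _ Sk n] unfolding maj_log_coeff[OF n] S1 by simp
  moreover have "2 * real n * norm (log_inverse_coeff f n) = norm (fps_nth (fps_deriv S * inverse (1 - S)) (n - 1))"
    using n unfolding class_S_log_inverse_coeff[OF f n] S_def by (simp add: norm_divide norm_mult)
  ultimately show ?thesis by simp
qed

text \<open>
  For a rotation by \<open>\<epsilon>\<close> the inverse satisfies \<open>F = w (1 - \<epsilon> F)\<^sup>2\<close>, so \<open>- \<epsilon> F\<close> is a series of the kind
  treated in \<open>koebe_series_log_coeff\<close>.
\<close>
lemma koebe_rotation_log_inverse_coeff: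
  assumes f: "f \<in> class_S" and rot: "is_rotation_of f koebe" and n: "n \<ge> 1"
  shows "2 * real n * norm (log_inverse_coeff f n) = real ((2 * n) choose n)"
proof -
  note F = class_SD[OF f]
  obtain \<theta> where \<theta>: "\<And>z. z \<in> ball 0 1 \<Longrightarrow> f z = exp (- \<i> * of_real \<theta>) * koebe (exp (\<i> * of_real \<theta>) * z)"
    using rot unfolding is_rotation_of_def by auto
  define \<epsilon> where "\<epsilon> = exp (\<i> * of_real \<theta>)"
  have n\<epsilon>: "norm \<epsilon> = 1" by (simp add: \<epsilon>_def)
  have nz: "1 - \<epsilon> * z \<noteq> 0" if "z \<in> ball 0 1" for z
  proof
    assume "1 - \<epsilon> * z = 0"
    then have "norm (\<epsilon> * z) = 1" by (metis norm_one right_minus_eq)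
    then show False using that n\<epsilon> by (simp add: norm_mult)
  qed
  have fz: "f z * (1 - \<epsilon> * z)\<^sup>2 = z" if "z \<in> ball 0 1" for z
    using \<theta>[OF that] nz[OF that] by (simp add: koebe_def \<epsilon>_def exp_minus field_simps)
  define A where "A = fps_expansion f 0"
  have A01: "fps_nth A 0 = 0" "fps_nth A 1 = 1" using F by (auto simp: A_def)
  have "A * (1 - fps_const \<epsilon> * fps_X)\<^sup>2 = fps_X"
  proof (rule fps_expansion_unique_complex)
    have 1: "(\<lambda>z. f z * (1 - \<epsilon> * z)\<^sup>2) has_fps_expansion (A * (1 - fps_const \<epsilon> * fps_X)\<^sup>2)"
      unfolding A_def by (intro fps_expansion_intros F(5))
    then show "(\<lambda>z. f z * (1 - \<epsilon> * z)\<^sup>2) has_fps_expansion (A * (1 - fps_const \<epsilon> * fps_X)\<^sup>2)" .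
    show "(\<lambda>z. f z * (1 - \<epsilon> * z)\<^sup>2) has_fps_expansion fps_X"
      by (rule has_fps_expansion_transform_ball[OF has_fps_expansion_fps_X, of 1]) (use fz in auto)
  qed
  then have "(A * (1 - fps_const \<epsilon> * fps_X)\<^sup>2) oo fps_inv A = fps_X oo fps_inv A" by simp
  then have \<Psi>: "fps_X * (1 - fps_const \<epsilon> * fps_inv A)\<^sup>2 = fps_inv A"
    using fps_inv_right[of A] A01
    by (simp add: fps_compose_mult_distrib fps_compose_power [symmetric] fps_compose_sub_distrib)
  define c where "c = - \<epsilon>"
  define T where "T = fps_const c * fps_inv A"
  have "T = fps_const c * (fps_X * (1 - fps_const \<epsilon> * fps_inv A)\<^sup>2)" by (simp add: T_def \<Psi>)
  also have "1 - fps_const \<epsilon> * fps_inv A = 1 + T" by (simp add: T_def c_def fps_const_neg [symmetric] del: fps_const_neg)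
  finally have T: "T = fps_const c * fps_X * (1 + T)\<^sup>2" by (simp add: mult.assoc)
  have T0: "fps_nth T 0 = 0" by (simp add: T_def)
  define S where "S = fps_const c * fps_X * (2 + T)"
  have c0: "c \<noteq> 0" using n\<epsilon> by (auto simp: c_def)
  have "(1 - S) * T = fps_const c * fps_X" unfolding S_def by (rule koebe_series_relation[OF T])
  then have "fps_const c * (fps_inv A * (1 - S)) = fps_const c * fps_X" by (simp add: T_def mult_ac)
  then have "fps_inv A * (1 - S) = fps_X" using c0 by (simp only: mult_cancel_left fps_const_eq_0_iff simp_thms)
  then have "slope A = 1 - S" using A01 by (intro slope_eqI) auto
  then have "log_inverse_coeff f n = fps_nth (fps_deriv S * inverse (1 - S)) (n - 1) / (2 * of_nat n)"
    using class_S_log_inverse_coeff[OF f n] by (simp add: A_def)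
  also have "fps_nth (fps_deriv S * inverse (1 - S)) (n - 1) = c ^ n * of_nat ((2 * n) choose n)"
    unfolding S_def by (rule koebe_series_log_coeff[OF T0 T n])
  finally show ?thesis using n n\<epsilon> by (simp add: norm_divide norm_mult norm_power c_def)
qed

section \<open>Functions with extremal second coefficient\<close>

text \<open>
  For real \<open>z\<close> this is the equality case of \<open>\<bar>z\<bar> + 1 / \<bar>z\<bar> \<ge> 2\<close>. For the other \<open>z\<close> the imaginary part of
  \<open>z + 1/z\<close> vanishes only on the unit circle.
\<close>
lemma reciprocal_koebe_odd_real_imp_norm_1:
  fixes z :: complex
  assumes z: "z \<noteq> 0" and im: "Im (z + 1 / z) = 0" and le: "norm (z + 1 / z) \<le> 2"
  shows "norm z = 1"
proof (cases "Im z = 0")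
  case True
  then have zr: "z = of_real (Re z)" by (simp add: complex_eq_iff)
  define x where "x = Re z"
  have x0: "x \<noteq> 0" using z zr by (auto simp: x_def)
  have "z + 1 / z = of_real (x + 1 / x)" by (subst (1 2) zr) (simp add: x_def)
  then have "\<bar>x + 1 / x\<bar> \<le> 2" using le by (simp only: norm_of_real)
  then have "\<bar>x * (x + 1 / x)\<bar> \<le> \<bar>x\<bar> * 2" unfolding abs_mult by (intro mult_left_mono) auto
  moreover have "x * (x + 1 / x) = \<bar>x\<bar>\<^sup>2 + 1" using x0 by (simp add: distrib_left power2_eq_square)
  ultimately have "(\<bar>x\<bar> - 1)\<^sup>2 \<le> 0" by (simp add: power2_diff)
  then have "\<bar>x\<bar> = 1" by simp
  then show ?thesis by (subst zr) (simp add: x_def)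
next
  case False
  have "Im (z + 1 / z) = Im z * (1 - 1 / (norm z)\<^sup>2)"
    by (simp add: Im_divide cmod_power2 algebra_simps)
  then have "1 - 1 / (norm z)\<^sup>2 = 0" using im False by simp
  then have "(norm z)\<^sup>2 = 1" using z by (simp add: field_simps)
  then show ?thesis by (simp add: power2_eq_1_iff) (smt (verit) norm_ge_zero)
qed

text \<open>
  Take \<open>g(z) = z k(z\<^sup>2)\<close>, where \<open>k\<close> is the square root of \<open>f(z)/z\<close> with \<open>k(0) = 1\<close>. It is odd, which is
  what makes it injective: \<open>g(x) = g(y)\<close> gives \<open>x = y\<close> or \<open>x = - y\<close>, and in the second case both
  points are \<open>0\<close>.
\<close>
lemma class_S_sqrt_transform:
  assumes f: "f \<in> class_S"
  obtains g where "g \<in> class_S" "\<And>z. z \<in> ball 0 1 \<Longrightarrow> (g z)\<^sup>2 = f (z\<^sup>2)"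
    "fps_nth (fps_expansion g 0) 2 = 0" "fps_nth (fps_expansion g 0) 3 = fps_nth (fps_expansion f 0) 2 / 2"
proof -
  note F = class_SD[OF f]
  obtain h where h: "h holomorphic_on ball 0 1" "\<And>z. norm z < 1 \<Longrightarrow> f z = z * h z" "deriv f 0 = h 0"
    using Schwarz3[OF F(1,3)] by metis
  have hnz: "h z \<noteq> 0" if z: "z \<in> ball 0 1" for z
  proof (cases "z = 0")
    case False
    then have "f z \<noteq> f 0" using F(2) z by (auto dest: inj_onD)
    then show ?thesis using h(2)[of z] z F(3) by auto
  qed (use h(3) F(4) in simp)
  obtain k0 where k0: "k0 holomorphic_on ball 0 1" "\<And>z. z \<in> ball 0 1 \<Longrightarrow> h z = (k0 z)\<^sup>2"
    using contractible_imp_holomorphic_sqrt[OF h(1) convex_imp_contractible[OF convex_ball] hnz] by blast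
  define k where "k = (\<lambda>z. k0 z / k0 0)"
  have k00: "(k0 0)\<^sup>2 = 1" using k0(2)[of 0] h(3) F(4) by simp
  have k: "k holomorphic_on ball 0 1" "\<And>z. z \<in> ball 0 1 \<Longrightarrow> h z = (k z)\<^sup>2" "k 0 = 1"
    using k0 k00 by (auto simp: k_def power_divide intro!: holomorphic_intros)
  define g where "g = (\<lambda>z. z * k (z\<^sup>2))"
  have sq: "z\<^sup>2 \<in> ball 0 1" if "z \<in> ball 0 1" for z :: complex
    using that by (simp add: norm_power power_less_one_iff)
  have g2: "(g z)\<^sup>2 = f (z\<^sup>2)" if "z \<in> ball 0 1" for z
    using k(2)[OF sq[OF that]] h(2)[of "z\<^sup>2"] sq[OF that] by (simp add: g_def power_mult_distrib)
  have ghol: "g holomorphic_on ball 0 1"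
  proof -
    have "(k \<circ> (\<lambda>z. z\<^sup>2)) holomorphic_on ball 0 1"
    proof (rule holomorphic_on_compose_gen[OF _ k(1)])
      show "(\<lambda>z::complex. z\<^sup>2) holomorphic_on ball 0 1" by (intro holomorphic_intros)
    qed (use sq in auto)
    then show ?thesis unfolding g_def o_def by (intro holomorphic_intros)
  qed
  have ginj: "inj_on g (ball 0 1)"
  proof (rule inj_onI)
    fix x y assume xy: "x \<in> ball 0 1" "y \<in> ball 0 1" "g x = g y"
    then have "f (x\<^sup>2) = f (y\<^sup>2)" using g2 by metis
    then have "x\<^sup>2 = y\<^sup>2" using F(2) sq xy by (meson inj_onD)
    then have "x = y \<or> x = - y" by (simp add: power2_eq_iff)
    then show "x = y"
    proof
      assume x: "x = - y"
      then have "y * k (y\<^sup>2) = 0" using xy(3) by (simp add: g_def)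
      moreover have "k (y\<^sup>2) \<noteq> 0" using k(2)[OF sq[OF xy(2)]] hnz[OF sq[OF xy(2)]] by auto
      ultimately show ?thesis using x by simp
    qed
  qed
  define K where "K = fps_expansion k 0"
  define A where "A = fps_expansion f 0"
  have kexp: "k has_fps_expansion K" unfolding K_def by (rule holomorphic_has_fps_expansion[OF k(1)]) simp
  have K0: "fps_nth K 0 = 1" by (simp add: K_def fps_nth_fps_expansion_0 k)
  have "A = fps_X * K\<^sup>2"
  proof (rule fps_expansion_unique_complex)
    show "f has_fps_expansion A" using F(5) by (simp add: A_def)
    have "(\<lambda>z. z * (k z)\<^sup>2) has_fps_expansion (fps_X * K\<^sup>2)"
      by (intro fps_expansion_intros kexp)
    then show "f has_fps_expansion (fps_X * K\<^sup>2)"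
      by (rule has_fps_expansion_transform_ball[of _ _ 1]) (use h(2) k(2) in auto)
  qed
  then have "fps_nth A 2 = fps_nth (K\<^sup>2) 1" by (simp add: numeral_2_eq_2)
  also have "\<dots> = 2 * fps_nth K 1" using K0 by (simp add: power2_eq_square fps_mult_nth_1)
  finally have K1: "fps_nth K 1 = fps_nth A 2 / 2" by simp
  define G where "G = fps_expansion g 0"
  have G: "G = fps_X * (K oo fps_X\<^sup>2)"
  proof (rule fps_expansion_unique_complex)
    show "g has_fps_expansion G" unfolding G_def by (rule holomorphic_has_fps_expansion[OF ghol]) simp
    have "(k \<circ> (\<lambda>z. z\<^sup>2)) has_fps_expansion (K oo fps_X\<^sup>2)"
      by (intro has_fps_expansion_compose kexp fps_expansion_intros) simp
    then have "(\<lambda>z. z * (k \<circ> (\<lambda>z. z\<^sup>2)) z) has_fps_expansion (fps_X * (K oo fps_X\<^sup>2))"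
      by (intro has_fps_expansion_mult has_fps_expansion_fps_X)
    then show "g has_fps_expansion (fps_X * (K oo fps_X\<^sup>2))" by (simp add: g_def o_def)
  qed
  have G0: "fps_nth G 0 = 0" by (simp add: G)
  have G1: "fps_nth G 1 = 1" by (simp add: G K0)
  have G2: "fps_nth G 2 = 0"
    by (simp add: G numeral_2_eq_2 fps_compose_nth power2_eq_square fps_mult_nth_1)
  have G3: "fps_nth G 3 = fps_nth K 1"
  proof -
    have "fps_nth ((fps_X\<^sup>2 :: complex fps) ^ 2) 2 = 0"
      by (simp add: fps_X_power_nth flip: power_mult)
    moreover have "fps_nth G 3 = fps_nth (K oo fps_X\<^sup>2) 2" by (simp add: G numeral_3_eq_3 numeral_2_eq_2)
    moreover have "fps_nth (K oo fps_X\<^sup>2) 2 = fps_nth K 1 * fps_nth (fps_X\<^sup>2) 2 + fps_nth K 2 * fps_nth ((fps_X\<^sup>2) ^ 2) 2"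
      by (simp add: fps_compose_nth numeral_2_eq_2)
    moreover have "fps_nth (fps_X\<^sup>2) 2 = (1 :: complex)" by (simp add: fps_X_power_nth)
    ultimately show ?thesis by simp
  qed
  have "g \<in> class_S"
    using ghol ginj G0 G1 unfolding class_S_def by (simp add: analytic_on_open G_def fps_nth_fps_expansion_0)
  then show ?thesis using that[of g] g2 G2 G3 K1 by (simp add: G_def A_def)
qed

text \<open>
  The square-root transform \<open>g\<close> has \<open>S\<^sub>1 = 0\<close> and \<open>S\<^sub>2 = 1\<close>. Sending an omitted value \<open>w\<close> of \<open>g\<close> to infinity
  preserves \<open>S\<^sub>2 = 1\<close> and turns \<open>S\<^sub>1\<close> into \<open>-1/w\<close>, which therefore is real. Hence \<open>g\<close> omits no value of
  \<open>p(z) = z / (1 + z\<^sup>2)\<close>, and Schwarz's lemma applies to \<open>g\<inverse> \<circ> p\<close>.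
\<close>
lemma class_S_a2_eq_minus_2:
  assumes f: "f \<in> class_S" and a2: "fps_nth (fps_expansion f 0) 2 = -2" and \<zeta>: "\<zeta> \<in> ball 0 1"
  shows "f \<zeta> = \<zeta> / (1 + \<zeta>)\<^sup>2"
proof -
  obtain g where g: "g \<in> class_S" and g2: "\<And>z. z \<in> ball 0 1 \<Longrightarrow> (g z)\<^sup>2 = f (z\<^sup>2)"
    and gc2: "fps_nth (fps_expansion g 0) 2 = 0" "fps_nth (fps_expansion g 0) 3 = fps_nth (fps_expansion f 0) 2 / 2"
    using class_S_sqrt_transform[OF f] by blast
  then have gc: "fps_nth (fps_expansion g 0) 2 = 0" "fps_nth (fps_expansion g 0) 3 = -1" using a2 by simp_all
  note G = class_SD[OF g]
  have u2: "fps_nth (slope (fps_expansion g 0)) 2 = -1"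
    using slope_nth_1_2(2)[OF G(6,7)] gc by simp
  have omit: "Im (1 / w) = 0 \<and> norm (1 / w) \<le> 2" if w: "w \<notin> g ` ball 0 1" for w
  proof -
    note T = class_S_omitted_transform[OF g w]
    have "fps_nth (slope (fps_expansion (\<lambda>z. w * g z / (w - g z)) 0)) 1 = 1 / w"
      using slope_nth_1_2(1)[OF class_SD(6,7)[OF T(1)]] T(2) gc(1) by simp
    moreover have "Im (fps_nth (slope (fps_expansion (\<lambda>z. w * g z / (w - g z)) 0)) 1) = 0"
      using T(3) u2 by (intro class_S_extremal_real[OF T(1)]) simp
    moreover have "norm (fps_nth (fps_expansion (\<lambda>z. w * g z / (w - g z)) 0) 2) \<le> 2"
      by (rule class_S_a2_le_2[OF T(1)])
    ultimately show ?thesis using T(2) gc(1) by simp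
  qed
  define p where "p = (\<lambda>z::complex. z / (1 + z\<^sup>2))"
  have nz: "1 + z\<^sup>2 \<noteq> 0" if "z \<in> ball 0 1" for z :: complex
  proof
    assume "1 + z\<^sup>2 = 0"
    then have "z\<^sup>2 = - 1" by (simp add: add_eq_0_iff)
    then have "norm (z\<^sup>2) = 1" by simp
    then have "(norm z)\<^sup>2 = 1" by (simp add: norm_power)
    moreover have "(norm z)\<^sup>2 < 1" using that by (simp add: power_less_one_iff)
    ultimately show False by simp
  qed
  have pin: "p z \<in> g ` ball 0 1" if z: "z \<in> ball 0 1" for z
  proof (cases "z = 0")
    case True then show ?thesis using G(3) by (auto simp: p_def intro: image_eqI[of 0 g 0])
  next
    case False
    show ?thesis
    proof (rule ccontr)
      assume "p z \<notin> g ` ball 0 1"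
      moreover have "1 / p z = z + 1 / z" using False nz[OF z] by (simp add: p_def field_simps power2_eq_square)
      ultimately have "norm z = 1"
        using omit[of "p z"] False by (intro reciprocal_koebe_odd_real_imp_norm_1) auto
      then show False using z by simp
    qed
  qed
  have phol: "p holomorphic_on ball 0 1" unfolding p_def using nz by (intro holomorphic_intros) auto
  have pd: "(p has_field_derivative 1) (at 0)"
    unfolding p_def by (auto intro!: derivative_eq_intros)
  obtain k where k: "k holomorphic_on g ` ball 0 1" "\<And>z. z \<in> ball 0 1 \<Longrightarrow> deriv g z * deriv k (g z) = 1"
    "\<And>z. z \<in> ball 0 1 \<Longrightarrow> k (g z) = z"
    using holomorphic_has_inverse[OF G(1) open_ball G(2)] by metis
  have op: "open (g ` ball 0 1)" using open_mapping_thm3[OF G(1) open_ball G(2)] .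
  define \<omega> where "\<omega> = k \<circ> p"
  have \<omega>: "\<omega> holomorphic_on ball 0 1" unfolding \<omega>_def
    using pin by (intro holomorphic_on_compose_gen[OF phol k(1)]) auto
  have \<omega>B: "\<omega> z \<in> ball 0 1" "g (\<omega> z) = p z" if "z \<in> ball 0 1" for z
    using pin[OF that] k(3) by (auto simp: \<omega>_def)
  have k0: "k 0 = 0" "deriv k 0 = 1" using k(2,3)[of 0] G(3,4) by simp_all
  have \<omega>0: "\<omega> 0 = 0" using k0 by (simp add: \<omega>_def p_def)
  have "(\<omega> has_field_derivative 1) (at 0)"
  proof -
    have "p 0 = 0" by (simp add: p_def)
    have "0 \<in> g ` ball 0 1" using pin[of 0] by (simp add: p_def)
    then have "(k has_field_derivative 1) (at (p 0))"
      using holomorphic_derivI[OF k(1) op, of 0] k0 \<open>p 0 = 0\<close> by simp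
    then show ?thesis unfolding \<omega>_def using DERIV_chain[of k 1 p 0 1 UNIV] pd by simp
  qed
  then have d\<omega>: "deriv \<omega> 0 = 1" by (rule DERIV_imp_deriv)
  then obtain \<alpha> where \<alpha>: "\<And>z. norm z < 1 \<Longrightarrow> \<omega> z = \<alpha> * z"
    using Schwarz_Lemma(3)[OF \<omega> \<omega>0, of 0] \<omega>B(1) by auto
  have "(\<omega> has_field_derivative \<alpha>) (at 0)"
    by (rule has_field_derivative_transform_within_open[of "\<lambda>z. \<alpha> * z" _ _ "ball 0 1"])
      (use \<alpha> in \<open>auto intro!: derivative_eq_intros\<close>)
  then have "\<alpha> = 1" using d\<omega> DERIV_imp_deriv by metis
  then have gp: "g z = p z" if "z \<in> ball 0 1" for z
    using \<alpha>[of z] \<omega>B(2)[OF that] that by simp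
  define z where "z = csqrt \<zeta>"
  have z2: "z\<^sup>2 = \<zeta>" by (simp add: z_def)
  have "(norm z)\<^sup>2 < 1" using \<zeta> z2 by (metis mem_ball_0 norm_power)
  then have z: "z \<in> ball 0 1" by (simp add: power_less_one_iff)
  have "f \<zeta> = (p z)\<^sup>2" using g2[OF z] gp[OF z] z2 by simp
  then show ?thesis by (simp add: p_def power_divide z2)
qed

text \<open>
  A rotation of \<open>f\<close> reduces the claim to \<open>a\<^sub>2 = -2\<close>.
\<close>
theorem class_S_a2_extremal:
  assumes f: "f \<in> class_S" and a2: "norm (fps_nth (fps_expansion f 0) 2) = 2"
  shows "is_rotation_of f koebe"
proof -
  note F = class_SD[OF f]
  define A where "A = fps_expansion f 0"
  define c where "c = -2 / fps_nth A 2"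
  have nc: "norm c = 1" using a2 by (simp add: c_def norm_divide A_def)
  then have c0: "c \<noteq> 0" by auto
  have a2c: "c * fps_nth A 2 = -2" using a2 by (auto simp: c_def A_def)
  define g where "g = (\<lambda>z. 1 / c * f (c * z))"
  have cb: "c * z \<in> ball 0 1" if "z \<in> ball 0 1" for z using that nc by (simp add: norm_mult)
  have fc: "(f \<circ> (\<lambda>z. c * z)) holomorphic_on ball 0 1"
  proof (rule holomorphic_on_compose_gen[OF _ F(1)])
    show "(\<lambda>z. c * z) holomorphic_on ball 0 1" by (intro holomorphic_intros)
  qed (use cb in auto)
  then have ghol: "g holomorphic_on ball 0 1"
    unfolding g_def o_def by (intro holomorphic_intros) (use c0 in auto)
  have ginj: "inj_on g (ball 0 1)"
  proof (rule inj_onI)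
    fix x y assume xy: "x \<in> ball 0 1" "y \<in> ball 0 1" "g x = g y"
    then have "f (c * x) = f (c * y)" using c0 by (simp add: g_def)
    then have "c * x = c * y" using F(2) cb xy by (meson inj_onD)
    then show "x = y" using c0 by simp
  qed
  have G: "fps_expansion g 0 = fps_const (1 / c) * (A oo (fps_const c * fps_X))"
  proof (rule fps_expansion_unique_complex)
    show "g has_fps_expansion fps_expansion g 0" by (rule holomorphic_has_fps_expansion[OF ghol]) simp
    have "(f \<circ> (\<lambda>z. c * z)) has_fps_expansion (A oo (fps_const c * fps_X))"
      unfolding A_def by (intro has_fps_expansion_compose F(5) fps_expansion_intros) auto
    then have "(\<lambda>z. 1 / c * (f \<circ> (\<lambda>z. c * z)) z) has_fps_expansion (fps_const (1 / c) * (A oo (fps_const c * fps_X)))"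
      by (rule has_fps_expansion_cmult_left)
    then show "g has_fps_expansion (fps_const (1 / c) * (A oo (fps_const c * fps_X)))"
      by (simp add: g_def o_def)
  qed
  have Gn: "fps_nth (fps_expansion g 0) k = c ^ k * fps_nth A k / c" for k
    unfolding G fps_compose_linear by simp
  have g: "g \<in> class_S"
    unfolding class_S_def using ghol ginj Gn[of 0] Gn[of 1] F c0
    by (simp add: analytic_on_open fps_nth_fps_expansion_0 A_def)
  have "fps_nth (fps_expansion g 0) 2 = -2" using Gn[of 2] a2c c0 by (simp add: power2_eq_square)
  then have gz: "g z = z / (1 + z)\<^sup>2" if "z \<in> ball 0 1" for z
    using class_S_a2_eq_minus_2[OF g _ that] by simp
  \<comment> \<open>\<open>z / (1 + z)\<^sup>2\<close> is the rotation of \<open>koebe\<close> by \<open>-1\<close>\<close>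
  define \<theta> where "\<theta> = Arg (- 1 / c)"
  have \<theta>: "exp (\<i> * of_real \<theta>) = - 1 / c"
    using Arg_eq[of "- 1 / c"] nc c0 by (simp add: \<theta>_def norm_divide)
  have \<theta>': "exp (- \<i> * of_real \<theta>) = - c"
    using \<theta> c0 by (simp add: exp_minus)
  show ?thesis
    unfolding is_rotation_of_def
  proof (intro exI[of _ \<theta>] ballI)
    fix z :: complex assume z: "z \<in> ball 0 1"
    then have "z / c \<in> ball 0 1" using nc by (simp add: norm_divide)
    then have "g (z / c) = z / c / (1 + z / c)\<^sup>2" by (rule gz)
    then have "c * g (z / c) = c * (z / c / (1 + z / c)\<^sup>2)" by (rule arg_cong)
    then have "f z = z / (1 + z / c)\<^sup>2" using c0 by (simp add: g_def)
    then show "f z = exp (- \<i> * of_real \<theta>) * koebe (exp (\<i> * of_real \<theta>) * z)"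
      unfolding \<theta> \<theta>' using c0 by (simp add: koebe_def)
  qed
qed

section \<open>The Koebe function and the main theorem\<close>

lemma koebe_eq:
  assumes "z \<noteq> 1"
  shows "1 + 4 * koebe z = ((1 + z) / (1 - z))\<^sup>2"
  using assms by (simp add: koebe_def power_divide field_simps) (simp add: power2_eq_square algebra_simps)

lemma Re_cayley_pos:
  assumes "z \<in> ball 0 1"
  shows "Re ((1 + z) / (1 - z)) > 0"
proof -
  have z: "norm z < 1" using assms by simp
  then have "z \<noteq> 1" by auto
  have "(norm z)\<^sup>2 < 1" using z by (simp add: power_less_one_iff)
  then have "(Re z)\<^sup>2 + (Im z)\<^sup>2 < 1" by (simp add: cmod_power2)
  then have "Re ((1 + z) * cnj (1 - z)) > 0" by (simp add: algebra_simps power2_eq_square)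
  moreover have "Re ((1 + z) / (1 - z)) = Re ((1 + z) * cnj (1 - z)) / (norm (1 - z))\<^sup>2"
    by (metis Re_divide_of_real complex_div_cnj of_real_power)
  ultimately show ?thesis using \<open>z \<noteq> 1\<close> by simp
qed

lemma koebe_image: "koebe ` ball 0 1 = {w. 1 + 4 * w \<notin> \<real>\<^sub>\<le>\<^sub>0}"
proof safe
  fix z :: complex assume z: "z \<in> ball 0 1" and "1 + 4 * koebe z \<in> \<real>\<^sub>\<le>\<^sub>0"
  define s where "s = (1 + z) / (1 - z)"
  have "z \<noteq> 1" using z by auto
  then have "s\<^sup>2 \<in> \<real>\<^sub>\<le>\<^sub>0" using \<open>1 + 4 * koebe z \<in> \<real>\<^sub>\<le>\<^sub>0\<close> koebe_eq by (simp add: s_def)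
  then have "Re (s\<^sup>2) \<le> 0" "Im (s\<^sup>2) = 0" by (auto simp: complex_nonpos_Reals_iff)
  moreover have "Re s > 0" using Re_cayley_pos[OF z] by (simp add: s_def)
  ultimately show False by (simp add: Re_power2 Im_power2)
next
  fix w :: complex assume w: "1 + 4 * w \<notin> \<real>\<^sub>\<le>\<^sub>0"
  define s where "s = csqrt (1 + 4 * w)"
  have s2: "s\<^sup>2 = 1 + 4 * w" by (simp add: s_def)
  have "Re s \<ge> 0" using csqrt_principal[of "1 + 4 * w"] by (auto simp: s_def)
  moreover have "Re s \<noteq> 0"
  proof
    assume "Re s = 0"
    then have "Re (s\<^sup>2) \<le> 0" "Im (s\<^sup>2) = 0" by (auto simp: Re_power2 Im_power2)
    then show False using w s2 by (simp add: complex_nonpos_Reals_iff)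
  qed
  ultimately have Re: "Re s > 0" by simp
  then have s1: "s + 1 \<noteq> 0" by (auto simp: complex_eq_iff)
  define z where "z = (s - 1) / (s + 1)"
  have "(norm (s - 1))\<^sup>2 < (norm (s + 1))\<^sup>2" unfolding cmod_power2
    using Re by (simp add: power2_eq_square algebra_simps)
  then have "norm (s - 1) < norm (s + 1)" by (rule power_less_imp_less_base) simp
  then have z: "norm z < 1" using s1 by (simp add: z_def norm_divide)
  have "1 - z = 2 / (s + 1)" "1 + z = 2 * s / (s + 1)" using s1 by (simp_all add: z_def field_simps)
  then have "(1 + z) / (1 - z) = s" using s1 by simp
  moreover have "z \<noteq> 1" using z by auto
  ultimately have "koebe z = w" using koebe_eq[of z] s2 by simp
  then show "w \<in> koebe ` ball 0 1" using z by force
qed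

text \<open>
  Starlikeness is read off from \<open>koebe_image\<close>: the omitted set is a ray on the negative axis that points
  away from the origin.
\<close>
lemma koebe_in_class_S_star: "koebe \<in> class_S_star"
proof -
  have ne: "1 - z \<noteq> 0" if "z \<in> ball 0 1" for z :: complex using that by auto
  have hol: "koebe holomorphic_on ball 0 1"
    unfolding koebe_def using ne by (intro holomorphic_intros) auto
  have inj: "inj_on koebe (ball 0 1)"
  proof (rule inj_onI)
    fix x y :: complex assume xy: "x \<in> ball 0 1" "y \<in> ball 0 1" "koebe x = koebe y"
    then have "x \<noteq> 1" "y \<noteq> 1" by auto
    then have "((1 + x) / (1 - x))\<^sup>2 = ((1 + y) / (1 - y))\<^sup>2"
      using koebe_eq[of x] koebe_eq[of y] xy(3) by simp
    then have "(1 + x) / (1 - x) = (1 + y) / (1 - y) \<or> (1 + x) / (1 - x) = - ((1 + y) / (1 - y))"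
      by (simp add: power2_eq_iff)
    moreover have "(1 + x) / (1 - x) \<noteq> - ((1 + y) / (1 - y))"
      using Re_cayley_pos[OF xy(1)] Re_cayley_pos[OF xy(2)] by (smt (verit) uminus_complex.sel(1))
    ultimately have "(1 + x) * (1 - y) = (1 + y) * (1 - x)" using ne xy by (simp add: frac_eq_eq)
    then show "x = y" by (simp add: algebra_simps)
  qed
  have "(koebe has_field_derivative 1) (at 0)"
    unfolding koebe_def by (auto intro!: derivative_eq_intros)
  then have "koebe \<in> class_S"
    unfolding class_S_def using hol inj by (auto simp: analytic_on_open koebe_def DERIV_imp_deriv)
  moreover have "closed_segment 0 w \<subseteq> koebe ` ball 0 1" if "w \<in> koebe ` ball 0 1" for w
  proof
    fix v assume "v \<in> closed_segment 0 w"
    then obtain t where t: "0 \<le> t" "t \<le> 1" "v = of_real t * w"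
      by (auto simp: closed_segment_def scaleR_conv_of_real)
    have w: "1 + 4 * w \<notin> \<real>\<^sub>\<le>\<^sub>0" using that by (simp add: koebe_image)
    have "1 + 4 * v \<notin> \<real>\<^sub>\<le>\<^sub>0"
    proof
      assume "1 + 4 * v \<in> \<real>\<^sub>\<le>\<^sub>0"
      then have v: "1 + 4 * (t * Re w) \<le> 0" "t * Im w = 0" by (auto simp: complex_nonpos_Reals_iff t(3))
      then have "t \<noteq> 0" by auto
      then have "Im w = 0" using v by simp
      moreover have "Re w \<le> t * Re w"
      proof -
        have "t * Re w < 0" using v by simp
        then have "Re w < 0" using t(1) by (simp add: mult_less_0_iff)
        then show ?thesis using t(2) mult_right_mono_neg[of t 1 "Re w"] by simp
      qed
      ultimately show False using w v by (auto simp: complex_nonpos_Reals_iff)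
    qed
    then show "v \<in> koebe ` ball 0 1" by (simp add: koebe_image)
  qed
  ultimately show ?thesis by (simp add: class_S_star_def)
qed

theorem theorem1:
  fixes \<C> :: "(complex \<Rightarrow> complex) set" and n :: nat
  assumes "\<C> = class_S \<or> \<C> = class_S_star" and "n \<ge> 1"
  shows "(\<forall>f\<in>\<C>. cmod (log_inverse_coeff f n) \<le> 1 / (2 * real n) * real ((2 * n) choose n)) \<and>
         (\<exists>f\<in>\<C>. cmod (log_inverse_coeff f n) = 1 / (2 * real n) * real ((2 * n) choose n)) \<and>
         (\<forall>f\<in>\<C>. cmod (log_inverse_coeff f n) = 1 / (2 * real n) * real ((2 * n) choose n)
                   \<longleftrightarrow> is_rotation_of f koebe)"
proof -
  have sub: "\<C> \<subseteq> class_S" and kC: "koebe \<in> \<C>"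
    using assms(1) koebe_in_class_S_star by (auto simp: class_S_star_def)
  have n0: "real n > 0" using assms(2) by simp
  have eq_iff: "cmod (log_inverse_coeff f n) = 1 / (2 * real n) * real ((2 * n) choose n)
    \<longleftrightarrow> 2 * real n * cmod (log_inverse_coeff f n) = real ((2 * n) choose n)" for f
    using n0 by (auto simp: field_simps)
  have main: "2 * real n * cmod (log_inverse_coeff f n) \<le> real ((2 * n) choose n)"
    and char: "2 * real n * cmod (log_inverse_coeff f n) = real ((2 * n) choose n) \<longleftrightarrow> is_rotation_of f koebe"
    if f: "f \<in> class_S" for f
  proof -
    define a where "a = norm (fps_nth (fps_expansion f 0) 2)"
    have a: "0 \<le> a" "a \<le> 2" using class_S_a2_le_2[OF f] by (auto simp: a_def)
    have b: "2 * real n * cmod (log_inverse_coeff f n) \<le> real ((2 * n) choose n) - (2 ^ n - a ^ n)"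
      using class_S_log_inverse_coeff_bound[OF f assms(2)] by (simp add: a_def)
    have an: "a ^ n \<le> 2 ^ n" using a by (intro power_mono)
    show "2 * real n * cmod (log_inverse_coeff f n) \<le> real ((2 * n) choose n)" using b an by linarith
    show "2 * real n * cmod (log_inverse_coeff f n) = real ((2 * n) choose n) \<longleftrightarrow> is_rotation_of f koebe"
    proof
      assume "2 * real n * cmod (log_inverse_coeff f n) = real ((2 * n) choose n)"
      then have "2 ^ n \<le> a ^ n" using b by linarith
      then have "2 \<le> a" using a(1) assms(2) by (subst (asm) power_mono_iff) auto
      then show "is_rotation_of f koebe"
        using a(2) by (intro class_S_a2_extremal[OF f]) (simp add: a_def)
    qed (rule koebe_rotation_log_inverse_coeff[OF f _ assms(2)])
  qed
  have "is_rotation_of koebe koebe" unfolding is_rotation_of_def by (intro exI[of _ 0]) simp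
  then have "cmod (log_inverse_coeff koebe n) = 1 / (2 * real n) * real ((2 * n) choose n)"
    using char kC sub eq_iff by blast
  moreover have "cmod (log_inverse_coeff f n) \<le> 1 / (2 * real n) * real ((2 * n) choose n)" if "f \<in> \<C>" for f
    using main[of f] that sub n0 by (auto simp: field_simps)
  ultimately show ?thesis using kC char sub eq_iff by blast
qed

end
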